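(* Let $G=\{G_t, t\in\mathbb{R}\}$ be a measurable process with stationary increments satisfying assumption $(\mathcal{A})$ (recalled in the context), and let $\theta>0$. Then: (a) The process $Z_t=\int_{-\infty}^t e^{-\theta(t-s)}dG_s$, $t\ge 0$, which is the solution of the equation $dZ_t=-\theta Z_t\,dt+dG_t$, $t\ge 0$, with $Z_0=\int_{-\infty}^0 e^{\theta s}dG_s$, is a stationary process. (b) Assume in addition that the function $\rho_G(t):=E(G_t^2)$, $t\in\mathbb{R}$, is twice continuously differentiable on $\mathbb{R}\setminus\{0\}$. Let $X_t=e^{-\theta t}\int_0^t e^{\theta r}dG_r$, $t\ge0$. Then, provided that the integrals below converge, $$E(Z_tZ_0)=e^{-\theta t}E(Z_0^2)+\frac{e^{-\theta t}}{2}\int_0^t\int_{-\infty}^0 e^{\theta u}e^{\theta v}\rho_G''(v-u)\,du\,dv,\qquad t\ge 0,$$ $$E(X_sX_t)=e^{-\theta(t-s)}E(X_s^2)+\frac{e^{-\theta t}e^{-\theta s}}{2}\int_s^t e^{\theta v}\int_0^s e^{\theta u}\rho_G''(v-u)\,du\,dv,\qquad 0\le s\le t,$$ there is a constant $C>0$ such that $$\left|E(X_t^2)-E(Z_0^2)\right|\le Ce^{-\theta t},\qquad t\ge 0,$$ and $$E(Z_0^2)=\frac{\theta}{2}\int_0^\infty e^{-\theta t}\rho_G(t)\,dt.$$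
   Context: Assumption $(\mathcal{A})$ on a measurable process $G=\{G_t,t\in\mathbb{R}\}$: $G_0=0$ a.s., and there is a constant $\gamma\in(0,1)$ such that for every $q\ge 2$ there is a constant $c_q>0$ with $E[|G_t-G_s|^q]\le c_q|t-s|^{q\gamma}$ for all $s,t\in\mathbb{R}$. By Kolmogorov–Centsov, $G$ has a modification with $(\gamma-\varepsilon)$-Hölder continuous paths on compact intervals for every $\varepsilon\in(0,\gamma)$; $G$ denotes this modification. A process $G$ has stationary increments if for every $s\in\mathbb{R}$ the processes $\{G_t-G_0,t\in\mathbb{R}\}$ and $\{G_{t+s}-G_s,t\in\mathbb{R}\}$ have the same finite-dimensional distributions. The integrals $\int_s^t e^{\theta r}dG_r$ are pathwise Riemann–Stieltjes integrals, and for $\theta>0$, $\int_{-\infty}^t e^{\theta r}dG_r$ is the (almost surely convergent) improper Riemann–Stieltjes integral. *)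

theory Defs
  imports "HOL-Probability.Probability"
begin

section \<open>Riemann--Stieltjes integrals\<close>

text \<open>
  The mesh of a tagged division is the largest length of its cells; \<^term>\<open>Inf K\<close>, \<^term>\<open>Sup K\<close>
  are the end points of a cell \<^term>\<open>K\<close>. Degenerate cells are allowed and contribute \<^term>\<open>0::real\<close> to the sum.
\<close>

definition has_rs_integral ::
    "(real \<Rightarrow> real) \<Rightarrow> (real \<Rightarrow> real) \<Rightarrow> real \<Rightarrow> real \<Rightarrow> real \<Rightarrow> bool" where
  "has_rs_integral f g a b I \<longleftrightarrow>
     (\<forall>e>0. \<exists>d>0. \<forall>p. p tagged_division_of {a..b} \<and> (\<forall>(x, K)\<in>p. Sup K - Inf K < d) \<longrightarrow>
        \<bar>(\<Sum>(x, K)\<in>p. f x * (g (Sup K) - g (Inf K))) - I\<bar> < e)"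

definition rs_integral :: "(real \<Rightarrow> real) \<Rightarrow> (real \<Rightarrow> real) \<Rightarrow> real \<Rightarrow> real \<Rightarrow> real" where
  "rs_integral f g a b = (THE I. has_rs_integral f g a b I)"

text \<open>The improper integral of \<^term>\<open>f\<close> with respect to \<^term>\<open>g\<close> over \<^term>\<open>{..b::real}\<close>.\<close>

definition has_rs_integral_bot ::
    "(real \<Rightarrow> real) \<Rightarrow> (real \<Rightarrow> real) \<Rightarrow> real \<Rightarrow> real \<Rightarrow> bool" where
  "has_rs_integral_bot f g b I \<longleftrightarrow>
     (\<forall>a\<le>b. \<exists>J. has_rs_integral f g a b J) \<and> ((\<lambda>a. rs_integral f g a b) \<longlongrightarrow> I) at_bot"

definition rs_integral_bot :: "(real \<Rightarrow> real) \<Rightarrow> (real \<Rightarrow> real) \<Rightarrow> real \<Rightarrow> real" where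
  "rs_integral_bot f g b = (THE I. has_rs_integral_bot f g b I)"

section \<open>Processes\<close>

definition measurable_process :: "'a measure \<Rightarrow> (real \<Rightarrow> 'a \<Rightarrow> real) \<Rightarrow> bool" where
  "measurable_process M G \<longleftrightarrow> (\<lambda>(t, \<omega>). G t \<omega>) \<in> borel_measurable (borel \<Otimes>\<^sub>M M)"

text \<open>
  Equality of finite-dimensional distributions. It is meaningful only for families of random
  variables, because \<^const>\<open>distr\<close> is not the image measure along a non-measurable map.
\<close>

definition same_fdd ::
    "'a measure \<Rightarrow> real set \<Rightarrow> (real \<Rightarrow> 'a \<Rightarrow> real) \<Rightarrow> (real \<Rightarrow> 'a \<Rightarrow> real) \<Rightarrow> bool" where
  "same_fdd M T X Y \<longleftrightarrow>
     (\<forall>J. finite J \<and> J \<subseteq> T \<longrightarrow>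
        distr M (\<Pi>\<^sub>M j\<in>J. borel) (\<lambda>\<omega>. \<lambda>j\<in>J. X j \<omega>) =
        distr M (\<Pi>\<^sub>M j\<in>J. borel) (\<lambda>\<omega>. \<lambda>j\<in>J. Y j \<omega>))"

definition stationary_increments :: "'a measure \<Rightarrow> (real \<Rightarrow> 'a \<Rightarrow> real) \<Rightarrow> bool" where
  "stationary_increments M G \<longleftrightarrow>
     (\<forall>s. same_fdd M UNIV (\<lambda>t \<omega>. G t \<omega> - G 0 \<omega>) (\<lambda>t \<omega>. G (t + s) \<omega> - G s \<omega>))"

definition stationary_process :: "'a measure \<Rightarrow> (real \<Rightarrow> 'a \<Rightarrow> real) \<Rightarrow> bool" where
  "stationary_process M Z \<longleftrightarrow>
     (\<forall>t\<ge>0. Z t \<in> borel_measurable M) \<and>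
     (\<forall>h\<ge>0. same_fdd M {0..} (\<lambda>t \<omega>. Z (t + h) \<omega>) Z)"

definition assumption_A :: "'a measure \<Rightarrow> (real \<Rightarrow> 'a \<Rightarrow> real) \<Rightarrow> real \<Rightarrow> bool" where
  "assumption_A M G \<gamma> \<longleftrightarrow>
     (AE \<omega> in M. G 0 \<omega> = 0) \<and> 0 < \<gamma> \<and> \<gamma> < 1 \<and>
     (\<forall>q\<ge>2. \<exists>c>0. \<forall>s t.
        integrable M (\<lambda>\<omega>. \<bar>G t \<omega> - G s \<omega>\<bar> powr q) \<and>
        (\<integral>\<omega>. \<bar>G t \<omega> - G s \<omega>\<bar> powr q \<partial>M) \<le> c * \<bar>t - s\<bar> powr (q * \<gamma>))"

text \<open>
  The path property of the Kolmogorov--Centsov modification, which is the version of the process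
  that is used throughout. It is required of every path.
\<close>

definition holder_paths :: "'a measure \<Rightarrow> (real \<Rightarrow> 'a \<Rightarrow> real) \<Rightarrow> real \<Rightarrow> bool" where
  "holder_paths M G \<gamma> \<longleftrightarrow>
     (\<forall>\<omega>\<in>space M. \<forall>\<epsilon>. 0 < \<epsilon> \<and> \<epsilon> < \<gamma> \<longrightarrow>
        (\<forall>a b. \<exists>C. \<forall>s\<in>{a..b}. \<forall>t\<in>{a..b}. \<bar>G t \<omega> - G s \<omega>\<bar> \<le> C * \<bar>t - s\<bar> powr (\<gamma> - \<epsilon>)))"

section \<open>Ornstein--Uhlenbeck processes driven by \<open>G\<close>\<close>

definition ou_Z :: "real \<Rightarrow> (real \<Rightarrow> 'a \<Rightarrow> real) \<Rightarrow> real \<Rightarrow> 'a \<Rightarrow> real" where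
  "ou_Z \<theta> G t \<omega> = rs_integral_bot (\<lambda>s. exp (- \<theta> * (t - s))) (\<lambda>s. G s \<omega>) t"

definition ou_X :: "real \<Rightarrow> (real \<Rightarrow> 'a \<Rightarrow> real) \<Rightarrow> real \<Rightarrow> 'a \<Rightarrow> real" where
  "ou_X \<theta> G t \<omega> = exp (- \<theta> * t) * rs_integral (\<lambda>r. exp (\<theta> * r)) (\<lambda>r. G r \<omega>) 0 t"

text \<open>
  The equation \<open>dz\<^sub>t = -\<theta> z\<^sub>t dt + dg\<^sub>t\<close>, \<open>t \<ge> 0\<close>, with initial value \<open>z0\<close>, for a single
  path and in integrated form.
\<close>

definition solves_langevin ::
    "real \<Rightarrow> (real \<Rightarrow> real) \<Rightarrow> real \<Rightarrow> (real \<Rightarrow> real) \<Rightarrow> bool" where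
  "solves_langevin \<theta> g z0 z \<longleftrightarrow>
     (\<forall>t\<ge>0. z integrable_on {0..t} \<and> z t = z0 - \<theta> * integral {0..t} z + (g t - g 0))"

definition rho :: "'a measure \<Rightarrow> (real \<Rightarrow> 'a \<Rightarrow> real) \<Rightarrow> real \<Rightarrow> real" where
  "rho M G t = (\<integral>\<omega>. (G t \<omega>)\<^sup>2 \<partial>M)"

definition C2_off_zero :: "(real \<Rightarrow> real) \<Rightarrow> bool" where
  "C2_off_zero f \<longleftrightarrow>
     (\<forall>t. t \<noteq> 0 \<longrightarrow> f differentiable (at t) \<and> deriv f differentiable (at t)) \<and>
     continuous_on (- {0}) (deriv (deriv f))"

text \<open>
  Convergence of the iterated integral of \<^term>\<open>\<lambda>u v. k u v\<close>, inner variable \<^term>\<open>u\<close> in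
  \<^term>\<open>A\<close> and outer variable \<^term>\<open>v\<close> in \<^term>\<open>{a..b::real}\<close>. Henstock--Kurzweil integrability
  covers both absolutely convergent and improper integrals. The inner integral is not required to
  converge at the single point \<^term>\<open>v = (a::real)\<close>, where the kernels considered here are
  singular.
\<close>

definition iterated_converges :: "(real \<Rightarrow> real \<Rightarrow> real) \<Rightarrow> real set \<Rightarrow> real \<Rightarrow> real \<Rightarrow> bool" where
  "iterated_converges k A a b \<longleftrightarrow>
     (\<forall>v\<in>{a<..b}. (\<lambda>u. k u v) integrable_on A) \<and>
     (\<lambda>v. integral A (\<lambda>u. k u v)) integrable_on {a..b}"

end

theory Submission
  imports Defs
begin

text \<open>
  Everything rests on integration by parts. For a continuous path \<open>g\<close> and an exponential
  integrand the Riemann--Stieltjes integral exists and equals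
  \<open>exp(\<theta>b) g(b) - exp(\<theta>a) g(a) - \<theta> \<integral>\<^sub>a\<^sup>b exp(\<theta>s) g(s) ds\<close>
  (\<open>has_rs_integral_by_parts\<close>, \<open>exp_has_rs_integral\<close>), so statements about \<open>dG\<close> become
  statements about ordinary integrals of \<open>G\<close>.

  \<^emph>\<open>Existence.\<close> Dyadic chaining with the moment of order \<open>2/\<gamma>\<close> shows that almost every path
  grows at most quadratically at \<open>-\<infinity>\<close> (\<open>AE_quadratic_growth\<close>). Hence the improper integrals
  converge and \<open>Z\<^sub>t = G\<^sub>t - \<theta> exp(-\<theta>t) \<integral>\<^sub>-\<^sub>\<infinity>\<^sup>t exp(\<theta>s) G\<^sub>s ds\<close>, which solves the
  Langevin equation by differentiation; two solutions differ by a solution of \<open>w' = -\<theta>w\<close>,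
  \<open>w(0) = 0\<close>.

  \<^emph>\<open>Stationarity.\<close> \<open>Z\<^sub>t\<close> is an almost sure limit of integrals over bounded intervals, and these
  are limits of finite linear combinations of increments of \<open>G\<close>. The law of such a combination
  does not change when time is shifted (\<open>distr_rs_sum_shift\<close>), and equality in law survives
  almost sure limits (\<open>distr_PiM_eq_limit\<close>).

  \<^emph>\<open>Second moments.\<close> Stationary increments give
  \<open>E(G\<^sub>s G\<^sub>t) = (\<rho>(s) + \<rho>(t) - \<rho>(t - s)) / 2\<close>, and Fubini's theorem carries this to
  integrals of \<open>G\<close> (\<open>expectation_mult_exp_integral\<close>). Let \<open>U\<close> be \<open>Z\<^sub>0\<close> or
  \<open>\<integral>\<^sub>0\<^sup>s exp(\<theta>r) dG\<^sub>r\<close>. Then \<open>\<psi>(v) = E(U G\<^sub>v)\<close> is an explicit expression in \<open>\<rho>\<close> and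
  \<open>A(v) = \<integral>\<^sub>0\<^sup>v exp(-\<theta>x) \<rho>(x) dx\<close>, and integration by parts gives
  \<open>E(U \<integral>\<^sub>s\<^sup>t exp(\<theta>v) dG\<^sub>v) = \<integral>\<^sub>s\<^sup>t exp(\<theta>v) \<psi>'(v) dv\<close>, where \<open>\<psi>'\<close> is needed only inside the
  interval (\<open>expectation_mult_wiener\<close>, \<open>exp_mult_deriv_has_integral\<close>). Finally
  \<open>exp(\<theta>v) \<psi>'(v)\<close> is half of the inner integral in the claim, because
  \<open>B(w) = exp(-\<theta>w) (\<rho>'(w) + \<theta> \<rho>(w)) + \<theta>^2 A(w)\<close> has derivative \<open>exp(-\<theta>w) \<rho>''(w)\<close>.
  When the integral to infinity converges, \<open>exp(-\<theta>w) \<rho>'(w)\<close> has a limit there, which must be zero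
  since \<open>\<rho>\<close> grows at most quadratically (\<open>integral_atMost_exp_deriv_deriv_rho\<close>).

  \<^emph>\<open>Variances.\<close> \<open>E(Z\<^sub>0^2)\<close> is a double integral of the covariance, which reduces to the
  Laplace transform of \<open>\<rho>\<close> by splitting a quadrant along its diagonal
  (\<open>exp_smooth_rho_integral\<close>). The estimate for \<open>E(X\<^sub>t^2)\<close> follows from \<open>X\<^sub>t = Z\<^sub>t - exp(-\<theta>t) Z\<^sub>0\<close> and stationarity.
\<close>

section \<open>Riemann--Stieltjes integration by parts\<close>

lemma fine_tagged_division_mesh:
  fixes a b d :: real
  assumes "d > 0"
  obtains p where "p tagged_division_of {a..b}" "\<forall>(x, K)\<in>p. Sup K - Inf K < d"
proof -
  have "gauge (\<lambda>x::real. ball x (d / 2))"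
    using assms by (simp add: gauge_ball_dependent)
  then obtain p where p: "p tagged_division_of {a..b}" "(\<lambda>x. ball x (d / 2)) fine p"
    by (rule fine_division_exists_real)
  have "Sup K - Inf K < d" if xKp: "(x, K) \<in> p" for x K
  proof -
    obtain u v where K: "K = cbox u v"
      using tagged_division_ofD(4)[OF p(1) xKp] by blast
    have xK: "x \<in> K"
      using tagged_division_ofD(2)[OF p(1) that] .
    have "K \<subseteq> ball x (d / 2)"
      using p(2) that by (auto simp: fine_def)
    moreover have "u \<in> K" "v \<in> K" "u \<le> v"
      using xK K by auto
    ultimately have "dist x u < d / 2" "dist x v < d / 2" "u \<le> v"
      by auto
    then have "v - u < d"
      unfolding dist_real_def by arith
    then show ?thesis
      using K \<open>u \<le> v\<close> by simp
  qed
  then show thesis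
    using p(1) that by blast
qed

definition rs_sum :: "(real \<Rightarrow> real) \<Rightarrow> (real \<Rightarrow> real) \<Rightarrow> (real \<times> real set) set \<Rightarrow> real" where
  "rs_sum f g p = (\<Sum>(x, K)\<in>p. f x * (g (Sup K) - g (Inf K)))"

text \<open>
  One sequence of partitions serves all integrands and integrators at once. Hence an integral
  against a random path is a pointwise limit of fixed finite linear combinations of its increments.
\<close>

lemma universal_rs_partitions:
  fixes a b :: real
  obtains p where "\<And>n. finite (p n)"
    "\<And>f g I. has_rs_integral f g a b I \<Longrightarrow> (\<lambda>n. rs_sum f g (p n)) \<longlonglongrightarrow> I"
proof -
  have "\<exists>p. p tagged_division_of {a..b} \<and> (\<forall>(x, K)\<in>p. Sup K - Inf K < 1 / (real n + 1))" for n
    by (rule fine_tagged_division_mesh[of "1 / (real n + 1)" a b]) auto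
  then obtain p where "\<forall>n. p n tagged_division_of {a..b} \<and> (\<forall>(x, K)\<in>p n. Sup K - Inf K < 1 / (real n + 1))"
    by metis
  then have p: "\<And>n. p n tagged_division_of {a..b}"
    "\<And>n x K. (x, K) \<in> p n \<Longrightarrow> Sup K - Inf K < 1 / (real n + 1)"
    by auto
  show thesis
  proof (rule that[of p])
    show "finite (p n)" for n
      using p(1) by (rule tagged_division_of_finite)
    fix f g I
    assume I: "has_rs_integral f g a b I"
    show "(\<lambda>n. rs_sum f g (p n)) \<longlonglongrightarrow> I"
    proof (rule LIMSEQ_I)
      fix e :: real
      assume "e > 0"
      then obtain d where d: "d > 0"
        and dp: "\<And>q. q tagged_division_of {a..b} \<Longrightarrow> \<forall>(x, K)\<in>q. Sup K - Inf K < d \<Longrightarrow>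
          \<bar>(\<Sum>(x, K)\<in>q. f x * (g (Sup K) - g (Inf K))) - I\<bar> < e"
        using I unfolding has_rs_integral_def by meson
      obtain N :: nat where N: "1 / d < real N"
        using reals_Archimedean2 by blast
      have "norm (rs_sum f g (p n) - I) < e" if "n \<ge> N" for n
      proof -
        have "1 / d < real n + 1"
          using N that by linarith
        then have "1 / (real n + 1) < d"
          using d by (simp add: field_simps)
        then have "\<forall>(x, K)\<in>p n. Sup K - Inf K < d"
          using p(2) by fastforce
        then show ?thesis
          unfolding rs_sum_def real_norm_def by (rule dp[OF p(1)])
      qed
      then show "\<exists>N. \<forall>n\<ge>N. norm (rs_sum f g (p n) - I) < e"
        by blast
    qed
  qed
qed

lemma has_rs_integral_unique:
  assumes "has_rs_integral f g a b I" "has_rs_integral f g a b J"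
  shows "I = J"
proof -
  obtain p where "\<And>n. finite (p n)"
    "\<And>f g I. has_rs_integral f g a b I \<Longrightarrow> (\<lambda>n. rs_sum f g (p n)) \<longlonglongrightarrow> I"
    using universal_rs_partitions[of a b] by blast
  then show ?thesis
    using assms LIMSEQ_unique by blast
qed

lemma rs_integral_eqI: "has_rs_integral f g a b I \<Longrightarrow> rs_integral f g a b = I"
  unfolding rs_integral_def by (blast intro: has_rs_integral_unique)

lemma rs_integral_bot_eqI:
  assumes "has_rs_integral_bot f g b I"
  shows "rs_integral_bot f g b = I"
  unfolding rs_integral_bot_def
proof (rule the_equality)
  show "has_rs_integral_bot f g b I"
    by fact
  show "J = I" if "has_rs_integral_bot f g b J" for J
    using that assms tendsto_unique[of at_bot "\<lambda>a. rs_integral f g a b" J I]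
    by (auto simp: has_rs_integral_bot_def)
qed

text \<open>
  With \<open>H(t) = f(t) g(t) - \<integral>\<^sub>a\<^sup>t f' g\<close>, a cell \<open>[u, v]\<close> with tag \<open>x\<close> contributes
  \<open>f(x) (g(v) - g(u)) - (H(v) - H(u)) = \<integral>\<^sub>u\<^sup>x f'(r) (g(r) - g(u)) dr + \<integral>\<^sub>x\<^sup>v f'(r) (g(r) - g(v)) dr\<close>
  to the error. This is at most the length of the cell times \<open>sup |f'|\<close> times the oscillation of
  \<open>g\<close> at the scale of the mesh, and the increments of \<open>H\<close> telescope over the division.
\<close>

theorem has_rs_integral_by_parts:
  fixes f g f' :: "real \<Rightarrow> real"
  assumes "a \<le> b"
    and f: "\<And>x. x \<in> {a..b} \<Longrightarrow> (f has_real_derivative f' x) (at x within {a..b})"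
    and f': "continuous_on {a..b} f'" and g: "continuous_on {a..b} g"
  shows "has_rs_integral f g a b (f b * g b - f a * g a - integral {a..b} (\<lambda>x. f' x * g x))"
  unfolding has_rs_integral_def
proof (intro allI impI)
  fix e :: real
  assume "e > 0"
  define H where "H t = f t * g t - integral {a..t} (\<lambda>x. f' x * g x)" for t
  have "compact (f' ` {a..b})"
    using f' by (intro compact_continuous_image) auto
  then obtain B where B: "B > 0" "\<And>x. x \<in> {a..b} \<Longrightarrow> \<bar>f' x\<bar> \<le> B"
    by (auto dest!: compact_imp_bounded simp: bounded_pos)
  \<comment> \<open>chosen so that the total error \<open>B \<eta> (b - a)\<close> stays below \<open>e\<close>\<close>
  define \<eta> where "\<eta> = e / (B * (b - a + 1))"
  have \<eta>: "\<eta> > 0"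
    using \<open>e > 0\<close> B \<open>a \<le> b\<close> by (simp add: \<eta>_def)
  have "uniformly_continuous_on {a..b} g"
    using g by (intro compact_uniformly_continuous) auto
  then obtain d where d: "d > 0"
    and dg: "\<And>r s. r \<in> {a..b} \<Longrightarrow> s \<in> {a..b} \<Longrightarrow> \<bar>r - s\<bar> < d \<Longrightarrow> \<bar>g r - g s\<bar> < \<eta>"
    using \<eta> unfolding uniformly_continuous_on_def dist_real_def by metis
  have int_f'g: "(\<lambda>x. f' x * g x) integrable_on {a..b}"
    using f' g by (intro integrable_continuous_real continuous_intros)
  have cell: "\<bar>f x * (g v - g u) - (H v - H u)\<bar> \<le> (B * \<eta>) * (v - u)"
    if "a \<le> u" "u \<le> x" "x \<le> v" "v \<le> b" "v - u < d" for u x v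
  proof -
    have ftc: "f q - f p = integral {p..q} f'" if "a \<le> p" "p \<le> q" "q \<le> b" for p q
    proof (rule integral_unique[symmetric], rule fundamental_theorem_of_calculus)
      show "(f has_vector_derivative f' y) (at y within {p..q})" if "y \<in> {p..q}" for y
        using f[of y] that \<open>a \<le> p\<close> \<open>q \<le> b\<close>
        by (auto simp: has_real_derivative_iff_has_vector_derivative[symmetric] intro: DERIV_subset)
    qed (use that in auto)
    have part: "\<bar>integral {p..q} (\<lambda>r. f' r * (g r - g c))\<bar> \<le> (B * \<eta>) * (q - p)"
      "integral {p..q} (\<lambda>r. f' r * (g r - g c)) =
        integral {p..q} (\<lambda>r. f' r * g r) - g c * (f q - f p)"
      if "u \<le> p" "p \<le> q" "q \<le> v" "c \<in> {p..q}" for p q c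
    proof -
      have cf: "continuous_on {p..q} f'" "continuous_on {p..q} g"
        using f' g that \<open>a \<le> u\<close> \<open>v \<le> b\<close> by (auto elim!: continuous_on_subset)
      have bd: "norm (f' r * (g r - g c)) \<le> B * \<eta>" if "r \<in> {p..q}" for r
      proof -
        have "\<bar>r - c\<bar> < d"
          using that \<open>c \<in> {p..q}\<close> \<open>u \<le> p\<close> \<open>q \<le> v\<close> \<open>v - u < d\<close> by (auto simp: abs_if)
        then have "\<bar>g r - g c\<bar> \<le> \<eta>"
          using that \<open>c \<in> {p..q}\<close> \<open>u \<le> p\<close> \<open>q \<le> v\<close> \<open>a \<le> u\<close> \<open>v \<le> b\<close> by (intro less_imp_le dg) auto
        moreover have "\<bar>f' r\<bar> \<le> B"
          using that \<open>u \<le> p\<close> \<open>q \<le> v\<close> \<open>a \<le> u\<close> \<open>v \<le> b\<close> by (intro B) auto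
        ultimately show ?thesis
          using B(1) by (auto simp: abs_mult intro!: mult_mono)
      qed
      have "norm (integral {p..q} (\<lambda>r. f' r * (g r - g c))) \<le> (B * \<eta>) * (q - p)"
        using \<open>p \<le> q\<close> cf bd by (intro integral_bound continuous_intros) auto
      then show "\<bar>integral {p..q} (\<lambda>r. f' r * (g r - g c))\<bar> \<le> (B * \<eta>) * (q - p)"
        by simp
      have "integral {p..q} (\<lambda>r. f' r * (g r - g c)) =
          integral {p..q} (\<lambda>r. f' r * g r - g c * f' r)"
        by (simp add: algebra_simps)
      also have "\<dots> = integral {p..q} (\<lambda>r. f' r * g r) - integral {p..q} (\<lambda>r. g c * f' r)"
        using cf by (intro integral_diff integrable_continuous_real continuous_intros)
      finally show "integral {p..q} (\<lambda>r. f' r * (g r - g c)) =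
          integral {p..q} (\<lambda>r. f' r * g r) - g c * (f q - f p)"
        using that \<open>a \<le> u\<close> \<open>v \<le> b\<close> by (simp add: ftc)
    qed
    have split: "integral {a..q} (\<lambda>r. f' r * g r) =
        integral {a..p} (\<lambda>r. f' r * g r) + integral {p..q} (\<lambda>r. f' r * g r)"
      if "a \<le> p" "p \<le> q" "q \<le> b" for p q
      using that int_f'g
      by (intro Henstock_Kurzweil_Integration.integral_combine[symmetric]) (auto intro: integrable_on_subinterval)
    have "f x * (g v - g u) - (H v - H u) =
        integral {u..x} (\<lambda>r. f' r * (g r - g u)) + integral {x..v} (\<lambda>r. f' r * (g r - g v))"
    proof -
      have "integral {u..x} (\<lambda>r. f' r * (g r - g u)) =
          integral {u..x} (\<lambda>r. f' r * g r) - g u * (f x - f u)"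
        "integral {x..v} (\<lambda>r. f' r * (g r - g v)) =
          integral {x..v} (\<lambda>r. f' r * g r) - g v * (f v - f x)"
        using that by (auto intro!: part(2))
      moreover have "H x = f x * g x - integral {a..u} (\<lambda>r. f' r * g r) - integral {u..x} (\<lambda>r. f' r * g r)"
        "H v = f v * g v - integral {a..x} (\<lambda>r. f' r * g r) - integral {x..v} (\<lambda>r. f' r * g r)"
        "H u = f u * g u - integral {a..u} (\<lambda>r. f' r * g r)"
        "H x = f x * g x - integral {a..x} (\<lambda>r. f' r * g r)"
        using that split[of u x] split[of x v] by (auto simp: H_def)
      ultimately show ?thesis
        by (simp add: right_diff_distrib mult.commute)
    qed
    also have "\<bar>\<dots>\<bar> \<le> (B * \<eta>) * (x - u) + (B * \<eta>) * (v - x)"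
      using that by (intro order.trans[OF abs_triangle_ineq] add_mono part(1)) auto
    finally show ?thesis
      by (simp add: algebra_simps)
  qed
  show "\<exists>d>0. \<forall>p. p tagged_division_of {a..b} \<and> (\<forall>(x, K)\<in>p. Sup K - Inf K < d) \<longrightarrow>
        \<bar>(\<Sum>(x, K)\<in>p. f x * (g (Sup K) - g (Inf K)))
          - (f b * g b - f a * g a - integral {a..b} (\<lambda>x. f' x * g x))\<bar> < e"
  proof (intro exI[of _ d] conjI allI impI)
    fix p
    assume p: "p tagged_division_of {a..b} \<and> (\<forall>(x, K)\<in>p. Sup K - Inf K < d)"
    have tele: "(\<Sum>(x, K)\<in>p. h (Sup K) - h (Inf K)) = h b - h a" for h :: "real \<Rightarrow> real"
      using additive_tagged_division_1[OF \<open>a \<le> b\<close>, of p h] p by simp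
    have "\<bar>(\<Sum>(x, K)\<in>p. f x * (g (Sup K) - g (Inf K))) - (H b - H a)\<bar> =
        \<bar>\<Sum>(x, K)\<in>p. f x * (g (Sup K) - g (Inf K)) - (H (Sup K) - H (Inf K))\<bar>"
      unfolding tele[symmetric] by (simp add: sum_subtractf[symmetric] split_def)
    also have "\<dots> \<le> (\<Sum>(x, K)\<in>p. (B * \<eta>) * (Sup K - Inf K))"
    proof (rule order.trans[OF sum_abs], rule sum_mono, clarify)
      fix x K
      assume xK: "(x, K) \<in> p"
      obtain u v where K: "K = cbox u v"
        using tagged_division_ofD(4)[of p "{a..b}" x K] p xK by blast
      have "x \<in> K" "K \<subseteq> {a..b}"
        using tagged_division_ofD(2,3)[of p "{a..b}" x K] p xK by blast+
      then have "a \<le> u" "u \<le> x" "x \<le> v" "v \<le> b" "Sup K = v" "Inf K = u"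
        using K by auto
      then show "\<bar>f x * (g (Sup K) - g (Inf K)) - (H (Sup K) - H (Inf K))\<bar>
          \<le> (B * \<eta>) * (Sup K - Inf K)"
        using p xK by (auto intro!: cell)
    qed
    also have "\<dots> = (B * \<eta>) * (b - a)"
      using tele[of "\<lambda>x. x"] by (simp add: sum_distrib_left[symmetric] split_def)
    also have "\<dots> = e * ((b - a) / (b - a + 1))"
      using B \<open>a \<le> b\<close> by (simp add: \<eta>_def)
    also have "\<dots> < e * 1"
      using \<open>a \<le> b\<close> \<open>e > 0\<close> by (intro mult_strict_left_mono) auto
    also have "e * 1 = e"
      by simp
    finally show "\<bar>(\<Sum>(x, K)\<in>p. f x * (g (Sup K) - g (Inf K)))
          - (f b * g b - f a * g a - integral {a..b} (\<lambda>x. f' x * g x))\<bar> < e"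
      by (simp add: H_def algebra_simps)
  qed (use d in auto)
qed

section \<open>Integrals against an exponential weight\<close>

lemma one_plus_square_le_exp:
  fixes c x :: real
  assumes "c > 0" "x \<ge> 0"
  shows "1 + x^2 \<le> (1 + 2 / c^2) * exp (c * x)"
proof -
  have "1 + c * x + (c * x)^2 / 2 \<le> exp (c * x)"
    using assms by (intro exp_lower_Taylor_quadratic) simp
  moreover have "0 \<le> c * x"
    using assms by simp
  ultimately have "(c * x)^2 / 2 \<le> exp (c * x)" "1 \<le> exp (c * x)"
    by (auto intro: order.trans)
  then have "1 + x^2 \<le> exp (c * x) + 2 / c^2 * exp (c * x)"
    using assms by (intro add_mono) (auto simp: field_simps power_mult_distrib)
  then show ?thesis
    by (simp add: distrib_right)
qed

lemma exp_minus_set_integrable: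
  fixes c :: real
  assumes "c > 0"
  shows "set_integrable lborel {0..} (\<lambda>x. exp (- c * x))"
    and "(LBINT x:{0..}. exp (- c * x)) = 1 / c"
proof -
  show int: "set_integrable lborel {0..} (\<lambda>x. exp (- c * x))"
  proof -
    have "(\<integral>\<^sup>+x. ennreal (exp (- c * x)) * indicator {0..} x \<partial>lborel) = ennreal (0 - (- exp (- c * 0) / c))"
    proof (rule nn_integral_FTC_atLeast)
      show "((\<lambda>x. - exp (- c * x) / c) has_real_derivative exp (- c * x)) (at x)" for x
        using assms by (auto intro!: derivative_eq_intros)
      have "filterlim (\<lambda>x. - c * x) at_bot at_top"
        using assms by (intro filterlim_tendsto_neg_mult_at_bot[OF tendsto_const]) (auto simp: filterlim_ident)
      then have "((\<lambda>x. exp (- c * x)) \<longlongrightarrow> 0) at_top"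
        by (rule filterlim_compose[OF exp_at_bot])
      then show "((\<lambda>x. - exp (- c * x) / c) \<longlongrightarrow> 0) at_top"
        using tendsto_divide[OF tendsto_minus[of _ 0] tendsto_const, of _ _ c] assms by simp
    qed auto
    then have "(\<integral>\<^sup>+x. ennreal (norm (indicator {0..} x *\<^sub>R exp (- c * x))) \<partial>lborel) < \<infinity>"
      by (simp add: indicator_mult_ennreal ennreal_mult'[symmetric] mult.commute)
    then show ?thesis
      unfolding set_integrable_def by (intro integrableI_bounded) auto
  qed
  show "(LBINT x:{0..}. exp (- c * x)) = 1 / c"
    using integral_unique[OF has_integral_exp_minus_to_infinity[OF assms, of 0]]
      set_borel_integral_eq_integral(2)[OF int] by (simp only: mult_zero_right exp_zero)
qed

lemma set_lborel_integral_Un_point: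
  fixes f :: "real \<Rightarrow> real"
  assumes int: "set_integrable lborel (A \<union> B) f"
    and A: "A \<in> sets borel" and B: "B \<in> sets borel" and "A \<inter> B \<subseteq> {x}"
  shows "(LBINT s:A \<union> B. f s) = (LBINT s:A. f s) + (LBINT s:B. f s)"
proof (rule set_integral_Un_AE)
  show "AE s in lborel. \<not> (s \<in> A \<and> s \<in> B)"
    using AE_lborel_singleton[of x] by eventually_elim (use \<open>A \<inter> B \<subseteq> {x}\<close> in blast)
  show "set_integrable lborel A f" "set_integrable lborel B f"
    using A B by (auto intro: set_integrable_subset[OF int])
qed (use A B in simp_all)

lemma set_integrable_reflect_real:
  fixes f :: "real \<Rightarrow> real"
  shows "set_integrable lborel {..0} f \<longleftrightarrow> set_integrable lborel {0..} (\<lambda>x. f (- x))"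
    and "(LBINT x:{..0}. f x) = (LBINT x:{0..}. f (- x))"
proof -
  have ind: "indicator {..0} (- x) = (indicator {0..} x :: real)" for x :: real
    by (auto simp: indicator_def)
  show "set_integrable lborel {..0} f \<longleftrightarrow> set_integrable lborel {0..} (\<lambda>x. f (- x))"
    using lborel_integrable_real_affine_iff[of "-1" "\<lambda>x. indicator {..0} x *\<^sub>R f x" 0]
    by (simp add: set_integrable_def ind)
  show "(LBINT x:{..0}. f x) = (LBINT x:{0..}. f (- x))"
    using lborel_integral_real_affine[of "-1" "\<lambda>x. indicator {..0} x *\<^sub>R f x" 0]
    by (simp add: set_lebesgue_integral_def ind)
qed

text \<open>Half of the exponential decay absorbs any quadratic growth.\<close>

lemma exp_mult_quadratic_le:
  fixes f :: "real \<Rightarrow> real"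
  assumes "c > 0" and bound: "\<And>x. x \<le> 0 \<Longrightarrow> \<bar>f x\<bar> \<le> C * (1 + x^2)" and "x \<le> 0"
  shows "\<bar>exp (c * x) * f x\<bar> \<le> C * (1 + 2 / (c / 2)^2) * exp (c / 2 * x)"
proof -
  define K where "K = 1 + 2 / (c / 2)^2"
  have "0 \<le> C"
    using order.trans[OF abs_ge_zero bound[of 0]] by simp
  have "1 + (- x)^2 \<le> K * exp (c / 2 * - x)"
    unfolding K_def using assms by (intro one_plus_square_le_exp) auto
  then have "\<bar>f x\<bar> \<le> C * (K * exp (- (c / 2 * x)))"
    using \<open>0 \<le> C\<close> by (intro order.trans[OF bound[OF \<open>x \<le> 0\<close>]] mult_left_mono) auto
  then have "exp (c * x) * \<bar>f x\<bar> \<le> exp (c * x) * (C * (K * exp (- (c / 2 * x))))"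
    by (intro mult_left_mono) auto
  also have "\<dots> = C * K * (exp (c * x) * exp (- (c / 2 * x)))"
    by (simp add: ac_simps)
  also have "exp (c * x) * exp (- (c / 2 * x)) = exp (c / 2 * x)"
    by (simp add: exp_add[symmetric])
  finally show ?thesis
    by (simp add: abs_mult K_def)
qed

lemma exp_mult_set_integrable_atMost:
  fixes f :: "real \<Rightarrow> real"
  assumes "c > 0" and [measurable]: "f \<in> borel_measurable borel"
    and bound: "\<And>x. x \<le> 0 \<Longrightarrow> \<bar>f x\<bar> \<le> C * (1 + x^2)"
  shows "set_integrable lborel {..0} (\<lambda>x. exp (c * x) * f x)"
proof -
  define K where "K = 1 + 2 / (c / 2)^2"
  have "set_integrable lborel {..0} (\<lambda>x. C * K * exp (c / 2 * x))"
    using assms exp_minus_set_integrable(1)[of "c / 2"]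
    by (auto simp: set_integrable_reflect_real(1))
  then show ?thesis
  proof (rule set_integrable_bound)
    show "set_borel_measurable lborel {..0} (\<lambda>x. exp (c * x) * f x)"
      unfolding set_borel_measurable_def by measurable
    have "norm (exp (c * x) * f x) \<le> norm (C * K * exp (c / 2 * x))" if "x \<le> 0" for x
      unfolding K_def real_norm_def
      by (rule order.trans[OF exp_mult_quadratic_le[OF \<open>c > 0\<close> bound that] abs_ge_self])
    then show "AE x in lborel. x \<in> {..0} \<longrightarrow> norm (exp (c * x) * f x) \<le> norm (C * K * exp (c / 2 * x))"
      by auto
  qed
qed

lemma exp_mult_tendsto_0_at_bot:
  fixes f :: "real \<Rightarrow> real"
  assumes "c > 0" and bound: "\<And>x. x \<le> 0 \<Longrightarrow> \<bar>f x\<bar> \<le> C * (1 + x^2)"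
  shows "((\<lambda>x. exp (c * x) * f x) \<longlongrightarrow> 0) at_bot"
proof (rule Lim_null_comparison)
  show "\<forall>\<^sub>F x in at_bot. norm (exp (c * x) * f x) \<le> C * (1 + 2 / (c / 2)^2) * exp (c / 2 * x)"
    using eventually_le_at_bot[of "0::real"]
    by eventually_elim (use exp_mult_quadratic_le[OF assms] in simp)
  have "((\<lambda>x. exp (c / 2 * x)) \<longlongrightarrow> 0) at_bot"
    using assms
    by (intro filterlim_compose[OF exp_at_bot] filterlim_tendsto_pos_mult_at_bot[where c="c / 2"] filterlim_ident) auto
  then show "((\<lambda>x. C * (1 + 2 / (c / 2)^2) * exp (c / 2 * x)) \<longlongrightarrow> 0) at_bot"
    by (rule tendsto_mult_right_zero)
qed

lemma exp_minus_mult_diff: "exp (- c * (t - s)) = exp (- c * t) * exp (c * s)" for c s t :: real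
  by (simp add: exp_add[symmetric] right_diff_distrib)

lemma exp_has_rs_integral:
  fixes g :: "real \<Rightarrow> real"
  assumes "a \<le> b" and g: "continuous_on {a..b} g"
  shows "has_rs_integral (\<lambda>s. exp (- c * (t - s))) g a b
    (exp (- c * (t - b)) * g b - exp (- c * (t - a)) * g a
      - c * exp (- c * t) * (LBINT s:{a..b}. exp (c * s) * g s))"
proof -
  have "has_rs_integral (\<lambda>s. exp (- c * (t - s))) g a b
    (exp (- c * (t - b)) * g b - exp (- c * (t - a)) * g a
      - integral {a..b} (\<lambda>s. c * exp (- c * (t - s)) * g s))"
    using assms by (intro has_rs_integral_by_parts) (auto intro!: derivative_eq_intros continuous_intros)
  moreover have "(LBINT s:{a..b}. exp (c * s) * g s) = integral {a..b} (\<lambda>s. exp (c * s) * g s)"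
    using g by (intro set_borel_integral_eq_integral borel_integrable_atLeastAtMost' continuous_intros)
  moreover have "(\<lambda>s. c * exp (- c * (t - s)) * g s) = (\<lambda>s. c * exp (- c * t) * (exp (c * s) * g s))"
    by (simp only: exp_minus_mult_diff mult.assoc)
  ultimately show ?thesis
    by simp
qed

lemma exp_mult_set_integrable_tail:
  fixes g :: "real \<Rightarrow> real"
  assumes "c > 0" and g: "continuous_on UNIV g"
    and bound: "\<And>x. x \<le> 0 \<Longrightarrow> \<bar>g x\<bar> \<le> C * (1 + x^2)"
  shows "set_integrable lborel {..t} (\<lambda>x. exp (c * x) * g x)"
proof -
  have "set_integrable lborel ({..0} \<union> {0..t}) (\<lambda>x. exp (c * x) * g x)"
    using assms
    by (intro set_integrable_Un exp_mult_set_integrable_atMost[where C=C] borel_integrable_atLeastAtMost'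
        borel_measurable_continuous_onI continuous_intros)
       (auto intro: continuous_on_subset)
  then show ?thesis
    by (rule set_integrable_subset) auto
qed

text \<open>
  Quadratic growth makes both the boundary term \<open>exp(ca) g(a)\<close> vanish and the remaining integral
  converge absolutely as \<open>a \<rightarrow> -\<infinity>\<close>.
\<close>

lemma exp_has_rs_integral_bot:
  fixes g :: "real \<Rightarrow> real"
  assumes "c > 0" and g: "continuous_on UNIV g"
    and bound: "\<And>x. x \<le> 0 \<Longrightarrow> \<bar>g x\<bar> \<le> C * (1 + x^2)"
  shows "has_rs_integral_bot (\<lambda>s. exp (- c * (t - s))) g t
    (g t - c * exp (- c * t) * (LBINT s:{..t}. exp (c * s) * g s))"
  unfolding has_rs_integral_bot_def
proof (intro conjI allI impI)
  have rs: "has_rs_integral (\<lambda>s. exp (- c * (t - s))) g a t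
    (g t - exp (- c * (t - a)) * g a
      - c * exp (- c * t) * (LBINT s:{a..t}. exp (c * s) * g s))" if "a \<le> t" for a
    using exp_has_rs_integral[OF that, of g c t] continuous_on_subset[OF g] by simp
  then show "\<exists>J. has_rs_integral (\<lambda>s. exp (- c * (t - s))) g a t J" if "a \<le> t" for a
    using that by blast
  have "((\<lambda>a. exp (- c * t) * (exp (c * a) * g a)) \<longlongrightarrow> 0) at_bot"
    using assms by (intro tendsto_mult_right_zero exp_mult_tendsto_0_at_bot[where C=C])
  then have "((\<lambda>a. exp (- c * (t - a)) * g a) \<longlongrightarrow> 0) at_bot"
    by (simp only: exp_minus_mult_diff mult.assoc)
  moreover have "((\<lambda>a. LBINT s:{a..t}. exp (c * s) * g s) \<longlongrightarrow>
      (LBINT s:{..t}. exp (c * s) * g s)) at_bot"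
    using exp_mult_set_integrable_tail[OF assms] by (intro tendsto_set_lebesgue_integral_at_bot) auto
  ultimately have "((\<lambda>a. g t - exp (- c * (t - a)) * g a
      - c * exp (- c * t) * (LBINT s:{a..t}. exp (c * s) * g s)) \<longlongrightarrow>
    g t - 0 - c * exp (- c * t) * (LBINT s:{..t}. exp (c * s) * g s)) at_bot"
    by (intro tendsto_intros)
  then show "((\<lambda>a. rs_integral (\<lambda>s. exp (- c * (t - s))) g a t) \<longlongrightarrow>
    g t - c * exp (- c * t) * (LBINT s:{..t}. exp (c * s) * g s)) at_bot"
    by (subst tendsto_cong[OF eventually_mono[OF eventually_le_at_bot[of t]]])
       (auto dest!: rs rs_integral_eqI)
qed

section \<open>The Langevin equation along one path\<close>

text \<open>
  Variation of constants: \<open>Y(t) = z(t) - g(t)\<close> satisfies \<open>Y' = - c Y - c g = - c z\<close>. The free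
  parameter \<open>I\<close> will be \<open>\<integral>\<^sub>-\<^sub>\<infinity>\<^sup>0 exp(cs) g(s) ds\<close>.
\<close>

lemma solves_langevin_exp:
  fixes g :: "real \<Rightarrow> real"
  assumes g: "continuous_on {0..} g"
  shows "solves_langevin c g (g 0 - c * I)
    (\<lambda>t. g t - c * exp (- c * t) * (I + integral {0..t} (\<lambda>s. exp (c * s) * g s)))"
    (is "solves_langevin c g _ ?z")
  unfolding solves_langevin_def
proof (intro allI impI)
  fix t :: real
  assume "t \<ge> 0"
  define P where "P u = integral {0..u} (\<lambda>s. exp (c * s) * g s)" for u
  define Y where "Y u = - c * exp (- c * u) * (I + P u)" for u
  have cont: "continuous_on {0..t} (\<lambda>s. exp (c * s) * g s)"
    using g by (intro continuous_intros) (auto elim: continuous_on_subset)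
  have "((\<lambda>u. - c * ?z u) has_integral (Y t - Y 0)) {0..t}"
  proof (rule fundamental_theorem_of_calculus[OF \<open>t \<ge> 0\<close>])
    fix u
    assume u: "u \<in> {0..t}"
    have "(P has_real_derivative exp (c * u) * g u) (at u within {0..t})"
      unfolding P_def using integral_has_real_derivative[OF cont u] .
    then have "(Y has_real_derivative - c * (- c * exp (- c * u) * (I + P u) + exp (- c * u) * (exp (c * u) * g u)))
      (at u within {0..t})"
      unfolding Y_def by (auto intro!: derivative_eq_intros simp: algebra_simps)
    moreover have "exp (- c * u) * (exp (c * u) * g u) = g u"
      by (simp add: mult.assoc[symmetric] exp_add[symmetric])
    moreover have "- c * ?z u = - c * (- c * exp (- c * u) * (I + P u) + g u)"
      unfolding P_def by (simp add: right_diff_distrib distrib_left)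
    ultimately have "(Y has_real_derivative - c * ?z u) (at u within {0..t})"
      by (simp only:)
    then show "(Y has_vector_derivative - c * ?z u) (at u within {0..t})"
      by (simp only: has_real_derivative_iff_has_vector_derivative)
  qed
  then have 1: "integral {0..t} (\<lambda>u. - c * ?z u) = Y t - Y 0"
    by (rule integral_unique)
  have "continuous_on {0..t} ?z"
    using g indefinite_integral_continuous_1[OF integrable_continuous_real[OF cont]]
    by (intro continuous_intros) (auto elim: continuous_on_subset)
  then have "?z integrable_on {0..t}"
    by (rule integrable_continuous_real)
  moreover have "integral {0..t} (\<lambda>u. - c * ?z u) = - c * integral {0..t} ?z"
    by (rule integral_mult_right)
  ultimately show "?z integrable_on {0..t} \<and> ?z t = g 0 - c * I - c * integral {0..t} ?z + (g t - g 0)"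
    using 1 by (auto simp: Y_def P_def)
qed

lemma solves_langevin_cong:
  assumes eq: "\<And>t. t \<ge> 0 \<Longrightarrow> z t = y t"
  shows "solves_langevin c g z0 z \<longleftrightarrow> solves_langevin c g z0 y"
proof -
  have "z integrable_on {0..t} \<longleftrightarrow> y integrable_on {0..t}" "integral {0..t} z = integral {0..t} y" for t
    using eq by (auto intro!: integrable_cong Henstock_Kurzweil_Integration.integral_cong)
  then show ?thesis
    using eq by (simp add: solves_langevin_def)
qed

text \<open>
  The noise cancels in the difference \<open>w\<close> of two solutions. Its integral \<open>U(t) = \<integral>\<^sub>0\<^sup>t w\<close> satisfies
  \<open>U' = - c U\<close> and \<open>U(0) = 0\<close>, hence \<open>exp(ct) U(t)\<close> is constant.
\<close>

lemma solves_langevin_unique: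
  assumes z: "solves_langevin c g z0 z" and y: "solves_langevin c g z0 y" and "t \<ge> 0"
  shows "z t = y t"
proof -
  define w where "w s = z s - y s" for s
  define U where "U u = integral {0..u} w" for u
  have int: "w integrable_on {0..s}" and w: "w s = - c * U s" if "s \<ge> 0" for s
  proof -
    have *: "z integrable_on {0..s}" "y integrable_on {0..s}"
      using z y that by (auto simp: solves_langevin_def)
    then show "w integrable_on {0..s}"
      unfolding w_def by (intro integrable_diff)
    have "U s = integral {0..s} z - integral {0..s} y"
      unfolding U_def w_def using * by (intro integral_diff)
    moreover have "z s = z0 - c * integral {0..s} z + (g s - g 0)"
      "y s = z0 - c * integral {0..s} y + (g s - g 0)"
      using z y that unfolding solves_langevin_def by blast+
    ultimately show "w s = - c * U s"
      unfolding w_def by (simp add: right_diff_distrib)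
  qed
  have "continuous_on {0..t} U"
    unfolding U_def by (intro indefinite_integral_continuous_1 int \<open>t \<ge> 0\<close>)
  then have "continuous_on {0..t} (\<lambda>s. - c * U s)"
    by (intro continuous_intros)
  then have cw: "continuous_on {0..t} w"
    using w by (subst continuous_on_cong[OF refl]) auto
  have "((\<lambda>u. 0) has_integral (exp (c * t) * U t - exp (c * 0) * U 0)) {0..t}"
  proof (rule fundamental_theorem_of_calculus[OF \<open>t \<ge> 0\<close>])
    fix u
    assume u: "u \<in> {0..t}"
    have "(U has_real_derivative w u) (at u within {0..t})"
      unfolding U_def using integral_has_real_derivative[OF cw u] .
    then have "((\<lambda>u. exp (c * u) * U u) has_real_derivative c * exp (c * u) * U u + exp (c * u) * w u)
      (at u within {0..t})"
      by (auto intro!: derivative_eq_intros)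
    then show "((\<lambda>u. exp (c * u) * U u) has_vector_derivative 0) (at u within {0..t})"
      using w[of u] u by (simp add: has_real_derivative_iff_has_vector_derivative[symmetric])
  qed
  then have "exp (c * t) * U t - exp (c * 0) * U 0 = 0"
    by (rule has_integral_unique[OF _ has_integral_0])
  then have "U t = 0"
    by (simp add: U_def)
  then show ?thesis
    using w[OF \<open>t \<ge> 0\<close>] by (simp add: w_def)
qed

section \<open>Growth of the paths\<close>

text \<open>
  Chaining: a dyadic point of level \<open>k + 1\<close> is either of level \<open>k\<close> or the right neighbour of such
  a point, so each level adds at most \<open>A r^k\<close>. Continuity extends the bound from dyadic points to
  all points.
\<close>

lemma dyadic_increments_bound:
  fixes g :: "real \<Rightarrow> real"
  assumes r: "0 \<le> r" "r < 1"
    and cont: "continuous_on {a..a + 1} g"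
    and inc: "\<And>k i. i < 2 ^ k \<Longrightarrow>
      \<bar>g (a + (real i + 1) / 2 ^ k) - g (a + real i / 2 ^ k)\<bar> \<le> A * r ^ k"
    and t: "t \<in> {a..a + 1}"
  shows "\<bar>g t - g a\<bar> \<le> A / (1 - r)"
proof -
  have "0 \<le> A"
    using order.trans[OF abs_ge_zero inc[of 0 0]] by simp
  have grid: "\<bar>g (a + real i / 2 ^ k) - g a\<bar> \<le> A * (\<Sum>j\<le>k. r ^ j)" if "i \<le> 2 ^ k" for i k
    using that
  proof (induction k arbitrary: i)
    case 0
    then have "i = 0 \<or> i = 1"
      by auto
    then show ?case
      using inc[of 0 0] \<open>0 \<le> A\<close> by auto
  next
    case (Suc k)
    have even: "\<bar>g (a + real (2 * m) / 2 ^ Suc k) - g a\<bar> \<le> A * (\<Sum>j\<le>k. r ^ j)" if "m \<le> 2 ^ k" for m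
      using Suc.IH[OF that] by simp
    show ?case
    proof (cases "even i")
      case True
      then obtain m where "i = 2 * m"
        by blast
      then have "\<bar>g (a + real i / 2 ^ Suc k) - g a\<bar> \<le> A * (\<Sum>j\<le>k. r ^ j)"
        using even[of m] Suc.prems by simp
      also have "\<dots> \<le> A * (\<Sum>j\<le>Suc k. r ^ j)"
        using \<open>0 \<le> A\<close> r by (intro mult_left_mono) auto
      finally show ?thesis .
    next
      case False
      then obtain m where m: "i = 2 * m + 1"
        by (metis oddE)
      have "m \<le> 2 ^ k" "2 * m < 2 ^ Suc k"
        using m Suc.prems by auto
      then have "\<bar>g (a + real (2 * m) / 2 ^ Suc k) - g a\<bar> \<le> A * (\<Sum>j\<le>k. r ^ j)"
        "\<bar>g (a + (real (2 * m) + 1) / 2 ^ Suc k) - g (a + real (2 * m) / 2 ^ Suc k)\<bar> \<le> A * r ^ Suc k"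
        using even inc by blast+
      moreover have "real i = real (2 * m) + 1"
        using m by simp
      ultimately show ?thesis
        by (simp only: sum.atMost_Suc distrib_left)
    qed
  qed
  have geo: "(\<Sum>j\<le>k. r ^ j) \<le> 1 / (1 - r)" for k
  proof -
    have "(\<Sum>j\<le>k. r ^ j) \<le> (\<Sum>j. r ^ j)"
      using r by (intro sum_le_suminf summable_geometric) auto
    then show ?thesis
      using r by (simp add: suminf_geometric)
  qed
  define N where "N k = nat \<lfloor>(t - a) * 2 ^ k\<rfloor>" for k :: nat
  define x where "x k = a + real (N k) / 2 ^ k" for k :: nat
  have x: "x k \<in> {a..a + 1}" "\<bar>g (x k) - g a\<bar> \<le> A / (1 - r)" "t - (1 / 2) ^ k \<le> x k" "x k \<le> t" for k
  proof -
    have nn: "0 \<le> (t - a) * 2 ^ k"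
      using t by simp
    have le: "(t - a) * 2 ^ k \<le> 2 ^ k"
      using t mult_right_mono[of "t - a" 1 "2 ^ k"] by simp
    have fl: "real (N k) = of_int \<lfloor>(t - a) * 2 ^ k\<rfloor>"
      using nn by (simp add: N_def of_nat_nat)
    have up: "real (N k) \<le> (t - a) * 2 ^ k"
      and lo: "(t - a) * 2 ^ k \<le> real (N k) + 1"
      unfolding fl by linarith+
    have "real (N k) \<le> real (2 ^ k)"
      using order.trans[OF up le] unfolding of_nat_power of_nat_numeral .
    then have "N k \<le> 2 ^ k"
      by (rule of_nat_le_iff[THEN iffD1])
    then have "\<bar>g (x k) - g a\<bar> \<le> A * (\<Sum>j\<le>k. r ^ j)"
      unfolding x_def by (rule grid)
    also have "\<dots> \<le> A * (1 / (1 - r))"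
      using geo \<open>0 \<le> A\<close> by (intro mult_left_mono)
    finally show "\<bar>g (x k) - g a\<bar> \<le> A / (1 - r)"
      by simp
    have "real (N k) / 2 ^ k \<le> t - a"
      using up by (simp only: pos_divide_le_eq zero_less_power zero_less_numeral)
    moreover have "t - a - (1 / 2) ^ k \<le> real (N k) / 2 ^ k"
    proof -
      have "t - a \<le> (real (N k) + 1) / 2 ^ k"
        using lo by (simp only: pos_le_divide_eq zero_less_power zero_less_numeral)
      then show ?thesis
        by (simp add: add_divide_distrib power_one_over)
    qed
    moreover have "0 \<le> real (N k) / 2 ^ k"
      by simp
    ultimately show "x k \<in> {a..a + 1}" "t - (1 / 2) ^ k \<le> x k" "x k \<le> t"
      using t unfolding x_def atLeastAtMost_iff by linarith+
  qed
  have "(\<lambda>k. t - (1 / 2) ^ k) \<longlonglongrightarrow> t - 0"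
    by (intro tendsto_diff tendsto_const LIMSEQ_power_zero) auto
  then have "x \<longlonglongrightarrow> t"
    using x(3,4) by (intro tendsto_sandwich[of "\<lambda>k. t - (1 / 2) ^ k" x _ "\<lambda>_. t"]) auto
  then have "(\<lambda>k. g (x k)) \<longlonglongrightarrow> g t"
    using cont t x(1) by (auto intro: continuous_on_tendsto_compose)
  then have "(\<lambda>k. \<bar>g (x k) - g a\<bar>) \<longlonglongrightarrow> \<bar>g t - g a\<bar>"
    by (intro tendsto_intros)
  then show ?thesis
    by (rule LIMSEQ_le_const2) (use x(2) in auto)
qed

lemma quadratic_bound_from_unit_intervals:
  fixes g :: "real \<Rightarrow> real"
  assumes inc: "\<And>n t. t \<in> {- (real n + 1)..- real n} \<Longrightarrow> \<bar>g t - g (- (real n + 1))\<bar> \<le> K * (real n + 1)"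
    and "t \<le> 0"
  shows "\<bar>g t - g 0\<bar> \<le> 6 * K * (1 + t^2)"
proof -
  have "0 \<le> K"
    using order.trans[OF abs_ge_zero inc[of 0 0]] by simp
  have grid: "\<bar>g (- real n) - g 0\<bar> \<le> K * (real n)^2" for n
  proof (induction n)
    case (Suc n)
    have "\<bar>g (- real n) - g (- (real n + 1))\<bar> \<le> K * (real n + 1)"
      by (rule inc) auto
    then have "\<bar>g (- (real n + 1)) - g 0\<bar> \<le> K * (real n)^2 + K * (real n + 1)"
      using Suc by linarith
    also have "\<dots> = K * ((real n)^2 + (real n + 1))"
      by (simp add: distrib_left)
    also have "\<dots> \<le> K * (real (Suc n))^2"
      using \<open>0 \<le> K\<close> by (intro mult_left_mono) (auto simp: power2_eq_square algebra_simps)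
    finally show ?case
      by (simp add: add.commute)
  qed simp
  define n where "n = nat \<lfloor>- t\<rfloor>"
  have n: "real n \<le> - t" "- t \<le> real n + 1"
    using \<open>t \<le> 0\<close> unfolding n_def by linarith+
  have n2: "(real n + 1)^2 \<le> 2 * (1 + t^2)"
  proof -
    have "(real n + 1)^2 \<le> (1 - t)^2"
      using n by (intro power_mono) auto
    also have "\<dots> \<le> 2 * (1 + t^2)"
      using zero_le_power2[of "1 + t"] by (simp add: power2_eq_square algebra_simps)
    finally show ?thesis .
  qed
  have "\<bar>g t - g (- (real n + 1))\<bar> \<le> K * (real n + 1)"
    "\<bar>g (- real n) - g (- (real n + 1))\<bar> \<le> K * (real n + 1)"
    using n by (intro inc; simp)+
  moreover have "K * (real n + 1) \<le> K * (real n + 1)^2" "K * (real n)^2 \<le> K * (real n + 1)^2"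
    using \<open>0 \<le> K\<close> by (auto intro!: mult_left_mono power_mono self_le_power)
  ultimately have "\<bar>g t - g 0\<bar> \<le> 3 * (K * (real n + 1)^2)"
    using grid[of n] by linarith
  also have "\<dots> \<le> 3 * (K * (2 * (1 + t^2)))"
    using \<open>0 \<le> K\<close> n2 by (intro mult_left_mono) auto
  finally show ?thesis
    by (simp add: algebra_simps)
qed

text \<open>
  The weighted sum \<open>V\<close> of \<open>q\<close>-th powers of all dyadic increments has finite expectation: level \<open>k\<close>
  of a unit interval consists of \<open>2^k\<close> increments of \<open>q\<close>-th moment at most \<open>c / 4^k\<close>, which leaves room
  for the weight \<open>(3/2)^k\<close>, and the weight \<open>1 / (n + 1)^2\<close> makes the sum over unit intervals finite.
  Where \<open>V\<close> is finite, the increments of level \<open>k\<close> in the \<open>n\<close>-th interval are at most a multiple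
  of \<open>(n + 1)^(2/q) (2/3)^(k/q)\<close>; since \<open>q \<ge> 2\<close>, chaining bounds the oscillation over that interval by
  a multiple of \<open>n + 1\<close>, and these oscillations add up to quadratic growth.
\<close>

lemma (in prob_space) AE_quadratic_growth:
  fixes G :: "real \<Rightarrow> 'a \<Rightarrow> real"
  assumes [measurable]: "\<And>t. G t \<in> borel_measurable M"
    and q: "q \<ge> 2" and c: "c \<ge> 0"
    and int: "\<And>s t. integrable M (\<lambda>\<omega>. \<bar>G t \<omega> - G s \<omega>\<bar> powr q)"
    and mom: "\<And>s t. (\<integral>\<omega>. \<bar>G t \<omega> - G s \<omega>\<bar> powr q \<partial>M) \<le> c * (t - s)^2"
    and cont: "\<And>\<omega>. \<omega> \<in> space M \<Longrightarrow> continuous_on UNIV (\<lambda>t. G t \<omega>)"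
  shows "AE \<omega> in M. \<exists>C. \<forall>t\<le>0. \<bar>G t \<omega> - G 0 \<omega>\<bar> \<le> C * (1 + t^2)"
proof -
  define a where "a n = - (real n + 1)" for n :: nat
  define \<Delta> where "\<Delta> n k i \<omega> = \<bar>G (a n + (real i + 1) / 2 ^ k) \<omega> - G (a n + real i / 2 ^ k) \<omega>\<bar> powr q"
    for n k i :: nat and \<omega>
  define w where "w n k = (3 / 2) ^ k / (real n + 1)^2" for n k :: nat
  have w: "w n k > 0" for n k
    by (simp add: w_def)
  have [measurable]: "\<Delta> n k i \<in> borel_measurable M" for n k i
    unfolding \<Delta>_def by measurable
  define V where "V \<omega> = (\<Sum>n. \<Sum>k. \<Sum>i<2 ^ k. ennreal (w n k * \<Delta> n k i \<omega>))" for \<omega>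
  have [measurable]: "V \<in> borel_measurable M"
    unfolding V_def by measurable
  have E\<Delta>: "(\<integral>\<^sup>+\<omega>. ennreal (w n k * \<Delta> n k i \<omega>) \<partial>M) \<le> ennreal (w n k * (c * (1 / 4) ^ k))" for n k i
  proof -
    have "(\<integral>\<^sup>+\<omega>. ennreal (w n k * \<Delta> n k i \<omega>) \<partial>M) = ennreal (\<integral>\<omega>. w n k * \<Delta> n k i \<omega> \<partial>M)"
      using w[of n k] unfolding \<Delta>_def by (intro nn_integral_eq_integral integrable_mult_right int) auto
    also have "(\<integral>\<omega>. w n k * \<Delta> n k i \<omega> \<partial>M) = w n k * (\<integral>\<omega>. \<Delta> n k i \<omega> \<partial>M)"
      by (rule integral_mult_right_zero)
    also have "ennreal \<dots> \<le> ennreal (w n k * (c * (1 / 4) ^ k))"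
    proof (intro ennreal_leI mult_left_mono)
      have "(\<integral>\<omega>. \<Delta> n k i \<omega> \<partial>M) \<le> c * ((a n + (real i + 1) / 2 ^ k) - (a n + real i / 2 ^ k))^2"
        unfolding \<Delta>_def by (rule mom)
      also have "(a n + (real i + 1) / 2 ^ k) - (a n + real i / 2 ^ k) = (1 / 2) ^ k"
        by (simp add: field_simps power_one_over)
      finally show "(\<integral>\<omega>. \<Delta> n k i \<omega> \<partial>M) \<le> c * (1 / 4) ^ k"
        by (simp add: power2_eq_square power_mult_distrib[symmetric])
    qed (use w[of n k] in auto)
    finally show ?thesis .
  qed
  have "(\<integral>\<^sup>+\<omega>. V \<omega> \<partial>M) = (\<Sum>n. \<Sum>k. \<Sum>i<2 ^ k. \<integral>\<^sup>+\<omega>. ennreal (w n k * \<Delta> n k i \<omega>) \<partial>M)"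
    unfolding V_def by (simp add: nn_integral_suminf nn_integral_sum)
  also have "\<dots> \<le> (\<Sum>n. \<Sum>k. \<Sum>i<(2::nat) ^ k. ennreal (w n k * (c * (1 / 4) ^ k)))"
    by (intro suminf_le sum_mono E\<Delta>) auto
  also have "\<dots> = (\<Sum>n. \<Sum>k. ennreal (c / (real n + 1)^2 * (3 / 4) ^ k))"
  proof -
    have "(\<Sum>i<(2::nat) ^ k. ennreal (w n k * (c * (1 / 4) ^ k))) = ennreal (c / (real n + 1)^2 * (3 / 4) ^ k)" for n k
    proof -
      have "(\<Sum>i<(2::nat) ^ k. ennreal (w n k * (c * (1 / 4) ^ k))) =
          ennreal (\<Sum>i<(2::nat) ^ k. w n k * (c * (1 / 4) ^ k))"
        using w[of n k] c by (intro sum_ennreal) auto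
      also have "(\<Sum>i<(2::nat) ^ k. w n k * (c * (1 / 4) ^ k)) = c / (real n + 1)^2 * (2 ^ k * ((3 / 2) ^ k * (1 / 4) ^ k))"
        by (simp add: w_def)
      also have "2 ^ k * ((3 / 2) ^ k * (1 / 4) ^ k) = (3 / 4 :: real) ^ k"
        by (simp add: power_mult_distrib[symmetric])
      finally show ?thesis .
    qed
    then show ?thesis
      by simp
  qed
  also have "\<dots> = (\<Sum>n. ennreal (c / (real n + 1)^2 * 4))"
  proof (intro suminf_cong suminf_ennreal_eq)
    show "(\<lambda>k. c / (real n + 1)^2 * (3 / 4) ^ k) sums (c / (real n + 1)^2 * 4)" for n
      using sums_mult[OF geometric_sums[of "3 / 4 :: real"], of "c / (real n + 1)^2"] by simp
  qed (use c in auto)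
  also have "\<dots> = ennreal (\<Sum>n. c / (real n + 1)^2 * 4)"
  proof (rule suminf_ennreal2)
    have "summable (\<lambda>n. inverse (real (Suc n) ^ 2))"
      using inverse_power_summable[of 2, where 'a=real] by (subst summable_Suc_iff) auto
    then have "summable (\<lambda>n. 4 * c * inverse (real (Suc n) ^ 2))"
      by (rule summable_mult)
    then show "summable (\<lambda>n. c / (real n + 1)^2 * 4)"
      by (simp add: field_simps)
  qed (use c in auto)
  finally have "(\<integral>\<^sup>+\<omega>. V \<omega> \<partial>M) \<noteq> \<infinity>"
    by (auto simp: top_unique)
  then have "AE \<omega> in M. V \<omega> \<noteq> \<infinity>"
    by (intro nn_integral_PInf_AE) auto
  then show ?thesis
  proof (rule AE_mp, intro AE_I2 impI)
    fix \<omega>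
    assume \<omega>: "\<omega> \<in> space M" and "V \<omega> \<noteq> \<infinity>"
    then obtain v where v: "v \<ge> 0" "V \<omega> = ennreal v"
      by (cases "V \<omega>") auto
    define r where "r = (2 / 3 :: real) powr (1 / q)"
    have r: "0 \<le> r" "r < 1"
      unfolding r_def using q powr_less_mono2[of "1 / q" "2 / 3 :: real" 1] by auto
    define K where "K = v powr (1 / q)"
    have pp: "(x ^ m) powr z = x powr (real m * z)" if "x > 0" for x z :: real and m
      using that by (simp only: powr_realpow[symmetric] powr_powr)
    have inc: "\<bar>G (a n + (real i + 1) / 2 ^ k) \<omega> - G (a n + real i / 2 ^ k) \<omega>\<bar> \<le> (K * (real n + 1)) * r ^ k"
      (is "\<bar>?D\<bar> \<le> _") if "i < 2 ^ k" for n k i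
    proof -
      have "ennreal (w n k * \<Delta> n k i \<omega>) \<le> (\<Sum>i<2 ^ k. ennreal (w n k * \<Delta> n k i \<omega>))"
        using that by (intro member_le_sum) auto
      also have "\<dots> \<le> (\<Sum>k. \<Sum>i<2 ^ k. ennreal (w n k * \<Delta> n k i \<omega>))"
        using sum_le_suminf[of "\<lambda>k. \<Sum>i<2 ^ k. ennreal (w n k * \<Delta> n k i \<omega>)" "{k}"] by simp
      also have "\<dots> \<le> V \<omega>"
        unfolding V_def
        using sum_le_suminf[of "\<lambda>n. \<Sum>k. \<Sum>i<2 ^ k. ennreal (w n k * \<Delta> n k i \<omega>)" "{n}"] by simp
      finally have "w n k * \<Delta> n k i \<omega> \<le> v"
        using v by simp
      then have "\<bar>?D\<bar> powr q \<le> v / w n k"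
        using w[of n k] by (simp add: \<Delta>_def field_simps)
      also have "v / w n k = v * (real n + 1)^2 * (2 / 3) ^ k"
        by (simp add: w_def power_divide)
      finally have "(\<bar>?D\<bar> powr q) powr (1 / q) \<le> (v * (real n + 1)^2 * (2 / 3) ^ k) powr (1 / q)"
        using q by (intro powr_mono2) auto
      also have "(\<bar>?D\<bar> powr q) powr (1 / q) = \<bar>?D\<bar>"
        using q by (simp add: powr_powr)
      also have "(v * (real n + 1)^2 * (2 / 3) ^ k) powr (1 / q) = K * ((real n + 1)^2) powr (1 / q) * r ^ k"
      proof -
        have "((2 / 3 :: real) ^ k) powr (1 / q) = r ^ k"
          unfolding r_def by (simp add: powr_power pp)
        then show ?thesis
          using v by (simp add: powr_mult K_def)
      qed
      also have "\<dots> \<le> K * (real n + 1) * r ^ k"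
      proof (intro mult_right_mono mult_left_mono)
        have "((real n + 1)^2) powr (1 / q) = (real n + 1) powr (2 / q)"
          by (simp add: pp)
        also have "\<dots> \<le> (real n + 1) powr 1"
          using q by (intro powr_mono) auto
        finally show "((real n + 1)^2) powr (1 / q) \<le> real n + 1"
          by simp
      qed (use r in \<open>auto simp: K_def\<close>)
      finally show ?thesis .
    qed
    have unit: "\<bar>G t \<omega> - G (- (real n + 1)) \<omega>\<bar> \<le> K / (1 - r) * (real n + 1)"
      if t: "t \<in> {- (real n + 1)..- real n}" for n t
    proof -
      have "\<bar>G t \<omega> - G (a n) \<omega>\<bar> \<le> K * (real n + 1) / (1 - r)"
      proof (rule dyadic_increments_bound[where g = "\<lambda>t. G t \<omega>" and a = "a n", OF r])
        show "continuous_on {a n..a n + 1} (\<lambda>t. G t \<omega>)"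
          using cont[OF \<omega>] by (rule continuous_on_subset) auto
        show "t \<in> {a n..a n + 1}"
          using t by (simp add: a_def)
      qed (rule inc)
      then show ?thesis
        by (simp add: a_def)
    qed
    show "\<exists>C. \<forall>t\<le>0. \<bar>G t \<omega> - G 0 \<omega>\<bar> \<le> C * (1 + t^2)"
      using quadratic_bound_from_unit_intervals[of "\<lambda>t. G t \<omega>" "K / (1 - r)", OF unit] by blast
  qed
qed

section \<open>Laws of almost sure limits\<close>

lemma finite_bounded_by_nat:
  fixes x :: "'i \<Rightarrow> real"
  assumes "finite J"
  shows "\<exists>n::nat. \<forall>j\<in>J. x j \<le> real n"
proof -
  obtain n :: nat where "Max (insert 0 (x ` J)) \<le> real n"
    using real_arch_simple by blast
  then show ?thesis
    using assms by (auto intro!: exI[of _ n] intro: order.trans)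
qed

text \<open>
  It suffices that coordinates are measurable for the generated sigma-algebra, and a half space
  in one coordinate is a countable union of lower orthants because \<open>J\<close> is finite.
\<close>

lemma sets_PiM_borel_atMost:
  assumes J: "finite J"
  shows "sets (\<Pi>\<^sub>M j\<in>J. (borel :: real measure)) =
    sigma_sets (\<Pi>\<^sub>E j\<in>J. UNIV) {(\<Pi>\<^sub>E j\<in>J. {..a j}) | a. True}" (is "_ = sigma_sets ?\<Omega> ?E")
proof
  have E: "?E \<subseteq> Pow ?\<Omega>"
    by auto
  define N where "N = sigma ?\<Omega> ?E"
  have N: "space N = ?\<Omega>" "sets N = sigma_sets ?\<Omega> ?E"
    using E by (auto simp: N_def space_measure_of sets_measure_of)
  have "sets (\<Pi>\<^sub>M j\<in>J. (borel :: real measure)) \<subseteq> sets N"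
  proof (rule sets_PiM_in_sets)
    show "space N = (\<Pi>\<^sub>E j\<in>J. space borel)"
      using N by simp
    fix i and A :: "real set"
    assume i: "i \<in> J" and A: "A \<in> sets borel"
    have "(\<lambda>x. x i) \<in> borel_measurable N"
    proof (subst borel_measurable_iff_le, intro allI)
      fix c :: real
      have "{x \<in> space N. x i \<le> c} = (\<Union>n::nat. \<Pi>\<^sub>E j\<in>J. {..(if j = i then c else real n)})"
      proof (intro equalityI subsetI)
        fix x
        assume x: "x \<in> {x \<in> space N. x i \<le> c}"
        obtain n :: nat where "\<forall>j\<in>J. x j \<le> real n"
          using finite_bounded_by_nat[OF J] by blast
        then have "x \<in> (\<Pi>\<^sub>E j\<in>J. {..(if j = i then c else real n)})"
          using x N by (auto simp: PiE_iff)
        then show "x \<in> (\<Union>n::nat. \<Pi>\<^sub>E j\<in>J. {..(if j = i then c else real n)})"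
          by blast
      next
        fix x
        assume "x \<in> (\<Union>n::nat. \<Pi>\<^sub>E j\<in>J. {..(if j = i then c else real n)})"
        then show "x \<in> {x \<in> space N. x i \<le> c}"
          using i N by (force simp: PiE_iff)
      qed
      also have "\<dots> \<in> sets N"
      proof (intro sets.countable_UN image_subsetI)
        fix n :: nat
        show "(\<Pi>\<^sub>E j\<in>J. {..(if j = i then c else real n)}) \<in> sets N"
          unfolding N
          by (intro sigma_sets.Basic CollectI exI[of _ "\<lambda>j. if j = i then c else real n"]) simp
      qed
      finally show "{x \<in> space N. x i \<le> c} \<in> sets N" .
    qed
    from measurable_sets[OF this A] show "{x \<in> space N. x i \<in> A} \<in> sets N"
      by (simp add: vimage_def Int_def conj_commute)
  qed
  then show "sets (\<Pi>\<^sub>M j\<in>J. (borel :: real measure)) \<subseteq> sigma_sets ?\<Omega> ?E"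
    by (simp add: N)
  have "sigma_sets (space (\<Pi>\<^sub>M j\<in>J. (borel :: real measure))) ?E \<subseteq> sets (\<Pi>\<^sub>M j\<in>J. (borel :: real measure))"
    using J by (intro sets.sigma_sets_subset) (auto intro!: sets_PiM_I_finite)
  then show "sigma_sets ?\<Omega> ?E \<subseteq> sets (\<Pi>\<^sub>M j\<in>J. (borel :: real measure))"
    by (simp add: space_PiM)
qed

abbreviation (in prob_space) joint_law :: "'i set \<Rightarrow> ('i \<Rightarrow> 'a \<Rightarrow> real) \<Rightarrow> ('i \<Rightarrow> real) measure" where
  "joint_law J X \<equiv> distr M (\<Pi>\<^sub>M j\<in>J. borel) (\<lambda>\<omega>. \<lambda>j\<in>J. X j \<omega>)"

lemma (in prob_space) distr_PiM_eqI_atMost: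
  fixes X Y :: "'i \<Rightarrow> 'a \<Rightarrow> real"
  assumes J: "finite J"
    and [measurable]: "\<And>j. j \<in> J \<Longrightarrow> X j \<in> borel_measurable M" "\<And>j. j \<in> J \<Longrightarrow> Y j \<in> borel_measurable M"
    and eq: "\<And>a. prob {\<omega> \<in> space M. \<forall>j\<in>J. X j \<omega> \<le> a j} = prob {\<omega> \<in> space M. \<forall>j\<in>J. Y j \<omega> \<le> a j}"
  shows "joint_law J X = joint_law J Y"
proof -
  let ?\<Omega> = "\<Pi>\<^sub>E j\<in>J. (UNIV :: real set)"
  let ?E = "{(\<Pi>\<^sub>E j\<in>J. {..a j}) | a :: 'i \<Rightarrow> real. True}"
  have box: "emeasure (joint_law J Z) (\<Pi>\<^sub>E j\<in>J. {..a j})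
      = prob {\<omega> \<in> space M. \<forall>j\<in>J. Z j \<omega> \<le> a j}"
    if [measurable]: "\<And>j. j \<in> J \<Longrightarrow> Z j \<in> borel_measurable M" for Z :: "'i \<Rightarrow> 'a \<Rightarrow> real" and a
  proof -
    have "emeasure (joint_law J Z) (\<Pi>\<^sub>E j\<in>J. {..a j}) =
        emeasure M ((\<lambda>\<omega>. \<lambda>j\<in>J. Z j \<omega>) -` (\<Pi>\<^sub>E j\<in>J. {..a j}) \<inter> space M)"
      using J by (intro emeasure_distr measurable_restrict sets_PiM_I_finite) auto
    also have "(\<lambda>\<omega>. \<lambda>j\<in>J. Z j \<omega>) -` (\<Pi>\<^sub>E j\<in>J. {..a j}) \<inter> space M = {\<omega> \<in> space M. \<forall>j\<in>J. Z j \<omega> \<le> a j}"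
      by (auto simp: PiE_iff)
    finally show ?thesis
      by (simp only: emeasure_eq_measure)
  qed
  show ?thesis
  proof (rule measure_eqI_generator_eq)
    show "Int_stable ?E"
    proof (rule Int_stableI)
      fix A B
      assume "A \<in> ?E" "B \<in> ?E"
      then obtain a b where "A = (\<Pi>\<^sub>E j\<in>J. {..a j})" "B = (\<Pi>\<^sub>E j\<in>J. {..b j})"
        by blast
      then have "A \<inter> B = (\<Pi>\<^sub>E j\<in>J. {..min (a j) (b j)})"
        by (auto simp: PiE_iff)
      then show "A \<inter> B \<in> ?E"
        by (intro CollectI exI[of _ "\<lambda>j. min (a j) (b j)"]) simp
    qed
    show "?E \<subseteq> Pow ?\<Omega>"
      by auto
    show "sets (joint_law J X) = sigma_sets ?\<Omega> ?E"
      "sets (joint_law J Y) = sigma_sets ?\<Omega> ?E"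
      using sets_PiM_borel_atMost[OF J] by simp_all
    show "emeasure (joint_law J X) A =
        emeasure (joint_law J Y) A" if "A \<in> ?E" for A
      using that eq by (auto simp: box)
    show "range (\<lambda>n::nat. \<Pi>\<^sub>E j\<in>J. {..real n}) \<subseteq> ?E"
    proof (intro image_subsetI CollectI)
      fix n :: nat
      show "\<exists>a. (\<Pi>\<^sub>E j\<in>J. {..real n}) = (\<Pi>\<^sub>E j\<in>J. {..a j}) \<and> True"
        by (intro exI[of _ "\<lambda>_. real n"]) simp
    qed
    show "(\<Union>n::nat. \<Pi>\<^sub>E j\<in>J. {..real n}) = ?\<Omega>"
    proof (intro equalityI subsetI)
      fix x
      assume x: "x \<in> ?\<Omega>"
      obtain n :: nat where "\<forall>j\<in>J. x j \<le> real n"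
        using finite_bounded_by_nat[OF J] by blast
      then show "x \<in> (\<Union>n::nat. \<Pi>\<^sub>E j\<in>J. {..real n})"
        using x by (auto simp: PiE_iff)
    qed (auto simp: PiE_iff)
    show "emeasure (joint_law J X) (\<Pi>\<^sub>E j\<in>J. {..real n}) \<noteq> \<infinity>" for n :: nat
      by (subst box) auto
  qed
qed

text \<open>
  Equality in law passes to almost sure limits: bounded continuous functions have equal
  expectations, and indicators of lower orthants are monotone limits of products of such functions.
\<close>

lemma (in prob_space) distr_PiM_eq_limit:
  fixes X Y :: "nat \<Rightarrow> 'i \<Rightarrow> 'a \<Rightarrow> real" and X' Y' :: "'i \<Rightarrow> 'a \<Rightarrow> real"
  assumes J: "finite J"
    and [measurable]: "\<And>n j. j \<in> J \<Longrightarrow> X n j \<in> borel_measurable M" "\<And>n j. j \<in> J \<Longrightarrow> Y n j \<in> borel_measurable M"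
      "\<And>j. j \<in> J \<Longrightarrow> X' j \<in> borel_measurable M" "\<And>j. j \<in> J \<Longrightarrow> Y' j \<in> borel_measurable M"
    and limX: "\<And>j. j \<in> J \<Longrightarrow> AE \<omega> in M. (\<lambda>n. X n j \<omega>) \<longlonglongrightarrow> X' j \<omega>"
    and limY: "\<And>j. j \<in> J \<Longrightarrow> AE \<omega> in M. (\<lambda>n. Y n j \<omega>) \<longlonglongrightarrow> Y' j \<omega>"
    and eq: "\<And>n. joint_law J (\<lambda>j \<omega>. X n j \<omega>) = joint_law J (\<lambda>j \<omega>. Y n j \<omega>)"
  shows "joint_law J X' = joint_law J Y'"
proof (rule distr_PiM_eqI_atMost[OF J])
  fix a :: "'i \<Rightarrow> real"
  \<comment> \<open>continuous functions decreasing to the indicator of \<open>{..0}\<close>\<close>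
  define \<phi> where "\<phi> m x = max 0 (min 1 (1 - real m * x))" for m :: nat and x :: real
  have \<phi>: "0 \<le> \<phi> m x" "\<phi> m x \<le> 1" for m x
    by (auto simp: \<phi>_def)
  have [measurable]: "\<phi> m \<in> borel_measurable borel" for m
    unfolding \<phi>_def by measurable
  have prod1: "\<bar>\<Prod>j\<in>J. \<phi> m (z j)\<bar> \<le> 1" for m z
    using prod_nonneg[of J "\<lambda>j. \<phi> m (z j)"] prod_le_1[of J "\<lambda>j. \<phi> m (z j)"] \<phi> by simp
  have \<phi>_lim: "(\<lambda>m. \<phi> m x) \<longlonglongrightarrow> indicator {..0} x" for x
  proof (cases "x \<le> 0")
    case True
    then have "\<phi> m x = 1" for m
      using mult_nonneg_nonpos[of "real m" x] by (simp add: \<phi>_def)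
    then show ?thesis
      using True by simp
  next
    case False
    then obtain m0 :: nat where m0: "1 / x \<le> real m0"
      using real_arch_simple by blast
    have "\<phi> m x = 0" if "m \<ge> m0" for m
    proof -
      have "1 / x \<le> real m"
        using m0 that by linarith
      then have "1 \<le> real m * x"
        using False by (simp add: divide_le_eq)
      then show ?thesis
        by (simp add: \<phi>_def)
    qed
    then show ?thesis
      using False by (intro tendsto_eventually) (auto simp: eventually_sequentially intro!: exI[of _ m0])
  qed
  have approx: "(\<lambda>n. \<integral>\<omega>. (\<Prod>j\<in>J. \<phi> m (Z n j \<omega> - a j)) \<partial>M) \<longlonglongrightarrow> (\<integral>\<omega>. (\<Prod>j\<in>J. \<phi> m (Z' j \<omega> - a j)) \<partial>M)"
    if [measurable]: "\<And>n j. j \<in> J \<Longrightarrow> Z n j \<in> borel_measurable M" "\<And>j. j \<in> J \<Longrightarrow> Z' j \<in> borel_measurable M"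
      and limZ: "\<And>j. j \<in> J \<Longrightarrow> AE \<omega> in M. (\<lambda>n. Z n j \<omega>) \<longlonglongrightarrow> Z' j \<omega>"
    for Z :: "nat \<Rightarrow> 'i \<Rightarrow> 'a \<Rightarrow> real" and Z' m
  proof (rule integral_dominated_convergence[where w = "\<lambda>_. 1"])
    have "AE \<omega> in M. \<forall>j\<in>J. (\<lambda>n. Z n j \<omega>) \<longlonglongrightarrow> Z' j \<omega>"
      using J limZ by (intro AE_finite_allI) auto
    then show "AE \<omega> in M. (\<lambda>n. \<Prod>j\<in>J. \<phi> m (Z n j \<omega> - a j)) \<longlonglongrightarrow> (\<Prod>j\<in>J. \<phi> m (Z' j \<omega> - a j))"
    proof eventually_elim
      case (elim \<omega>)
      then show ?case
        unfolding \<phi>_def by (intro tendsto_intros) auto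
    qed
  qed (use prod1 in auto)
  have dist: "prob {\<omega> \<in> space M. \<forall>j\<in>J. Z j \<omega> \<le> a j} = lim (\<lambda>m. \<integral>\<omega>. (\<Prod>j\<in>J. \<phi> m (Z j \<omega> - a j)) \<partial>M)"
    if [measurable]: "\<And>j. j \<in> J \<Longrightarrow> Z j \<in> borel_measurable M" for Z :: "'i \<Rightarrow> 'a \<Rightarrow> real"
  proof (rule limI[symmetric])
    have ind: "(\<Prod>j\<in>J. indicator {..0} (Z j \<omega> - a j)) = (indicator {\<omega>. \<forall>j\<in>J. Z j \<omega> \<le> a j} \<omega> :: real)" for \<omega>
      using J by (auto simp: indicator_def intro!: prod.neutral)
    have "(\<lambda>m. \<integral>\<omega>. (\<Prod>j\<in>J. \<phi> m (Z j \<omega> - a j)) \<partial>M) \<longlonglongrightarrow> (\<integral>\<omega>. (\<Prod>j\<in>J. indicator {..0} (Z j \<omega> - a j)) \<partial>M)"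
    proof (rule integral_dominated_convergence[where w = "\<lambda>_. 1"])
      show "AE \<omega> in M. (\<lambda>m. \<Prod>j\<in>J. \<phi> m (Z j \<omega> - a j)) \<longlonglongrightarrow> (\<Prod>j\<in>J. indicator {..0} (Z j \<omega> - a j))"
        by (intro AE_I2 tendsto_prod \<phi>_lim)
    qed (use prod1 in auto)
    also have "(\<integral>\<omega>. (\<Prod>j\<in>J. indicator {..0} (Z j \<omega> - a j)) \<partial>M) = prob {\<omega> \<in> space M. \<forall>j\<in>J. Z j \<omega> \<le> a j}"
      unfolding ind by (simp add: Int_def conj_commute)
    finally show "(\<lambda>m. \<integral>\<omega>. (\<Prod>j\<in>J. \<phi> m (Z j \<omega> - a j)) \<partial>M) \<longlonglongrightarrow> prob {\<omega> \<in> space M. \<forall>j\<in>J. Z j \<omega> \<le> a j}" .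
  qed
  have law: "(\<integral>\<omega>. (\<Prod>j\<in>J. \<phi> m (Z j \<omega> - a j)) \<partial>M) =
      (\<integral>x. (\<Prod>j\<in>J. \<phi> m (x j - a j)) \<partial>joint_law J Z)"
    if [measurable]: "\<And>j. j \<in> J \<Longrightarrow> Z j \<in> borel_measurable M" for Z :: "'i \<Rightarrow> 'a \<Rightarrow> real" and m
    by (subst integral_distr) (auto intro!: measurable_restrict)
  have "(\<integral>\<omega>. (\<Prod>j\<in>J. \<phi> m (X' j \<omega> - a j)) \<partial>M) = (\<integral>\<omega>. (\<Prod>j\<in>J. \<phi> m (Y' j \<omega> - a j)) \<partial>M)" for m
  proof (rule LIMSEQ_unique)
    show "(\<lambda>n. \<integral>\<omega>. (\<Prod>j\<in>J. \<phi> m (X n j \<omega> - a j)) \<partial>M) \<longlonglongrightarrow> (\<integral>\<omega>. (\<Prod>j\<in>J. \<phi> m (X' j \<omega> - a j)) \<partial>M)"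
      by (rule approx) (auto intro: limX)
    have "(\<integral>\<omega>. (\<Prod>j\<in>J. \<phi> m (X n j \<omega> - a j)) \<partial>M) = (\<integral>\<omega>. (\<Prod>j\<in>J. \<phi> m (Y n j \<omega> - a j)) \<partial>M)" for n
      by (simp add: law eq)
    then show "(\<lambda>n. \<integral>\<omega>. (\<Prod>j\<in>J. \<phi> m (X n j \<omega> - a j)) \<partial>M) \<longlonglongrightarrow> (\<integral>\<omega>. (\<Prod>j\<in>J. \<phi> m (Y' j \<omega> - a j)) \<partial>M)"
      by (simp only:) (rule approx; auto intro: limY)
  qed
  then show "prob {\<omega> \<in> space M. \<forall>j\<in>J. X' j \<omega> \<le> a j} = prob {\<omega> \<in> space M. \<forall>j\<in>J. Y' j \<omega> \<le> a j}"
    by (simp add: dist)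
qed auto

section \<open>Riemann--Stieltjes integrals of processes with stationary increments\<close>

lemma borel_measurable_rs_integral:
  fixes G :: "real \<Rightarrow> 'a \<Rightarrow> real"
  assumes [measurable]: "\<And>t. G t \<in> borel_measurable M"
    and ex: "\<And>\<omega>. \<omega> \<in> space M \<Longrightarrow> \<exists>I. has_rs_integral f (\<lambda>s. G s \<omega>) a b I"
  shows "(\<lambda>\<omega>. rs_integral f (\<lambda>s. G s \<omega>) a b) \<in> borel_measurable M"
proof -
  obtain p where p: "\<And>n. finite (p n)"
    "\<And>f g I. has_rs_integral f g a b I \<Longrightarrow> (\<lambda>n. rs_sum f g (p n)) \<longlonglongrightarrow> I"
    using universal_rs_partitions[of a b] by blast
  show ?thesis
  proof (rule borel_measurable_LIMSEQ_real)
    show "(\<lambda>\<omega>. rs_sum f (\<lambda>s. G s \<omega>) (p n)) \<in> borel_measurable M" for n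
      unfolding rs_sum_def split_def by measurable
    show "(\<lambda>n. rs_sum f (\<lambda>s. G s \<omega>) (p n)) \<longlonglongrightarrow> rs_integral f (\<lambda>s. G s \<omega>) a b" if "\<omega> \<in> space M" for \<omega>
      using ex[OF that] p(2) rs_integral_eqI by fastforce
  qed
qed

text \<open>
  A sum over a division involves only increments between finitely many points \<open>S\<close>. It is therefore
  a measurable image \<open>T\<close> of the vector \<open>(G(s + u) - G(u))\<close>, \<open>s \<in> S\<close>, whose law does not depend on
  \<open>u\<close>.
\<close>

lemma (in prob_space) distr_rs_sum_shift:
  fixes G :: "real \<Rightarrow> 'a \<Rightarrow> real" and f :: "'i \<Rightarrow> real \<Rightarrow> real"
  assumes [measurable]: "\<And>t. G t \<in> borel_measurable M"
    and stat: "stationary_increments M G"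
    and J: "finite J" and p: "\<And>j. j \<in> J \<Longrightarrow> finite (p j)"
  shows "joint_law J (\<lambda>j \<omega>. rs_sum (f j) (\<lambda>s. G (s + h) \<omega>) (p j)) =
    joint_law J (\<lambda>j \<omega>. rs_sum (f j) (\<lambda>s. G s \<omega>) (p j))"
proof -
  define S where "S = (\<Union>j\<in>J. \<Union>(x, K)\<in>p j. {Sup K, Inf K})"
  have S: "finite S" "\<And>j x K. j \<in> J \<Longrightarrow> (x, K) \<in> p j \<Longrightarrow> Sup K \<in> S \<and> Inf K \<in> S"
    using J p by (auto simp: S_def)
  define T where "T y = (\<lambda>j\<in>J. rs_sum (f j) y (p j))" for y
  have T: "T \<in> (\<Pi>\<^sub>M s\<in>S. borel) \<rightarrow>\<^sub>M (\<Pi>\<^sub>M j\<in>J. borel)"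
    unfolding T_def
  proof (rule measurable_restrict)
    fix j
    assume "j \<in> J"
    then show "(\<lambda>y. rs_sum (f j) y (p j)) \<in> (\<Pi>\<^sub>M s\<in>S. borel) \<rightarrow>\<^sub>M borel"
      unfolding rs_sum_def split_def using S(2)
      by (intro borel_measurable_sum borel_measurable_times borel_measurable_diff
          measurable_component_singleton borel_measurable_const) auto
  qed
  have inc: "(\<lambda>\<omega>. \<lambda>s\<in>S. G (s + u) \<omega> - G u \<omega>) \<in> M \<rightarrow>\<^sub>M (\<Pi>\<^sub>M s\<in>S. borel)" for u
    by (intro measurable_restrict) measurable
  have law: "joint_law J (\<lambda>j \<omega>. rs_sum (f j) (\<lambda>s. G (s + u) \<omega>) (p j)) =
      distr (distr M (\<Pi>\<^sub>M s\<in>S. borel) (\<lambda>\<omega>. \<lambda>s\<in>S. G (s + u) \<omega> - G u \<omega>)) (\<Pi>\<^sub>M j\<in>J. borel) T" for u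
  proof -
    have "rs_sum (f j) (\<lambda>s\<in>S. G (s + u) \<omega> - G u \<omega>) (p j) = rs_sum (f j) (\<lambda>s. G (s + u) \<omega>) (p j)"
      if "j \<in> J" for j \<omega>
      unfolding rs_sum_def using S(2)[OF that] by (intro sum.cong) auto
    then have "T (\<lambda>s\<in>S. G (s + u) \<omega> - G u \<omega>) = (\<lambda>j\<in>J. rs_sum (f j) (\<lambda>s. G (s + u) \<omega>) (p j))" for \<omega>
      by (auto simp: T_def)
    then show ?thesis
      by (simp add: distr_distr[OF T inc] comp_def)
  qed
  have "same_fdd M UNIV (\<lambda>t \<omega>. G t \<omega> - G 0 \<omega>) (\<lambda>t \<omega>. G (t + h) \<omega> - G h \<omega>)"
    using stat by (simp add: stationary_increments_def)
  then have "distr M (\<Pi>\<^sub>M s\<in>S. borel) (\<lambda>\<omega>. \<lambda>s\<in>S. G s \<omega> - G 0 \<omega>) =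
      distr M (\<Pi>\<^sub>M s\<in>S. borel) (\<lambda>\<omega>. \<lambda>s\<in>S. G (s + h) \<omega> - G h \<omega>)"
    using S(1) by (simp add: same_fdd_def)
  then show ?thesis
    using law[of h] law[of 0] by simp
qed

lemma (in prob_space) distr_rs_integral_shift:
  fixes G :: "real \<Rightarrow> 'a \<Rightarrow> real" and f :: "'i \<Rightarrow> real \<Rightarrow> real"
  assumes G[measurable]: "\<And>t. G t \<in> borel_measurable M"
    and stat: "stationary_increments M G" and J: "finite J"
    and ex: "\<And>j h \<omega>. j \<in> J \<Longrightarrow> \<omega> \<in> space M \<Longrightarrow> \<exists>I. has_rs_integral (f j) (\<lambda>s. G (s + h) \<omega>) (a j) (b j) I"
  shows "joint_law J (\<lambda>j \<omega>. rs_integral (f j) (\<lambda>s. G (s + h) \<omega>) (a j) (b j)) =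
    joint_law J (\<lambda>j \<omega>. rs_integral (f j) (\<lambda>s. G s \<omega>) (a j) (b j))"
proof -
  have "\<exists>p. (\<forall>n. finite (p n)) \<and> (\<forall>f g I. has_rs_integral f g (a j) (b j) I \<longrightarrow> (\<lambda>n. rs_sum f g (p n)) \<longlonglongrightarrow> I)" for j
    by (rule universal_rs_partitions[of "a j" "b j"]) blast
  then obtain p where p: "\<And>j n. finite (p j n)"
    "\<And>j f g I. has_rs_integral f g (a j) (b j) I \<Longrightarrow> (\<lambda>n. rs_sum f g (p j n)) \<longlonglongrightarrow> I"
    by metis
  have lim: "(\<lambda>n. rs_sum (f j) (\<lambda>s. G (s + u) \<omega>) (p j n)) \<longlonglongrightarrow> rs_integral (f j) (\<lambda>s. G (s + u) \<omega>) (a j) (b j)"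
    if "j \<in> J" "\<omega> \<in> space M" for j u \<omega>
    using ex[OF that, of u] p(2) rs_integral_eqI by fastforce
  have meas: "(\<lambda>\<omega>. rs_integral (f j) (\<lambda>s. G (s + u) \<omega>) (a j) (b j)) \<in> borel_measurable M" if "j \<in> J" for j u
    using ex that by (intro borel_measurable_rs_integral) auto
  have smeas: "(\<lambda>\<omega>. rs_sum (f j) (\<lambda>s. G (s + u) \<omega>) (p j n)) \<in> borel_measurable M" for j u n
    unfolding rs_sum_def split_def by measurable
  show ?thesis
  proof (rule distr_PiM_eq_limit[OF J,
        where X = "\<lambda>n j \<omega>. rs_sum (f j) (\<lambda>s. G (s + h) \<omega>) (p j n)"
          and Y = "\<lambda>n j \<omega>. rs_sum (f j) (\<lambda>s. G s \<omega>) (p j n)"])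
    show "joint_law J (\<lambda>j \<omega>. rs_sum (f j) (\<lambda>s. G (s + h) \<omega>) (p j n)) =
      joint_law J (\<lambda>j \<omega>. rs_sum (f j) (\<lambda>s. G s \<omega>) (p j n))" for n
      using p(1) by (intro distr_rs_sum_shift[OF G stat J])
  qed (use lim[of _ _ h] lim[of _ _ 0] meas[of _ h] meas[of _ 0] smeas[of _ h] smeas[of _ 0] in auto)
qed

text \<open>
  Shifting the integrator amounts to shifting the interval and the integrand. By parts this is a
  substitution in an ordinary integral, so no division has to be translated.
\<close>

lemma rs_integral_exp_shift:
  fixes g :: "real \<Rightarrow> real"
  assumes "a \<le> t" and g: "continuous_on UNIV g"
  shows "rs_integral (\<lambda>s. exp (- c * (t - s))) (\<lambda>s. g (s + h)) a t =
    rs_integral (\<lambda>s. exp (- c * (t + h - s))) g (a + h) (t + h)"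
proof -
  have "has_rs_integral (\<lambda>s. exp (- c * (t - s))) (\<lambda>s. g (s + h)) a t
    (exp (- c * (t - t)) * g (t + h) - exp (- c * (t - a)) * g (a + h)
      - c * exp (- c * t) * (LBINT s:{a..t}. exp (c * s) * g (s + h)))"
    by (rule exp_has_rs_integral[OF \<open>a \<le> t\<close>])
       (intro continuous_on_compose2[OF g] continuous_intros, auto)
  moreover have "has_rs_integral (\<lambda>s. exp (- c * (t + h - s))) g (a + h) (t + h)
    (exp (- c * (t + h - (t + h))) * g (t + h) - exp (- c * (t + h - (a + h))) * g (a + h)
      - c * exp (- c * (t + h)) * (LBINT s:{a + h..t + h}. exp (c * s) * g s))"
    using \<open>a \<le> t\<close> by (intro exp_has_rs_integral) (auto intro: continuous_on_subset[OF g])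
  moreover have "(LBINT s:{a + h..t + h}. exp (c * s) * g s) =
      exp (c * h) * (LBINT s:{a..t}. exp (c * s) * g (s + h))"
  proof -
    have "(LBINT s:{a + h..t + h}. exp (c * s) * g s) =
        (LBINT s. indicator {a + h..t + h} (h + s) *\<^sub>R (exp (c * (h + s)) * g (h + s)))"
      unfolding set_lebesgue_integral_def
      by (subst lborel_integral_real_affine[where c = 1 and t = h]) auto
    also have "\<dots> = (LBINT s. exp (c * h) * (indicator {a..t} s *\<^sub>R (exp (c * s) * g (s + h))))"
      by (intro Bochner_Integration.integral_cong)
         (auto simp: indicator_def distrib_left exp_add add.commute)
    finally show ?thesis
      by (simp add: set_lebesgue_integral_def)
  qed
  moreover have "exp (- (c * (t + h))) * exp (c * h) = exp (- (c * t))"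
    by (simp add: exp_add[symmetric] distrib_left)
  ultimately show ?thesis
    by (simp add: rs_integral_eqI mult.assoc)
qed

section \<open>Measurability of limits at minus infinity\<close>

lemma rational_seq_below:
  fixes p :: real
  obtains r where "\<And>i::nat. r i \<in> \<rat>" "\<And>i. r i \<le> p" "r \<longlonglongrightarrow> p"
proof -
  have "\<exists>q\<in>\<rat>. p - 1 / (real i + 1) < q \<and> q < p" for i :: nat
    by (rule Rats_dense_in_real) simp
  then obtain r where r: "\<And>i. r i \<in> \<rat>" "\<And>i. p - 1 / (real i + 1) < r i" "\<And>i. r i < p"
    by metis
  have "(\<lambda>i. p - 1 / (real i + 1)) \<longlonglongrightarrow> p - 0"
    using LIMSEQ_inverse_real_of_nat by (intro tendsto_diff tendsto_const) (simp add: inverse_eq_divide add.commute)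
  then have "r \<longlonglongrightarrow> p"
    using r by (intro tendsto_sandwich[of "\<lambda>i. p - 1 / (real i + 1)" r _ "\<lambda>_. p"])
       (auto intro!: always_eventually less_imp_le)
  then show thesis
    using r by (intro that[of r]) (auto intro: less_imp_le)
qed

text \<open>
  A countable criterion, needed because a set that is described by uncountably many conditions
  need not be measurable.
\<close>

lemma convergent_at_bot_iff_Cauchy_rational:
  fixes F :: "real \<Rightarrow> real"
  assumes cont: "continuous_on {..t} F"
  shows "(\<exists>I. (F \<longlongrightarrow> I) at_bot) \<longleftrightarrow>
    (\<forall>n::nat. \<exists>m::nat. \<forall>p\<in>\<rat> \<inter> {..t}. \<forall>q\<in>\<rat> \<inter> {..t}.
        p \<le> - real m \<longrightarrow> q \<le> - real m \<longrightarrow> \<bar>F p - F q\<bar> \<le> 1 / (real n + 1))" (is "_ \<longleftrightarrow> ?C")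
proof
  assume "\<exists>I. (F \<longlongrightarrow> I) at_bot"
  then obtain I where I: "(F \<longlongrightarrow> I) at_bot"
    by blast
  show ?C
  proof
    fix n :: nat
    have "\<forall>\<^sub>F a in at_bot. dist (F a) I < 1 / (2 * (real n + 1))"
      using I by (rule tendstoD) simp
    then obtain b where b: "\<And>a. a \<le> b \<Longrightarrow> dist (F a) I < 1 / (2 * (real n + 1))"
      by (auto simp: eventually_at_bot_linorder)
    obtain m :: nat where m: "- b \<le> real m"
      using real_arch_simple by blast
    have "\<bar>F p - F q\<bar> \<le> 1 / (real n + 1)" if "p \<le> - real m" "q \<le> - real m" for p q
    proof -
      have "dist (F p) I < 1 / (2 * (real n + 1))" "dist (F q) I < 1 / (2 * (real n + 1))"
        using that m by (intro b; linarith)+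
      then have "\<bar>F p - F q\<bar> < 1 / (2 * (real n + 1)) + 1 / (2 * (real n + 1))"
        unfolding dist_real_def by linarith
      also have "\<dots> = 1 / (real n + 1)"
        by (simp add: field_simps)
      finally show ?thesis
        by simp
    qed
    then show "\<exists>m::nat. \<forall>p\<in>\<rat> \<inter> {..t}. \<forall>q\<in>\<rat> \<inter> {..t}.
        p \<le> - real m \<longrightarrow> q \<le> - real m \<longrightarrow> \<bar>F p - F q\<bar> \<le> 1 / (real n + 1)"
      by blast
  qed
next
  assume C: ?C
  have real: "\<exists>b\<le>t. \<forall>p\<le>b. \<forall>q\<le>b. \<bar>F p - F q\<bar> \<le> 1 / (real n + 1)" for n :: nat
  proof -
    obtain m :: nat where m: "\<And>p q. p \<in> \<rat> \<Longrightarrow> q \<in> \<rat> \<Longrightarrow> p \<le> t \<Longrightarrow> q \<le> t \<Longrightarrow>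
        p \<le> - real m \<Longrightarrow> q \<le> - real m \<Longrightarrow> \<bar>F p - F q\<bar> \<le> 1 / (real n + 1)"
      using C by (metis IntI atMost_iff)
    have "\<bar>F p - F q\<bar> \<le> 1 / (real n + 1)" if pq: "p \<le> min t (- real m)" "q \<le> min t (- real m)" for p q
    proof -
      obtain r where r: "\<And>i::nat. r i \<in> \<rat>" "\<And>i. r i \<le> p" "r \<longlonglongrightarrow> p"
        using rational_seq_below[of p] by blast
      obtain s where s: "\<And>i::nat. s i \<in> \<rat>" "\<And>i. s i \<le> q" "s \<longlonglongrightarrow> q"
        using rational_seq_below[of q] by blast
      have le: "r i \<le> t" "r i \<le> - real m" "s i \<le> t" "s i \<le> - real m" for i
        using r(2)[of i] s(2)[of i] pq by auto
      have "(\<lambda>i. F (r i)) \<longlonglongrightarrow> F p" "(\<lambda>i. F (s i)) \<longlonglongrightarrow> F q"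
        using r s le pq by (auto intro!: continuous_on_tendsto_compose[OF cont])
      then have "(\<lambda>i. \<bar>F (r i) - F (s i)\<bar>) \<longlonglongrightarrow> \<bar>F p - F q\<bar>"
        by (intro tendsto_intros)
      moreover have "\<bar>F (r i) - F (s i)\<bar> \<le> 1 / (real n + 1)" for i
        using r(1) s(1) le by (intro m)
      ultimately show ?thesis
        by (intro LIMSEQ_le_const2) auto
    qed
    then show ?thesis
      by (intro exI[of _ "min t (- real m)"]) auto
  qed
  have "\<exists>I. filterlim F (nhds I) at_bot"
  proof -
    have "cauchy_filter (filtermap F at_bot)"
      unfolding cauchy_filter_metric_filtermap
    proof (intro allI impI)
      fix e :: real
      assume "e > 0"
      then obtain n :: nat where n: "1 / (real n + 1) < e"
        by (metis nat_approx_posE add.commute of_nat_Suc)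
      obtain b where "\<And>p q. p \<le> b \<Longrightarrow> q \<le> b \<Longrightarrow> \<bar>F p - F q\<bar> \<le> 1 / (real n + 1)"
        using real[of n] by blast
      then have "dist (F p) (F q) < e" if "p \<le> b" "q \<le> b" for p q
        using that n by (fastforce simp: dist_real_def)
      then show "\<exists>P. eventually P at_bot \<and> (\<forall>x y. P x \<and> P y \<longrightarrow> dist (F x) (F y) < e)"
        by (intro exI[of _ "\<lambda>x. x \<le> b"]) (auto intro: eventually_le_at_bot)
    qed
    moreover have "filtermap F at_bot \<noteq> bot"
      by (simp add: filtermap_bot_iff)
    ultimately show ?thesis
      using complete_uniform[where S = "UNIV :: real set"] complete_UNIV
      by (force simp add: filterlim_def)
  qed
  then show "\<exists>I. (F \<longlongrightarrow> I) at_bot"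
    by simp
qed

lemma filterlim_diff_real_at_bot: "filterlim (\<lambda>k. t - real k) at_bot sequentially"
  unfolding filterlim_at_bot eventually_sequentially
proof
  fix Z :: real
  obtain N :: nat where "t - Z \<le> real N"
    using real_arch_simple by blast
  then show "\<exists>N. \<forall>k\<ge>N. t - real k \<le> Z"
    by (intro exI[of _ N]) force
qed

text \<open>
  Where the limit fails to exist, the description denotes one and the same unspecified number, so
  measurability reduces to that of the set of convergence. Equality almost everywhere with a
  measurable function would be enough only on a complete measure space.
\<close>

lemma borel_measurable_limit_at_bot:
  fixes F :: "real \<Rightarrow> 'a \<Rightarrow> real"
  assumes F: "\<And>a. a \<le> t \<Longrightarrow> F a \<in> borel_measurable M"
    and cont: "\<And>\<omega>. \<omega> \<in> space M \<Longrightarrow> continuous_on {..t} (\<lambda>a. F a \<omega>)"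
  shows "(\<lambda>\<omega>. THE I. ((\<lambda>a. F a \<omega>) \<longlongrightarrow> I) at_bot) \<in> borel_measurable M"
proof -
  define D where "D = {p. real_of_rat p \<le> t}"
  have [measurable]: "F (min t a) \<in> borel_measurable M" for a
    by (rule F) simp
  define conv where "conv \<omega> \<longleftrightarrow> (\<forall>n::nat. \<exists>m::nat. \<forall>p\<in>D. \<forall>q\<in>D.
        real_of_rat p \<le> - real m \<longrightarrow> real_of_rat q \<le> - real m \<longrightarrow>
        \<bar>F (min t (real_of_rat p)) \<omega> - F (min t (real_of_rat q)) \<omega>\<bar> \<le> 1 / (real n + 1))" for \<omega>
  have conv: "conv \<omega> \<longleftrightarrow> (\<forall>n::nat. \<exists>m::nat. \<forall>p\<in>\<rat> \<inter> {..t}. \<forall>q\<in>\<rat> \<inter> {..t}.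
        p \<le> - real m \<longrightarrow> q \<le> - real m \<longrightarrow> \<bar>F p \<omega> - F q \<omega>\<bar> \<le> 1 / (real n + 1))" for \<omega>
  proof -
    have "\<rat> \<inter> {..t} = real_of_rat ` D"
      by (auto simp: D_def Rats_def)
    then show ?thesis
      unfolding conv_def by (simp add: D_def)
  qed
  have meas: "Measurable.pred M conv"
    unfolding conv_def by measurable
  have "(\<lambda>\<omega>. if conv \<omega> then lim (\<lambda>k. F (t - real k) \<omega>) else (THE I. False)) \<in> borel_measurable M"
    using meas F by (intro measurable_If borel_measurable_lim_metric) (auto simp: pred_def)
  moreover have "(THE I. ((\<lambda>a. F a \<omega>) \<longlongrightarrow> I) at_bot) = (if conv \<omega> then lim (\<lambda>k. F (t - real k) \<omega>) else (THE I. False))"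
    if \<omega>: "\<omega> \<in> space M" for \<omega>
  proof (cases "conv \<omega>")
    case True
    then obtain I where I: "((\<lambda>a. F a \<omega>) \<longlongrightarrow> I) at_bot"
      using convergent_at_bot_iff_Cauchy_rational[OF cont[OF \<omega>]] unfolding conv by blast
    have "lim (\<lambda>k. F (t - real k) \<omega>) = I"
      by (intro limI filterlim_compose[OF I] filterlim_diff_real_at_bot)
    moreover have "(THE I. ((\<lambda>a. F a \<omega>) \<longlongrightarrow> I) at_bot) = I"
      using I by (intro the_equality) (auto intro: tendsto_unique[OF trivial_limit_at_bot_linorder])
    ultimately show ?thesis
      using True by simp
  next
    case False
    then have "\<nexists>I. ((\<lambda>a. F a \<omega>) \<longlongrightarrow> I) at_bot"
      using convergent_at_bot_iff_Cauchy_rational[OF cont[OF \<omega>]] unfolding conv by blast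
    then show ?thesis
      using False by simp
  qed
  ultimately show ?thesis
    by (subst measurable_cong)
qed

section \<open>The stationary solution\<close>

lemma continuous_on_rs_integral_exp:
  fixes g :: "real \<Rightarrow> real"
  assumes g: "continuous_on UNIV g"
  shows "continuous_on {..t} (\<lambda>a. rs_integral (\<lambda>s. exp (- c * (t - s))) g a t)"
  unfolding continuous_on_eq_continuous_within
proof
  fix x
  assume x: "x \<in> {..t}"
  have "continuous_on {x - 1..t} (\<lambda>a. g t - exp (- c * (t - a)) * g a
      - c * exp (- c * t) * integral {a..t} (\<lambda>s. exp (c * s) * g s))"
    using g
    by (intro continuous_intros indefinite_integral_continuous_1' integrable_continuous_real)
       (auto elim: continuous_on_subset)
  moreover have "rs_integral (\<lambda>s. exp (- c * (t - s))) g a t = g t - exp (- c * (t - a)) * g a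
      - c * exp (- c * t) * integral {a..t} (\<lambda>s. exp (c * s) * g s)" if "a \<in> {x - 1..t}" for a
  proof -
    have "has_rs_integral (\<lambda>s. exp (- c * (t - s))) g a t
      (exp (- c * (t - t)) * g t - exp (- c * (t - a)) * g a
        - c * exp (- c * t) * (LBINT s:{a..t}. exp (c * s) * g s))"
      using that by (intro exp_has_rs_integral continuous_on_subset[OF g]) auto
    moreover have "(LBINT s:{a..t}. exp (c * s) * g s) = integral {a..t} (\<lambda>s. exp (c * s) * g s)"
      by (intro set_borel_integral_eq_integral borel_integrable_atLeastAtMost' continuous_intros
          continuous_on_subset[OF g]) auto
    ultimately show ?thesis
      by (auto dest!: rs_integral_eqI)
  qed
  ultimately have "continuous_on {x - 1..t} (\<lambda>a. rs_integral (\<lambda>s. exp (- c * (t - s))) g a t)"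
    by (subst continuous_on_cong[OF refl])
  then have "continuous (at x within {x - 1..t}) (\<lambda>a. rs_integral (\<lambda>s. exp (- c * (t - s))) g a t)"
    using x by (auto simp: continuous_on_eq_continuous_within)
  moreover have "at x within {x - 1..t} = at x within {..t}"
    by (rule at_within_nhd[of _ "{x - 1<..}"]) auto
  ultimately show "continuous (at x within {..t}) (\<lambda>a. rs_integral (\<lambda>s. exp (- c * (t - s))) g a t)"
    by simp
qed

text \<open>
  Continuity and growth of the paths make the improper integrals converge, and stationarity of the
  increments makes the solution stationary.
\<close>

locale ou_driver = prob_space M for M :: "'a measure" +
  fixes G :: "real \<Rightarrow> 'a \<Rightarrow> real" and \<theta> :: real
  assumes process: "measurable_process M G"
    and increments: "stationary_increments M G"
    and paths: "\<And>\<omega>. \<omega> \<in> space M \<Longrightarrow> continuous_on UNIV (\<lambda>t. G t \<omega>)"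
    and growth: "AE \<omega> in M. \<exists>C. \<forall>t\<le>0. \<bar>G t \<omega>\<bar> \<le> C * (1 + t^2)"
    and \<theta>: "\<theta> > 0"
begin

lemma measurable_G:
  assumes "f \<in> N \<rightarrow>\<^sub>M borel" "g \<in> N \<rightarrow>\<^sub>M M"
  shows "(\<lambda>x. G (f x) (g x)) \<in> borel_measurable N"
  using measurable_compose[OF measurable_Pair[OF assms] process[unfolded measurable_process_def]]
  by simp

abbreviation Z :: "real \<Rightarrow> 'a \<Rightarrow> real" where "Z \<equiv> ou_Z \<theta> G"
abbreviation X :: "real \<Rightarrow> 'a \<Rightarrow> real" where "X \<equiv> ou_X \<theta> G"

definition exp_integral :: "real set \<Rightarrow> 'a \<Rightarrow> real" where
  "exp_integral A \<omega> = (LBINT s:A. exp (\<theta> * s) * G s \<omega>)"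

lemma borel_measurable_G[measurable]: "G t \<in> borel_measurable M"
  by (rule measurable_G) simp_all

lemma borel_measurable_path[measurable]: "\<omega> \<in> space M \<Longrightarrow> (\<lambda>s. G s \<omega>) \<in> borel_measurable borel"
  by (rule measurable_G) simp_all

lemma borel_measurable_exp_integral[measurable]:
  assumes [measurable]: "A \<in> sets borel"
  shows "exp_integral A \<in> borel_measurable M"
proof -
  have [measurable]: "(\<lambda>x. G (snd x) (fst x)) \<in> borel_measurable (M \<Otimes>\<^sub>M lborel)"
    by (rule measurable_G) simp_all
  show ?thesis
    unfolding exp_integral_def set_lebesgue_integral_def by measurable
qed

lemma rs_integral_ex:
  assumes "\<omega> \<in> space M"
  shows "\<exists>I. has_rs_integral (\<lambda>s. exp (- \<theta> * (t - s))) (\<lambda>s. G (s + h) \<omega>) a b I"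
proof (cases "a \<le> b")
  case True
  have "continuous_on {a..b} (\<lambda>s. G (s + h) \<omega>)"
    by (intro continuous_on_compose2[OF paths[OF assms]] continuous_intros) auto
  then show ?thesis
    using exp_has_rs_integral[OF True] by blast
next
  case False
  \<comment> \<open>an empty interval has only the empty division\<close>
  then have "has_rs_integral (\<lambda>s. exp (- \<theta> * (t - s))) (\<lambda>s. G (s + h) \<omega>) a b 0"
    by (auto simp: has_rs_integral_def intro: exI[of _ "1 :: real"])
  then show ?thesis
    by blast
qed

lemma AE_ou_Z:
  "AE \<omega> in M. \<forall>t. has_rs_integral_bot (\<lambda>s. exp (- \<theta> * (t - s))) (\<lambda>s. G s \<omega>) t (Z t \<omega>) \<and>
    Z t \<omega> = G t \<omega> - \<theta> * exp (- \<theta> * t) * exp_integral {..t} \<omega> \<and>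
    set_integrable lborel {..t} (\<lambda>s. exp (\<theta> * s) * G s \<omega>)"
  using growth AE_space
proof eventually_elim
  case (elim \<omega>)
  note \<omega> = elim(2)
  obtain C where C: "\<And>t. t \<le> 0 \<Longrightarrow> \<bar>G t \<omega>\<bar> \<le> C * (1 + t^2)"
    using elim(1) by blast
  have *: "has_rs_integral_bot (\<lambda>s. exp (- \<theta> * (t - s))) (\<lambda>s. G s \<omega>) t
      (G t \<omega> - \<theta> * exp (- \<theta> * t) * exp_integral {..t} \<omega>)" for t
    unfolding exp_integral_def using paths[OF \<omega>] C by (rule exp_has_rs_integral_bot[OF \<theta>])
  have "Z t \<omega> = G t \<omega> - \<theta> * exp (- \<theta> * t) * exp_integral {..t} \<omega>" for t
    unfolding ou_Z_def using * by (rule rs_integral_bot_eqI)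
  moreover have "set_integrable lborel {..t} (\<lambda>s. exp (\<theta> * s) * G s \<omega>)" for t
    using paths[OF \<omega>] C by (rule exp_mult_set_integrable_tail[OF \<theta>])
  ultimately show ?case
    using * by (simp only: simp_thms)
qed

lemma exp_integral_atMost_split:
  assumes int: "set_integrable lborel {..t} (\<lambda>s. exp (\<theta> * s) * G s \<omega>)" and "a \<le> t"
  shows "exp_integral {..t} \<omega> = exp_integral {..a} \<omega> + exp_integral {a..t} \<omega>"
proof -
  have "{..a} \<union> {a..t} = {..t}" "{..a} \<inter> {a..t} = {a}"
    using \<open>a \<le> t\<close> by auto
  then show ?thesis
    using set_lborel_integral_Un_point[of "{..a}" "{a..t}" _ a] int by (simp add: exp_integral_def)
qed

lemma borel_measurable_ou_Z[measurable]: "Z t \<in> borel_measurable M"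
proof -
  have "(\<lambda>\<omega>. THE I. ((\<lambda>a. rs_integral (\<lambda>s. exp (- \<theta> * (t - s))) (\<lambda>s. G s \<omega>) a t) \<longlongrightarrow> I) at_bot) \<in> borel_measurable M"
  proof (rule borel_measurable_limit_at_bot)
    show "(\<lambda>\<omega>. rs_integral (\<lambda>s. exp (- \<theta> * (t - s))) (\<lambda>s. G s \<omega>) a t) \<in> borel_measurable M" for a
      using rs_integral_ex[of _ t 0] by (intro borel_measurable_rs_integral) auto
    show "continuous_on {..t} (\<lambda>a. rs_integral (\<lambda>s. exp (- \<theta> * (t - s))) (\<lambda>s. G s \<omega>) a t)"
      if "\<omega> \<in> space M" for \<omega>
      using paths[OF that] by (rule continuous_on_rs_integral_exp)
  qed
  moreover have "Z t \<omega> =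
      (THE I. ((\<lambda>a. rs_integral (\<lambda>s. exp (- \<theta> * (t - s))) (\<lambda>s. G s \<omega>) a t) \<longlongrightarrow> I) at_bot)"
    if "\<omega> \<in> space M" for \<omega>
    using rs_integral_ex[OF that, of t 0] by (simp add: ou_Z_def rs_integral_bot_def has_rs_integral_bot_def)
  ultimately show ?thesis
    by (subst measurable_cong)
qed

text \<open>
  The integrals over \<open>[j + u - n, j + u]\<close> have laws that do not depend on the shift \<open>u\<close>, and they
  converge almost surely to \<open>Z\<close> at \<open>j + u\<close>.
\<close>

theorem stationary_ou_Z: "stationary_process M Z"
  unfolding stationary_process_def same_fdd_def
proof (intro conjI allI impI)
  show "Z t \<in> borel_measurable M" for t
    by measurable
  fix h :: real and J :: "real set"
  assume "finite J \<and> J \<subseteq> {0..}"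
  then have J: "finite J"
    by simp
  define R where "R u n j \<omega> = rs_integral (\<lambda>s. exp (- \<theta> * (j - s))) (\<lambda>s. G (s + u) \<omega>) (j - real n) j"
    for u n j \<omega>
  have meas: "R u n j \<in> borel_measurable M" for u n j
    unfolding R_def using rs_integral_ex by (intro borel_measurable_rs_integral) auto
  have lim: "AE \<omega> in M. (\<lambda>n. R u n j \<omega>) \<longlonglongrightarrow> Z (j + u) \<omega>" for u j
    using AE_ou_Z AE_space
  proof eventually_elim
    case (elim \<omega>)
    note \<omega> = elim(2)
    from elim have "has_rs_integral_bot (\<lambda>s. exp (- \<theta> * (j + u - s))) (\<lambda>s. G s \<omega>) (j + u) (Z (j + u) \<omega>)"
      by blast
    then have "((\<lambda>a. rs_integral (\<lambda>s. exp (- \<theta> * (j + u - s))) (\<lambda>s. G s \<omega>) a (j + u)) \<longlongrightarrow> Z (j + u) \<omega>) at_bot"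
      unfolding has_rs_integral_bot_def by (rule conjunct2)
    then have "(\<lambda>n. rs_integral (\<lambda>s. exp (- \<theta> * (j + u - s))) (\<lambda>s. G s \<omega>) (j + u - real n) (j + u)) \<longlonglongrightarrow> Z (j + u) \<omega>"
      by (rule filterlim_compose[OF _ filterlim_diff_real_at_bot])
    moreover have "R u n j \<omega> = rs_integral (\<lambda>s. exp (- \<theta> * (j + u - s))) (\<lambda>s. G s \<omega>) (j + u - real n) (j + u)" for n
      using rs_integral_exp_shift[of "j - real n" j "\<lambda>s. G s \<omega>" \<theta> u] paths[OF \<omega>]
      by (simp add: R_def algebra_simps)
    ultimately show ?case
      by simp
  qed
  show "distr M (\<Pi>\<^sub>M j\<in>J. borel) (\<lambda>\<omega>. \<lambda>j\<in>J. Z (j + h) \<omega>) =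
      distr M (\<Pi>\<^sub>M j\<in>J. borel) (\<lambda>\<omega>. \<lambda>j\<in>J. Z j \<omega>)"
  proof (rule distr_PiM_eq_limit[OF J, where X = "\<lambda>n j. R h n j" and Y = "\<lambda>n j. R 0 n j"])
    show "distr M (\<Pi>\<^sub>M j\<in>J. borel) (\<lambda>\<omega>. \<lambda>j\<in>J. R h n j \<omega>) = distr M (\<Pi>\<^sub>M j\<in>J. borel) (\<lambda>\<omega>. \<lambda>j\<in>J. R 0 n j \<omega>)" for n
      using distr_rs_integral_shift[OF _ increments J, of "\<lambda>j s. exp (- \<theta> * (j - s))" "\<lambda>j. j - real n" "\<lambda>j. j" h]
        rs_integral_ex by (simp add: R_def)
    show "AE \<omega> in M. (\<lambda>n. R 0 n j \<omega>) \<longlonglongrightarrow> Z j \<omega>" for j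
      using lim[of 0 j] by simp
  qed (use meas lim in auto)
qed

lemma AE_ou_Z_langevin:
  "AE \<omega> in M. let z0 = rs_integral_bot (\<lambda>s. exp (\<theta> * s)) (\<lambda>s. G s \<omega>) 0 in
     solves_langevin \<theta> (\<lambda>t. G t \<omega>) z0 (\<lambda>t. Z t \<omega>) \<and>
     (\<forall>z. solves_langevin \<theta> (\<lambda>t. G t \<omega>) z0 z \<longrightarrow> (\<forall>t\<ge>0. z t = Z t \<omega>))"
  using AE_ou_Z AE_space
proof eventually_elim
  case (elim \<omega>)
  note Z = elim(1) and \<omega> = elim(2)
  have z0: "rs_integral_bot (\<lambda>s. exp (\<theta> * s)) (\<lambda>s. G s \<omega>) 0 = G 0 \<omega> - \<theta> * exp_integral {..0} \<omega>"
    using Z[rule_format, of 0] by (simp add: ou_Z_def)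
  have eq: "Z t \<omega> = G t \<omega> - \<theta> * exp (- \<theta> * t) *
      (exp_integral {..0} \<omega> + integral {0..t} (\<lambda>s. exp (\<theta> * s) * G s \<omega>))" if "t \<ge> 0" for t
  proof -
    have int: "set_integrable lborel {..t} (\<lambda>s. exp (\<theta> * s) * G s \<omega>)"
      and "Z t \<omega> = G t \<omega> - \<theta> * exp (- \<theta> * t) * exp_integral {..t} \<omega>"
      using Z by blast+
    moreover note exp_integral_atMost_split[OF int that]
    moreover have "exp_integral {0..t} \<omega> = integral {0..t} (\<lambda>s. exp (\<theta> * s) * G s \<omega>)"
      unfolding exp_integral_def
      by (intro set_borel_integral_eq_integral borel_integrable_atLeastAtMost' continuous_intros
          continuous_on_subset[OF paths[OF \<omega>]]) auto
    ultimately show ?thesis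
      by simp
  qed
  have sol: "solves_langevin \<theta> (\<lambda>t. G t \<omega>) (G 0 \<omega> - \<theta> * exp_integral {..0} \<omega>) (\<lambda>t. Z t \<omega>)"
  proof -
    have "solves_langevin \<theta> (\<lambda>t. G t \<omega>) (G 0 \<omega> - \<theta> * exp_integral {..0} \<omega>) (\<lambda>t. G t \<omega> - \<theta> * exp (- \<theta> * t) *
      (exp_integral {..0} \<omega> + integral {0..t} (\<lambda>s. exp (\<theta> * s) * G s \<omega>)))"
      using paths[OF \<omega>] by (intro solves_langevin_exp) (auto elim: continuous_on_subset)
    then show ?thesis
      by (rule solves_langevin_cong[THEN iffD2, rotated]) (rule eq)
  qed
  then show ?case
    unfolding z0 Let_def using solves_langevin_unique[OF _ sol] by blast
qed

end

section \<open>Second moments\<close>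

lemma square_integrable_mult:
  fixes X Y :: "'a \<Rightarrow> real"
  assumes [measurable]: "X \<in> borel_measurable M" "Y \<in> borel_measurable M"
    and X: "integrable M (\<lambda>\<omega>. (X \<omega>)^2)" and Y: "integrable M (\<lambda>\<omega>. (Y \<omega>)^2)"
  shows "integrable M (\<lambda>\<omega>. X \<omega> * Y \<omega>)"
    and "\<bar>\<integral>\<omega>. X \<omega> * Y \<omega> \<partial>M\<bar> \<le> ((\<integral>\<omega>. (X \<omega>)^2 \<partial>M) + (\<integral>\<omega>. (Y \<omega>)^2 \<partial>M)) / 2"
    and "(\<integral>\<omega>. \<bar>X \<omega> * Y \<omega>\<bar> \<partial>M) \<le> ((\<integral>\<omega>. (X \<omega>)^2 \<partial>M) + (\<integral>\<omega>. (Y \<omega>)^2 \<partial>M)) / 2"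
proof -
  have amgm: "\<bar>x * y\<bar> \<le> (x^2 + y^2) / 2" for x y :: real
    using zero_le_power2[of "\<bar>x\<bar> - \<bar>y\<bar>"] by (simp add: power2_diff abs_mult)
  have int: "integrable M (\<lambda>\<omega>. ((X \<omega>)^2 + (Y \<omega>)^2) / 2)"
    using X Y by simp
  show XY: "integrable M (\<lambda>\<omega>. X \<omega> * Y \<omega>)"
    by (rule Bochner_Integration.integrable_bound[OF int]) (use amgm in \<open>auto intro: order.trans[OF _ abs_ge_self]\<close>)
  have "(\<integral>\<omega>. \<bar>X \<omega> * Y \<omega>\<bar> \<partial>M) \<le> (\<integral>\<omega>. ((X \<omega>)^2 + (Y \<omega>)^2) / 2 \<partial>M)"
    using XY int amgm by (intro integral_mono) auto
  then show *: "(\<integral>\<omega>. \<bar>X \<omega> * Y \<omega>\<bar> \<partial>M) \<le> ((\<integral>\<omega>. (X \<omega>)^2 \<partial>M) + (\<integral>\<omega>. (Y \<omega>)^2 \<partial>M)) / 2"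
    using X Y by simp
  show "\<bar>\<integral>\<omega>. X \<omega> * Y \<omega> \<partial>M\<bar> \<le> ((\<integral>\<omega>. (X \<omega>)^2 \<partial>M) + (\<integral>\<omega>. (Y \<omega>)^2 \<partial>M)) / 2"
    using * integral_abs_bound[of M "\<lambda>\<omega>. X \<omega> * Y \<omega>"] by linarith
qed

text \<open>
  The variance function \<open>\<rho>\<close> grows at most quadratically, so all weighted integrals of \<open>G\<close> below
  have finite second moments.
\<close>

locale ou_driver_L2 = ou_driver +
  fixes c :: real
  assumes G_0: "AE \<omega> in M. G 0 \<omega> = 0"
    and square_integrable_increment: "\<And>s t. integrable M (\<lambda>\<omega>. (G t \<omega> - G s \<omega>)^2)"
    and rho_bound: "\<And>t. rho M G t \<le> c * (1 + t^2)"
begin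

lemma square_integrable_G: "integrable M (\<lambda>\<omega>. (G t \<omega>)^2)"
  by (rule integrable_cong_AE_imp[OF square_integrable_increment[of t 0]])
     (use G_0 in auto)

lemma rho_nonneg: "0 \<le> rho M G t"
  by (simp add: rho_def)

lemma rho_0: "rho M G 0 = 0"
proof -
  have "rho M G 0 = (\<integral>\<omega>. 0 \<partial>M)"
    unfolding rho_def using G_0 by (intro integral_cong_AE) auto
  then show ?thesis
    by simp
qed

lemma c_nonneg: "0 \<le> c"
  using rho_bound[of 0] by (simp add: rho_0)

text \<open>
  Equality of the laws of \<open>G(t) - G(s)\<close> and \<open>G(t - s) - G(0)\<close>. Evenness of \<open>\<rho>\<close> and the
  covariance of \<open>G\<close> follow from this identity.
\<close>

lemma expectation_increment_square: "(\<integral>\<omega>. (G t \<omega> - G s \<omega>)^2 \<partial>M) = rho M G (t - s)"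
proof -
  define u where "u = t - s"
  have "distr M (\<Pi>\<^sub>M j\<in>{u}. borel) (\<lambda>\<omega>. \<lambda>j\<in>{u}. G j \<omega> - G 0 \<omega>) =
      distr M (\<Pi>\<^sub>M j\<in>{u}. borel) (\<lambda>\<omega>. \<lambda>j\<in>{u}. G (j + s) \<omega> - G s \<omega>)"
    using increments by (simp add: stationary_increments_def same_fdd_def)
  then have "(\<integral>x. (x u)^2 \<partial>distr M (\<Pi>\<^sub>M j\<in>{u}. borel) (\<lambda>\<omega>. \<lambda>j\<in>{u}. G j \<omega> - G 0 \<omega>)) =
      (\<integral>x. (x u)^2 \<partial>distr M (\<Pi>\<^sub>M j\<in>{u}. borel) (\<lambda>\<omega>. \<lambda>j\<in>{u}. G (j + s) \<omega> - G s \<omega>))"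
    by simp
  moreover have "(\<integral>x. (x u)^2 \<partial>distr M (\<Pi>\<^sub>M j\<in>{u}. borel) (\<lambda>\<omega>. \<lambda>j\<in>{u}. G (j + r) \<omega> - G r \<omega>)) =
      (\<integral>\<omega>. (G (u + r) \<omega> - G r \<omega>)^2 \<partial>M)" for r
    by (subst integral_distr) (auto intro!: measurable_restrict)
  from this[of 0] this[of s] have "(\<integral>x. (x u)^2 \<partial>distr M (\<Pi>\<^sub>M j\<in>{u}. borel) (\<lambda>\<omega>. \<lambda>j\<in>{u}. G j \<omega> - G 0 \<omega>)) =
      (\<integral>\<omega>. (G u \<omega> - G 0 \<omega>)^2 \<partial>M)"
    "(\<integral>x. (x u)^2 \<partial>distr M (\<Pi>\<^sub>M j\<in>{u}. borel) (\<lambda>\<omega>. \<lambda>j\<in>{u}. G (j + s) \<omega> - G s \<omega>)) =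
      (\<integral>\<omega>. (G t \<omega> - G s \<omega>)^2 \<partial>M)"
    by (simp_all add: u_def)
  moreover have "(\<integral>\<omega>. (G u \<omega> - G 0 \<omega>)^2 \<partial>M) = rho M G u"
    unfolding rho_def using G_0 by (intro integral_cong_AE) auto
  ultimately show ?thesis
    by (simp add: u_def)
qed

lemma rho_minus: "rho M G (- t) = rho M G t"
proof -
  have "(\<integral>\<omega>. (G 0 \<omega> - G t \<omega>)^2 \<partial>M) = (\<integral>\<omega>. (G t \<omega> - G 0 \<omega>)^2 \<partial>M)"
    by (simp add: power2_commute)
  then show ?thesis
    by (simp add: expectation_increment_square)
qed

lemma integrable_G_mult: "integrable M (\<lambda>\<omega>. G s \<omega> * G t \<omega>)"
  by (intro square_integrable_mult square_integrable_G) simp_all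

lemma expectation_G_mult: "(\<integral>\<omega>. G s \<omega> * G t \<omega> \<partial>M) = (rho M G s + rho M G t - rho M G (t - s)) / 2"
proof -
  have "rho M G (t - s) = (\<integral>\<omega>. (G t \<omega>)^2 + (G s \<omega>)^2 - 2 * (G s \<omega> * G t \<omega>) \<partial>M)"
    unfolding expectation_increment_square[symmetric]
    by (intro Bochner_Integration.integral_cong) (auto simp: power2_diff)
  also have "\<dots> = rho M G t + rho M G s - 2 * (\<integral>\<omega>. G s \<omega> * G t \<omega> \<partial>M)"
    using square_integrable_G integrable_G_mult by (simp add: rho_def)
  finally show ?thesis
    by simp
qed

lemma borel_measurable_rho[measurable]: "rho M G \<in> borel_measurable borel"
proof -
  have [measurable]: "(\<lambda>x. G (fst x) (snd x)) \<in> borel_measurable (borel \<Otimes>\<^sub>M M)"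
    by (rule measurable_G) simp_all
  show ?thesis
    unfolding rho_def[abs_def] by measurable
qed

text \<open>
  The sets over which \<open>exp(\<theta>s) G\<^sub>s\<close> will be integrated. The second moment of \<open>G\<^sub>s\<close> is at most of
  the order of \<open>1 + s^2\<close>.
\<close>

definition exp_admissible :: "real set \<Rightarrow> bool" where
  "exp_admissible A \<longleftrightarrow> A \<in> sets borel \<and> set_integrable lborel A (\<lambda>s. exp (\<theta> * s) * (1 + s^2))"

lemma exp_admissible_Iic: "exp_admissible {..0}"
  unfolding exp_admissible_def using exp_mult_set_integrable_atMost[OF \<theta>, of "\<lambda>s. 1 + s^2" 1] by auto

lemma exp_admissible_Icc: "exp_admissible {a..b}"
  unfolding exp_admissible_def by (auto intro!: borel_integrable_atLeastAtMost' continuous_intros)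

text \<open>
  By the Cauchy--Schwarz inequality for the weight \<open>w(s) = exp(\<theta>s)\<close> on \<open>A\<close>, the square of \<open>\<integral> w G\<close>
  is at most \<open>\<integral> w\<close> times \<open>\<integral> w G^2\<close>, and the expectation of the latter is finite by Tonelli.
\<close>

lemma square_integrable_exp_integral:
  assumes A: "exp_admissible A"
  shows "integrable M (\<lambda>\<omega>. (exp_integral A \<omega>)^2)"
proof -
  have [measurable]: "A \<in> sets borel"
    using A by (simp add: exp_admissible_def)
  define w where "w s = indicator A s * exp (\<theta> * s)" for s :: real
  have w: "w s \<ge> 0" for s
    by (simp add: w_def)
  have [measurable]: "w \<in> borel_measurable borel"
    unfolding w_def by measurable
  have int: "integrable lborel (\<lambda>s. w s * (1 + s^2))"
    using A by (simp add: exp_admissible_def set_integrable_def w_def mult.assoc)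
  have "integrable lborel w"
    by (rule Bochner_Integration.integrable_bound[OF int]) (auto simp: abs_mult w mult_le_cancel_left1 leD[OF w])
  then have K: "(\<integral>\<^sup>+s. ennreal (w s) \<partial>lborel) < \<infinity>" (is "?K < _")
    by (simp add: nn_integral_eq_integral w)
  have exp_integral: "exp_integral A \<omega> = (LBINT s. w s * G s \<omega>)" for \<omega>
    by (simp add: exp_integral_def set_lebesgue_integral_def w_def mult.assoc)
  have CS: "ennreal ((exp_integral A \<omega>)^2) \<le> ?K * (\<integral>\<^sup>+s. ennreal (w s * (G s \<omega>)^2) \<partial>lborel)"
    if \<omega>[measurable]: "\<omega> \<in> space M" for \<omega>
  proof -
    have "ennreal \<bar>exp_integral A \<omega>\<bar> \<le> (\<integral>\<^sup>+s. ennreal \<bar>w s * G s \<omega>\<bar> \<partial>lborel)"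
    proof (cases "integrable lborel (\<lambda>s. w s * G s \<omega>)")
      case True
      then show ?thesis
        unfolding exp_integral using integral_norm_bound_ennreal[OF True] by simp
    qed (simp add: exp_integral not_integrable_integral_eq)
    also have "(\<integral>\<^sup>+s. ennreal \<bar>w s * G s \<omega>\<bar> \<partial>lborel) =
        (\<integral>\<^sup>+s. ennreal (sqrt (w s)) * ennreal (sqrt (w s) * \<bar>G s \<omega>\<bar>) \<partial>lborel)"
      using w by (intro nn_integral_cong) (simp add: ennreal_mult'[symmetric] abs_mult)
    finally have "(ennreal \<bar>exp_integral A \<omega>\<bar>)^2 \<le> (\<integral>\<^sup>+s. ennreal (sqrt (w s)) * ennreal (sqrt (w s) * \<bar>G s \<omega>\<bar>) \<partial>lborel)^2"
      by (rule power_mono) simp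
    also have "\<dots> \<le> (\<integral>\<^sup>+s. (ennreal (sqrt (w s)))^2 \<partial>lborel) * (\<integral>\<^sup>+s. (ennreal (sqrt (w s) * \<bar>G s \<omega>\<bar>))^2 \<partial>lborel)"
      by (rule Cauchy_Schwarz_nn_integral) measurable
    also have "\<dots> = ?K * (\<integral>\<^sup>+s. ennreal (w s * (G s \<omega>)^2) \<partial>lborel)"
      using w by (simp add: ennreal_power power_mult_distrib)
    finally show ?thesis
      by (simp add: ennreal_power)
  qed
  have [measurable]: "(\<lambda>x. G (snd x) (fst x)) \<in> borel_measurable (M \<Otimes>\<^sub>M lborel)"
    "(\<lambda>x. G (fst x) (snd x)) \<in> borel_measurable (lborel \<Otimes>\<^sub>M M)"
    by (rule measurable_G; simp)+
  interpret P: pair_sigma_finite lborel M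
    by standard
  have "(\<integral>\<^sup>+\<omega>. ennreal ((exp_integral A \<omega>)^2) \<partial>M) \<le> (\<integral>\<^sup>+\<omega>. ?K * (\<integral>\<^sup>+s. ennreal (w s * (G s \<omega>)^2) \<partial>lborel) \<partial>M)"
    by (rule nn_integral_mono) (rule CS)
  also have "\<dots> = ?K * (\<integral>\<^sup>+\<omega>. (\<integral>\<^sup>+s. ennreal (w s * (G s \<omega>)^2) \<partial>lborel) \<partial>M)"
    by (rule nn_integral_cmult) measurable
  also have "(\<integral>\<^sup>+\<omega>. (\<integral>\<^sup>+s. ennreal (w s * (G s \<omega>)^2) \<partial>lborel) \<partial>M) =
      (\<integral>\<^sup>+s. (\<integral>\<^sup>+\<omega>. ennreal (w s * (G s \<omega>)^2) \<partial>M) \<partial>lborel)"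
    by (rule P.Fubini') measurable
  also have "\<dots> \<le> (\<integral>\<^sup>+s. ennreal (c * (w s * (1 + s^2))) \<partial>lborel)"
  proof (rule nn_integral_mono)
    fix s
    have "(\<integral>\<^sup>+\<omega>. ennreal (w s * (G s \<omega>)^2) \<partial>M) = ennreal (w s * rho M G s)"
      using w square_integrable_G[of s] by (subst nn_integral_eq_integral) (auto simp: rho_def)
    also have "\<dots> \<le> ennreal (w s * (c * (1 + s^2)))"
      using w by (intro ennreal_leI mult_left_mono rho_bound)
    finally show "(\<integral>\<^sup>+\<omega>. ennreal (w s * (G s \<omega>)^2) \<partial>M) \<le> ennreal (c * (w s * (1 + s^2)))"
      by (simp add: mult.left_commute)
  qed
  also have "(\<integral>\<^sup>+s. ennreal (c * (w s * (1 + s^2))) \<partial>lborel) = ennreal (LBINT s. c * (w s * (1 + s^2)))"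
    using int w c_nonneg by (intro nn_integral_eq_integral) auto
  finally have "(\<integral>\<^sup>+\<omega>. ennreal ((exp_integral A \<omega>)^2) \<partial>M) \<le> ?K * ennreal (LBINT s. c * (w s * (1 + s^2)))"
    by this (auto intro: mult_left_mono)
  also have "\<dots> < \<infinity>"
    using K by (simp add: ennreal_mult_less_top)
  finally show ?thesis
    by (intro integrableI_bounded) simp_all
qed

lemma expectation_mult_exp_integral:
  assumes A: "exp_admissible A" and Y[measurable]: "Y \<in> borel_measurable M"
    and Y2: "integrable M (\<lambda>\<omega>. (Y \<omega>)^2)"
  shows "(\<integral>\<omega>. Y \<omega> * exp_integral A \<omega> \<partial>M) = (LBINT s:A. exp (\<theta> * s) * (\<integral>\<omega>. Y \<omega> * G s \<omega> \<partial>M))"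
proof -
  have [measurable]: "A \<in> sets borel"
    using A by (simp add: exp_admissible_def)
  define w where "w s = indicator A s * exp (\<theta> * s)" for s :: real
  have w: "w s \<ge> 0" for s
    by (simp add: w_def)
  have [measurable]: "w \<in> borel_measurable borel"
    unfolding w_def by measurable
  have int: "integrable lborel (\<lambda>s. w s * (1 + s^2))"
    using A by (simp add: exp_admissible_def set_integrable_def w_def mult.assoc)
  have [measurable]: "(\<lambda>x. G (fst x) (snd x)) \<in> borel_measurable (lborel \<Otimes>\<^sub>M M)"
    by (rule measurable_G; simp)
  interpret P: pair_sigma_finite lborel M
    by standard
  have YG: "integrable M (\<lambda>\<omega>. Y \<omega> * G s \<omega>)"
    "(\<integral>\<omega>. \<bar>Y \<omega> * G s \<omega>\<bar> \<partial>M) \<le> ((\<integral>\<omega>. (Y \<omega>)^2 \<partial>M) + rho M G s) / 2" for s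
    unfolding rho_def by (rule square_integrable_mult; use Y2 square_integrable_G in simp)+
  have "integrable (lborel \<Otimes>\<^sub>M M) (\<lambda>(s, \<omega>). w s * (Y \<omega> * G s \<omega>))"
  proof (rule P.Fubini_integrable)
    show "(\<lambda>(s, \<omega>). w s * (Y \<omega> * G s \<omega>)) \<in> borel_measurable (lborel \<Otimes>\<^sub>M M)"
      unfolding split_def by measurable
    show "AE s in lborel. integrable M (\<lambda>\<omega>. case (s, \<omega>) of (s, \<omega>) \<Rightarrow> w s * (Y \<omega> * G s \<omega>))"
      using YG by simp
    define V where "V = (\<integral>\<omega>. (Y \<omega>)^2 \<partial>M)"
    define B where "B = V + c"
    have "integrable lborel (\<lambda>s. B * (w s * (1 + s^2)))"
      using int by simp
    then show "integrable lborel (\<lambda>s. \<integral>\<omega>. norm (case (s, \<omega>) of (s, \<omega>) \<Rightarrow> w s * (Y \<omega> * G s \<omega>)) \<partial>M)"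
    proof (rule Bochner_Integration.integrable_bound)
      show "(\<lambda>s. \<integral>\<omega>. norm (case (s, \<omega>) of (s, \<omega>) \<Rightarrow> w s * (Y \<omega> * G s \<omega>)) \<partial>M) \<in> borel_measurable lborel"
        by measurable
      have "norm (\<integral>\<omega>. norm (w s * (Y \<omega> * G s \<omega>)) \<partial>M) \<le> norm (B * (w s * (1 + s^2)))" for s
      proof -
        have "(\<integral>\<omega>. norm (w s * (Y \<omega> * G s \<omega>)) \<partial>M) = w s * (\<integral>\<omega>. \<bar>Y \<omega> * G s \<omega>\<bar> \<partial>M)"
          using w by (simp add: abs_mult)
        also have "\<dots> \<le> w s * (B * (1 + s^2))"
        proof (rule mult_left_mono[OF order.trans[OF YG(2)] w])
          have *: "0 \<le> V" "0 \<le> V * s^2"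
            by (simp_all add: V_def)
          then show "((\<integral>\<omega>. (Y \<omega>)^2 \<partial>M) + rho M G s) / 2 \<le> B * (1 + s^2)"
          proof -
            have "B * (1 + s^2) = V + V * s^2 + c * (1 + s^2)"
              by (simp add: B_def algebra_simps)
            moreover have "(v + r) / 2 \<le> b" if "b = v + x + y" "0 \<le> v" "0 \<le> x" "r \<le> y" "0 \<le> r" for b v x y r :: real
              using that by simp
            ultimately show ?thesis
              unfolding V_def[symmetric] using * rho_bound[of s] rho_nonneg[of s] by blast
          qed
        qed
        finally have "(\<integral>\<omega>. norm (w s * (Y \<omega> * G s \<omega>)) \<partial>M) \<le> B * (w s * (1 + s^2))"
          by (simp add: mult.left_commute)
        moreover have "0 \<le> (\<integral>\<omega>. norm (w s * (Y \<omega> * G s \<omega>)) \<partial>M)"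
          by simp
        ultimately show ?thesis
          by (simp only: real_norm_def abs_of_nonneg order.trans[OF _ abs_ge_self])
      qed
      then show "AE s in lborel. norm (\<integral>\<omega>. norm (case (s, \<omega>) of (s, \<omega>) \<Rightarrow> w s * (Y \<omega> * G s \<omega>)) \<partial>M)
          \<le> norm (B * (w s * (1 + s^2)))"
        by simp
    qed
  qed
  then have "(\<integral>\<omega>. (LBINT s. w s * (Y \<omega> * G s \<omega>)) \<partial>M) = (LBINT s. (\<integral>\<omega>. w s * (Y \<omega> * G s \<omega>) \<partial>M))"
    by (rule P.Fubini_integral)
  moreover have "(LBINT s. w s * (Y \<omega> * G s \<omega>)) = Y \<omega> * exp_integral A \<omega>" for \<omega>
    by (simp add: exp_integral_def set_lebesgue_integral_def w_def mult.assoc mult.left_commute[of _ "Y \<omega>"])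
  ultimately show ?thesis
    by (simp add: set_lebesgue_integral_def w_def mult.assoc)
qed

end

context ou_driver_L2
begin

text \<open>
  The integral \<open>\<integral>\<^sub>s\<^sup>t exp(\<theta>r) dG\<^sub>r\<close> in its integrated-by-parts form.
\<close>

definition wiener :: "real \<Rightarrow> real \<Rightarrow> 'a \<Rightarrow> real" where
  "wiener s t \<omega> = exp (\<theta> * t) * G t \<omega> - exp (\<theta> * s) * G s \<omega> - \<theta> * exp_integral {s..t} \<omega>"

lemma borel_measurable_wiener[measurable]: "wiener s t \<in> borel_measurable M"
  unfolding wiener_def by measurable

lemma square_integrable_add:
  fixes X Y :: "'a \<Rightarrow> real"
  assumes [measurable]: "X \<in> borel_measurable M" "Y \<in> borel_measurable M"
    and X: "integrable M (\<lambda>\<omega>. (X \<omega>)^2)" and Y: "integrable M (\<lambda>\<omega>. (Y \<omega>)^2)"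
  shows "integrable M (\<lambda>\<omega>. (a * X \<omega> + b * Y \<omega>)^2)"
proof -
  have "integrable M (\<lambda>\<omega>. a^2 * (X \<omega>)^2 + b^2 * (Y \<omega>)^2 + 2 * a * b * (X \<omega> * Y \<omega>))"
    using X Y square_integrable_mult(1)[OF assms] by simp
  then show ?thesis
    by (simp add: power2_sum power_mult_distrib algebra_simps)
qed

lemma square_integrable_wiener: "integrable M (\<lambda>\<omega>. (wiener s t \<omega>)^2)"
proof -
  have "integrable M (\<lambda>\<omega>. (1 * (exp (\<theta> * t) * G t \<omega> + (- exp (\<theta> * s)) * G s \<omega>) + (- \<theta>) * exp_integral {s..t} \<omega>)^2)"
    by (intro square_integrable_add square_integrable_G square_integrable_exp_integral exp_admissible_Icc) measurable
  then show ?thesis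
    by (simp add: wiener_def)
qed

text \<open>
  Expectation against a fixed square integrable \<open>U\<close> commutes with the integral: the right-hand
  side is \<open>\<integral>\<^sub>s\<^sup>t exp(\<theta>v) d\<psi>(v)\<close> by parts, where \<open>\<psi>(v) = E(U G\<^sub>v)\<close>.
\<close>

lemma expectation_mult_wiener:
  assumes U[measurable]: "U \<in> borel_measurable M" and U2: "integrable M (\<lambda>\<omega>. (U \<omega>)^2)"
  shows "(\<integral>\<omega>. U \<omega> * wiener s t \<omega> \<partial>M) =
    exp (\<theta> * t) * (\<integral>\<omega>. U \<omega> * G t \<omega> \<partial>M) - exp (\<theta> * s) * (\<integral>\<omega>. U \<omega> * G s \<omega> \<partial>M)
    - \<theta> * (LBINT v:{s..t}. exp (\<theta> * v) * (\<integral>\<omega>. U \<omega> * G v \<omega> \<partial>M))"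
proof -
  have UG: "integrable M (\<lambda>\<omega>. U \<omega> * G v \<omega>)" for v
    by (intro square_integrable_mult U2 square_integrable_G) simp_all
  have UP: "integrable M (\<lambda>\<omega>. U \<omega> * exp_integral {s..t} \<omega>)"
    by (intro square_integrable_mult U2 square_integrable_exp_integral exp_admissible_Icc) simp_all
  have "(\<integral>\<omega>. U \<omega> * wiener s t \<omega> \<partial>M) =
      (\<integral>\<omega>. exp (\<theta> * t) * (U \<omega> * G t \<omega>) - exp (\<theta> * s) * (U \<omega> * G s \<omega>) - \<theta> * (U \<omega> * exp_integral {s..t} \<omega>) \<partial>M)"
    by (intro Bochner_Integration.integral_cong) (auto simp: wiener_def algebra_simps)
  also have "\<dots> = exp (\<theta> * t) * (\<integral>\<omega>. U \<omega> * G t \<omega> \<partial>M) - exp (\<theta> * s) * (\<integral>\<omega>. U \<omega> * G s \<omega> \<partial>M)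
      - \<theta> * (\<integral>\<omega>. U \<omega> * exp_integral {s..t} \<omega> \<partial>M)"
    using UG UP by simp
  finally show ?thesis
    by (simp add: expectation_mult_exp_integral[OF exp_admissible_Icc U U2])
qed

lemma wiener_split:
  assumes \<omega>: "\<omega> \<in> space M" and "r \<le> s" "s \<le> t"
  shows "wiener r t \<omega> = wiener r s \<omega> + wiener s t \<omega>"
proof -
  have int: "set_integrable lborel {r..t} (\<lambda>s. exp (\<theta> * s) * G s \<omega>)"
    by (intro borel_integrable_atLeastAtMost' continuous_intros continuous_on_subset[OF paths[OF \<omega>]]) auto
  have "{r..s} \<union> {s..t} = {r..t}" "{r..s} \<inter> {s..t} = {s}"
    using assms by auto
  then have "exp_integral {r..t} \<omega> = exp_integral {r..s} \<omega> + exp_integral {s..t} \<omega>"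
    using set_lborel_integral_Un_point[of "{r..s}" "{s..t}" _ s] int by (simp add: exp_integral_def)
  then show ?thesis
    by (simp add: wiener_def algebra_simps)
qed

lemma ou_X_eq:
  assumes \<omega>: "\<omega> \<in> space M" and "t \<ge> 0"
  shows "X t \<omega> = exp (- \<theta> * t) * wiener 0 t \<omega>"
proof -
  have "has_rs_integral (\<lambda>s. exp (- \<theta> * (0 - s))) (\<lambda>s. G s \<omega>) 0 t
    (exp (- \<theta> * (0 - t)) * G t \<omega> - exp (- \<theta> * (0 - 0)) * G 0 \<omega>
      - \<theta> * exp (- \<theta> * 0) * (LBINT s:{0..t}. exp (\<theta> * s) * G s \<omega>))"
    using assms by (intro exp_has_rs_integral continuous_on_subset[OF paths]) auto
  then show ?thesis
    by (simp add: ou_X_def wiener_def exp_integral_def rs_integral_eqI)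
qed

lemma AE_ou_Z_eq:
  "AE \<omega> in M. Z 0 \<omega> = - \<theta> * exp_integral {..0} \<omega>"
  "t \<ge> 0 \<Longrightarrow> AE \<omega> in M. Z t \<omega> = exp (- \<theta> * t) * (Z 0 \<omega> + wiener 0 t \<omega>)"
proof -
  show "AE \<omega> in M. Z 0 \<omega> = - \<theta> * exp_integral {..0} \<omega>"
    using AE_ou_Z G_0
  proof eventually_elim
    case (elim \<omega>)
    from elim(1)[rule_format, of 0] elim(2) show ?case
      by simp
  qed
  assume "t \<ge> 0"
  show "AE \<omega> in M. Z t \<omega> = exp (- \<theta> * t) * (Z 0 \<omega> + wiener 0 t \<omega>)"
    using AE_ou_Z
  proof eventually_elim
    case (elim \<omega>)
    have int: "set_integrable lborel {..t} (\<lambda>s. exp (\<theta> * s) * G s \<omega>)"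
      and Zt: "Z t \<omega> = G t \<omega> - \<theta> * exp (- \<theta> * t) * exp_integral {..t} \<omega>"
      and Z0: "Z 0 \<omega> = G 0 \<omega> - \<theta> * exp_integral {..0} \<omega>"
      using elim[rule_format, of t] elim[rule_format, of 0] by simp_all
    have e: "exp (- \<theta> * t) * (exp (\<theta> * t) * x) = x" for x :: real
      by (simp add: mult.assoc[symmetric] exp_add[symmetric])
    show ?case
      unfolding Zt Z0 exp_integral_atMost_split[OF int \<open>t \<ge> 0\<close>] wiener_def
      by (simp only: right_diff_distrib distrib_left e) (simp add: algebra_simps)
  qed
qed

lemma square_integrable_ou_Z_0: "integrable M (\<lambda>\<omega>. (Z 0 \<omega>)^2)"
proof (rule integrable_cong_AE_imp)
  show "integrable M (\<lambda>\<omega>. \<theta>^2 * (exp_integral {..0} \<omega>)^2)"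
    using square_integrable_exp_integral[OF exp_admissible_Iic] by simp
  show "AE \<omega> in M. \<theta>^2 * (exp_integral {..0} \<omega>)^2 = (Z 0 \<omega>)^2"
    using AE_ou_Z_eq(1) by eventually_elim (simp add: power_mult_distrib)
qed measurable

lemma square_integrable_ou_Z:
  assumes "t \<ge> 0"
  shows "integrable M (\<lambda>\<omega>. (Z t \<omega>)^2)"
proof (rule integrable_cong_AE_imp)
  have "integrable M (\<lambda>\<omega>. (1 * Z 0 \<omega> + 1 * wiener 0 t \<omega>)^2)"
    by (intro square_integrable_add square_integrable_ou_Z_0 square_integrable_wiener) measurable
  then show "integrable M (\<lambda>\<omega>. (exp (- \<theta> * t))^2 * (Z 0 \<omega> + wiener 0 t \<omega>)^2)"
    by simp
  show "AE \<omega> in M. (exp (- \<theta> * t))^2 * (Z 0 \<omega> + wiener 0 t \<omega>)^2 = (Z t \<omega>)^2"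
    using AE_ou_Z_eq(2)[OF assms] by eventually_elim (simp add: power_mult_distrib)
qed measurable

lemma expectation_ou_Z_square:
  assumes "t \<ge> 0"
  shows "(\<integral>\<omega>. (Z t \<omega>)^2 \<partial>M) = (\<integral>\<omega>. (Z 0 \<omega>)^2 \<partial>M)"
proof -
  have "distr M (\<Pi>\<^sub>M j\<in>{0}. borel) (\<lambda>\<omega>. \<lambda>j\<in>{0}. Z (j + t) \<omega>) =
      distr M (\<Pi>\<^sub>M j\<in>{0}. borel) (\<lambda>\<omega>. \<lambda>j\<in>{0}. Z j \<omega>)"
    using stationary_ou_Z assms by (simp add: stationary_process_def same_fdd_def)
  then have "(\<integral>x. (x 0)^2 \<partial>distr M (\<Pi>\<^sub>M j\<in>{0}. borel) (\<lambda>\<omega>. \<lambda>j\<in>{0}. Z (j + t) \<omega>)) =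
      (\<integral>x. (x 0)^2 \<partial>distr M (\<Pi>\<^sub>M j\<in>{0}. borel) (\<lambda>\<omega>. \<lambda>j\<in>{0}. Z (j + 0) \<omega>))"
    by simp
  moreover have law: "(\<integral>x. (x 0)^2 \<partial>distr M (\<Pi>\<^sub>M j\<in>{0}. borel) (\<lambda>\<omega>. \<lambda>j\<in>{0}. Z (j + r) \<omega>)) =
      (\<integral>\<omega>. (Z r \<omega>)^2 \<partial>M)" for r
    by (subst integral_distr) (auto intro!: measurable_restrict)
  ultimately show ?thesis
    using law[of 0] law[of t] by simp
qed

text \<open>
  As \<open>X\<^sub>t = Z\<^sub>t - exp(-\<theta>t) Z\<^sub>0\<close>, expanding the square leaves \<open>exp(-2\<theta>t) V - 2 exp(-\<theta>t) E(Z\<^sub>t Z\<^sub>0)\<close>, where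
  \<open>V = E(Z\<^sub>t^2) = E(Z\<^sub>0^2)\<close> also bounds \<open>|E(Z\<^sub>t Z\<^sub>0)|\<close>.
\<close>

lemma expectation_ou_X_square_close:
  assumes "t \<ge> 0"
  shows "\<bar>(\<integral>\<omega>. (X t \<omega>)^2 \<partial>M) - (\<integral>\<omega>. (Z 0 \<omega>)^2 \<partial>M)\<bar>
    \<le> 3 * (\<integral>\<omega>. (Z 0 \<omega>)^2 \<partial>M) * exp (- \<theta> * t)"
proof -
  define V where "V = (\<integral>\<omega>. (Z 0 \<omega>)^2 \<partial>M)"
  define r where "r = (\<integral>\<omega>. Z t \<omega> * Z 0 \<omega> \<partial>M)"
  define e where "e = exp (- \<theta> * t)"
  have e: "0 \<le> e" "e \<le> 1"
    using \<theta> assms by (auto simp: e_def)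
  have V: "0 \<le> V"
    by (simp add: V_def)
  have r: "\<bar>r\<bar> \<le> V"
    using square_integrable_mult(2)[of "Z t" M "Z 0"]
      square_integrable_ou_Z[OF assms] square_integrable_ou_Z_0
    by (simp add: r_def V_def expectation_ou_Z_square[OF assms])
  have ZZ: "integrable M (\<lambda>\<omega>. Z t \<omega> * Z 0 \<omega>)"
    using square_integrable_ou_Z[OF assms] square_integrable_ou_Z_0 by (intro square_integrable_mult) simp_all
  have "(\<integral>\<omega>. (X t \<omega>)^2 \<partial>M) = (\<integral>\<omega>. (exp (- \<theta> * t) * wiener 0 t \<omega>)^2 \<partial>M)"
    using assms by (intro Bochner_Integration.integral_cong) (auto simp: ou_X_eq)
  also have "\<dots> = (\<integral>\<omega>. (Z t \<omega>)^2 + e^2 * (Z 0 \<omega>)^2 - 2 * e * (Z t \<omega> * Z 0 \<omega>) \<partial>M)"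
  proof (rule integral_cong_AE)
    show "AE \<omega> in M. (exp (- \<theta> * t) * wiener 0 t \<omega>)^2 =
        (Z t \<omega>)^2 + e^2 * (Z 0 \<omega>)^2 - 2 * e * (Z t \<omega> * Z 0 \<omega>)"
      using AE_ou_Z_eq(2)[OF assms]
    proof eventually_elim
      case (elim \<omega>)
      then have "exp (- \<theta> * t) * wiener 0 t \<omega> = Z t \<omega> - e * Z 0 \<omega>"
        by (simp add: e_def algebra_simps)
      then show ?case
        by (simp only: power2_diff power_mult_distrib) (simp add: algebra_simps)
    qed
  qed measurable
  also have "\<dots> = V + e^2 * V - 2 * e * r"
    using square_integrable_ou_Z[OF assms] square_integrable_ou_Z_0 ZZ
    by (simp add: V_def r_def expectation_ou_Z_square[OF assms])
  finally have "(\<integral>\<omega>. (X t \<omega>)^2 \<partial>M) - V = e * (e * V - 2 * r)"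
    by (simp add: power2_eq_square algebra_simps)
  then have "\<bar>(\<integral>\<omega>. (X t \<omega>)^2 \<partial>M) - V\<bar> = e * \<bar>e * V - 2 * r\<bar>"
    using e by (simp add: abs_mult)
  also have "\<dots> \<le> e * (3 * V)"
  proof (rule mult_left_mono[OF _ e(1)])
    have "0 \<le> e * V" "e * V \<le> V"
      using e V by (auto simp: mult_left_le_one_le)
    then show "\<bar>e * V - 2 * r\<bar> \<le> 3 * V"
      using r by linarith
  qed
  finally show ?thesis
    by (simp add: V_def e_def mult.commute)
qed

definition laplace_rho :: real where
  "laplace_rho = (LBINT x:{0..}. exp (- \<theta> * x) * rho M G x)"

lemma rho_shift_bound: "\<bar>rho M G (u - v)\<bar> \<le> 2 * c * (1 + v^2) * (1 + u^2)"
proof -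
  have "(u - v)^2 \<le> 2 * u^2 + 2 * v^2"
    using zero_le_power2[of "u + v"] by (simp add: power2_diff power2_sum)
  then have "1 + (u - v)^2 \<le> 2 * (1 + v^2 + u^2) + 2 * (u^2 * v^2)"
    by (intro add_increasing2) simp_all
  also have "\<dots> = 2 * ((1 + v^2) * (1 + u^2))"
    by (simp add: algebra_simps)
  finally have "1 + (u - v)^2 \<le> 2 * ((1 + v^2) * (1 + u^2))" .
  then have "c * (1 + (u - v)^2) \<le> c * (2 * ((1 + v^2) * (1 + u^2)))"
    using c_nonneg by (rule mult_left_mono)
  also have "\<dots> = 2 * c * (1 + v^2) * (1 + u^2)"
    by simp
  finally show ?thesis
    using order.trans[OF rho_bound[of "u - v"]] rho_nonneg[of "u - v"] by simp
qed

lemma set_integrable_exp_rho_shift: "set_integrable lborel {..0} (\<lambda>u. exp (\<theta> * u) * rho M G (u - v))"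
  by (rule exp_mult_set_integrable_atMost[OF \<theta>, where C = "2 * c * (1 + v^2)"])
     (use rho_shift_bound in auto)

lemma set_integrable_exp_rho: "set_integrable lborel {0..} (\<lambda>x. exp (- \<theta> * x) * rho M G x)"
  and laplace_rho_reflect: "(LBINT u:{..0}. exp (\<theta> * u) * rho M G u) = laplace_rho"
  using set_integrable_exp_rho_shift[of 0] set_integrable_reflect_real[of "\<lambda>u. exp (\<theta> * u) * rho M G u"]
  by (simp_all add: rho_minus laplace_rho_def)

lemma set_integrable_exp: "set_integrable lborel {..0} (\<lambda>u. exp (\<theta> * u))"
  and integral_exp: "(LBINT u:{..0}. exp (\<theta> * u)) = 1 / \<theta>"
  using exp_minus_set_integrable[OF \<theta>] set_integrable_reflect_real[of "\<lambda>u. exp (\<theta> * u)"] by simp_all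

text \<open>
  The convolution of \<open>\<rho>\<close> with a one-sided exponential kernel; it is the only term in
  \<open>E(Z\<^sub>0 G\<^sub>v)\<close> that is not simply \<open>\<rho>(v)\<close> or a constant.
\<close>

definition smooth_rho :: "real \<Rightarrow> real" where
  "smooth_rho v = (LBINT u:{..0}. exp (\<theta> * u) * rho M G (u - v))"

lemma expectation_ou_Z_0_G:
  "(\<integral>\<omega>. Z 0 \<omega> * G v \<omega> \<partial>M) = (- rho M G v - \<theta> * laplace_rho + \<theta> * smooth_rho v) / 2"
proof -
  have "(\<integral>\<omega>. Z 0 \<omega> * G v \<omega> \<partial>M) = (\<integral>\<omega>. - \<theta> * (G v \<omega> * exp_integral {..0} \<omega>) \<partial>M)"
  proof (rule integral_cong_AE)
    show "AE \<omega> in M. Z 0 \<omega> * G v \<omega> = - \<theta> * (G v \<omega> * exp_integral {..0} \<omega>)"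
      using AE_ou_Z_eq(1) by eventually_elim simp
  qed measurable
  also have "\<dots> = - \<theta> * (\<integral>\<omega>. G v \<omega> * exp_integral {..0} \<omega> \<partial>M)"
    by (rule integral_mult_right_zero)
  also have "(\<integral>\<omega>. G v \<omega> * exp_integral {..0} \<omega> \<partial>M) =
      (LBINT u:{..0}. exp (\<theta> * u) * ((rho M G v + rho M G u - rho M G (u - v)) / 2))"
    by (subst expectation_mult_exp_integral[OF exp_admissible_Iic]) (simp_all add: square_integrable_G expectation_G_mult)
  also have "\<dots> = (LBINT u:{..0}. rho M G v / 2 * exp (\<theta> * u) + 1 / 2 * (exp (\<theta> * u) * rho M G u)
      - 1 / 2 * (exp (\<theta> * u) * rho M G (u - v)))"
    by (simp add: algebra_simps add_divide_distrib diff_divide_distrib)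
  also have "\<dots> = rho M G v / 2 * (1 / \<theta>) + 1 / 2 * laplace_rho - 1 / 2 * smooth_rho v"
    using set_integrable_exp set_integrable_exp_rho_shift[of v] set_integrable_exp_rho_shift[of 0]
    by (simp add: set_integral_diff(2) set_integral_add(2) set_integrable_mult_right set_integral_mult_right
        integral_exp laplace_rho_reflect smooth_rho_def)
  also have "- \<theta> * (rho M G v / 2 * (1 / \<theta>) + 1 / 2 * laplace_rho - 1 / 2 * smooth_rho v) =
      (- rho M G v - \<theta> * laplace_rho + \<theta> * smooth_rho v) / 2"
    using \<theta> by (simp add: field_simps)
  finally show ?thesis .
qed

end

context ou_driver_L2
begin

text \<open>
  The double integral of \<open>exp(\<theta>(u+v)) \<rho>(u - v)\<close> over the negative quadrant. The kernel is
  symmetric, so the two sides of the diagonal contribute equally. On the side \<open>u \<le> v\<close> the shift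
  \<open>u \<mapsto> v + u\<close> separates the variables into \<open>exp(2\<theta>v)\<close> times \<open>exp(\<theta>u) \<rho>(u)\<close>.
\<close>

lemma exp_smooth_rho_integral:
  "set_integrable lborel {..0} (\<lambda>v. exp (\<theta> * v) * smooth_rho v)"
  "(LBINT v:{..0}. exp (\<theta> * v) * smooth_rho v) = laplace_rho / \<theta>"
proof -
  define k where "k u v = indicator {..0} u * (indicator {..0} v * (exp (\<theta> * (u + v)) * rho M G (u - v)))"
    for u v :: real
  have [measurable]: "(\<lambda>(u, v). k u v) \<in> borel_measurable (borel \<Otimes>\<^sub>M borel)"
    unfolding k_def by measurable
  have k: "0 \<le> k u v" for u v
    by (simp add: k_def rho_nonneg)
  \<comment> \<open>the part of the kernel on one side of the diagonal, on which the kernel vanishes\<close>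
  define h where "h u v = (if u \<le> v then k u v else 0)" for u v
  have [measurable]: "(\<lambda>(u, v). h u v) \<in> borel_measurable (borel \<Otimes>\<^sub>M borel)"
    unfolding h_def by measurable
  have sym: "k u v = k v u" for u v
    using rho_minus[of "u - v"] by (simp add: k_def add.commute mult.left_commute)
  have R: "0 \<le> laplace_rho"
    unfolding laplace_rho_def set_lebesgue_integral_def
    by (intro Bochner_Integration.integral_nonneg) (auto simp: rho_nonneg)
  have half: "(\<integral>\<^sup>+u. ennreal (h u v) \<partial>lborel) =
      ennreal (indicator {..0} v * (laplace_rho * exp (2 * \<theta> * v)))" for v
  proof -
    have "(\<integral>\<^sup>+u. ennreal (h u v) \<partial>lborel) =
        (\<integral>\<^sup>+u. ennreal (h (v + 1 * u) v) \<partial>lborel)"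
      by (subst nn_integral_real_affine[where c = 1 and t = v]) auto
    also have "\<dots> = (\<integral>\<^sup>+u. ennreal (indicator {..0} v * exp (2 * \<theta> * v) * (indicator {..0} u * (exp (\<theta> * u) * rho M G u))) \<partial>lborel)"
    proof (rule nn_integral_cong)
      fix u :: real
      have e: "exp (\<theta> * (v + u + v)) = exp (2 * \<theta> * v) * exp (\<theta> * u)"
        by (simp add: exp_add[symmetric] distrib_left)
      then show "ennreal (h (v + 1 * u) v) =
          ennreal (indicator {..0} v * exp (2 * \<theta> * v) * (indicator {..0} u * (exp (\<theta> * u) * rho M G u)))"
        unfolding h_def k_def mult_1_left e by (simp add: indicator_def mult.assoc)
    qed
    also have "\<dots> = ennreal (LBINT u. indicator {..0} v * exp (2 * \<theta> * v) * (indicator {..0} u * (exp (\<theta> * u) * rho M G u)))"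
      using set_integrable_exp_rho_shift[of 0]
      by (intro nn_integral_eq_integral integrable_mult_right) (auto simp: set_integrable_def rho_nonneg)
    also have "(LBINT u. indicator {..0} v * exp (2 * \<theta> * v) * (indicator {..0} u * (exp (\<theta> * u) * rho M G u))) =
        indicator {..0} v * (laplace_rho * exp (2 * \<theta> * v))"
      by (simp add: laplace_rho_reflect[symmetric] set_lebesgue_integral_def)
    finally show ?thesis .
  qed
  have outer: "(\<integral>\<^sup>+v. ennreal (indicator {..0} v * (laplace_rho * exp (2 * \<theta> * v))) \<partial>lborel) = ennreal (laplace_rho / (2 * \<theta>))"
  proof -
    have int: "set_integrable lborel {..0} (\<lambda>v. exp (2 * \<theta> * v))"
      "(LBINT v:{..0}. exp (2 * \<theta> * v)) = 1 / (2 * \<theta>)"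
      using exp_minus_set_integrable[of "2 * \<theta>"] \<theta> set_integrable_reflect_real[of "\<lambda>v. exp (2 * \<theta> * v)"] by simp_all
    have "(\<integral>\<^sup>+v. ennreal (laplace_rho * (indicator {..0} v * exp (2 * \<theta> * v))) \<partial>lborel) =
        ennreal (LBINT v. laplace_rho * (indicator {..0} v * exp (2 * \<theta> * v)))"
      using int(1) R by (intro nn_integral_eq_integral integrable_mult_right) (auto simp: set_integrable_def)
    also have "(LBINT v. laplace_rho * (indicator {..0} v * exp (2 * \<theta> * v))) = laplace_rho / (2 * \<theta>)"
      using int(2) by (simp add: set_lebesgue_integral_def)
    finally show ?thesis
      by (simp add: mult.left_commute)
  qed
  have total: "(\<integral>\<^sup>+v. (\<integral>\<^sup>+u. ennreal (k u v) \<partial>lborel) \<partial>lborel) = ennreal (laplace_rho / \<theta>)"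
  proof -
    have split: "ennreal (k u v) = ennreal (h u v) + ennreal (h v u)" for u v
    proof (cases "u = v")
      case True
      then show ?thesis
        by (simp add: h_def k_def rho_0)
    next
      case False
      then show ?thesis
        using sym[of u v] by (auto simp: h_def)
    qed
    have "(\<integral>\<^sup>+v. (\<integral>\<^sup>+u. ennreal (k u v) \<partial>lborel) \<partial>lborel) =
        (\<integral>\<^sup>+v. (\<integral>\<^sup>+u. ennreal (h u v) \<partial>lborel) \<partial>lborel) +
        (\<integral>\<^sup>+v. (\<integral>\<^sup>+u. ennreal (h v u) \<partial>lborel) \<partial>lborel)"
      unfolding split by (subst nn_integral_add[symmetric], (measurable)[2]) (intro nn_integral_cong nn_integral_add; measurable)
    also have "(\<integral>\<^sup>+v. (\<integral>\<^sup>+u. ennreal (h v u) \<partial>lborel) \<partial>lborel) =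
        (\<integral>\<^sup>+u. (\<integral>\<^sup>+v. ennreal (h v u) \<partial>lborel) \<partial>lborel)"
      by (rule lborel_pair.Fubini') measurable
    finally show ?thesis
      using R \<theta> by (simp add: half outer ennreal_plus[symmetric] del: ennreal_plus)
  qed
  have inner: "(\<integral>\<^sup>+u. ennreal (k u v) \<partial>lborel) = ennreal (indicator {..0} v * (exp (\<theta> * v) * smooth_rho v))" for v
  proof -
    have "k u v = indicator {..0} v * exp (\<theta> * v) * (indicator {..0} u * (exp (\<theta> * u) * rho M G (u - v)))" for u
      by (simp add: k_def exp_add distrib_left mult_ac)
    moreover have "(\<integral>\<^sup>+u. ennreal (indicator {..0} v * exp (\<theta> * v) * (indicator {..0} u * (exp (\<theta> * u) * rho M G (u - v)))) \<partial>lborel) =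
        ennreal (LBINT u. indicator {..0} v * exp (\<theta> * v) * (indicator {..0} u * (exp (\<theta> * u) * rho M G (u - v))))"
      using set_integrable_exp_rho_shift[of v]
      by (intro nn_integral_eq_integral integrable_mult_right) (auto simp: set_integrable_def rho_nonneg)
    ultimately show ?thesis
      by (simp add: smooth_rho_def set_lebesgue_integral_def mult.assoc)
  qed
  have [measurable]: "smooth_rho \<in> borel_measurable borel"
    unfolding smooth_rho_def[abs_def] set_lebesgue_integral_def by measurable
  have nonneg: "0 \<le> smooth_rho v" for v
    unfolding smooth_rho_def set_lebesgue_integral_def
    by (intro Bochner_Integration.integral_nonneg) (auto simp: rho_nonneg)
  have "has_bochner_integral lborel (\<lambda>v. indicator {..0} v * (exp (\<theta> * v) * smooth_rho v)) (laplace_rho / \<theta>)"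
    using total R \<theta> nonneg unfolding inner by (intro has_bochner_integral_nn_integral) auto
  then show "set_integrable lborel {..0} (\<lambda>v. exp (\<theta> * v) * smooth_rho v)"
    "(LBINT v:{..0}. exp (\<theta> * v) * smooth_rho v) = laplace_rho / \<theta>"
    by (auto simp: has_bochner_integral_iff set_integrable_def set_lebesgue_integral_def)
qed

lemma expectation_ou_Z_0_square: "(\<integral>\<omega>. (Z 0 \<omega>)^2 \<partial>M) = \<theta> / 2 * laplace_rho"
proof -
  have "(\<integral>\<omega>. (Z 0 \<omega>)^2 \<partial>M) = (\<integral>\<omega>. - \<theta> * (Z 0 \<omega> * exp_integral {..0} \<omega>) \<partial>M)"
  proof (rule integral_cong_AE)
    show "AE \<omega> in M. (Z 0 \<omega>)^2 = - \<theta> * (Z 0 \<omega> * exp_integral {..0} \<omega>)"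
      using AE_ou_Z_eq(1) by eventually_elim (simp add: power2_eq_square)
  qed measurable
  also have "\<dots> = - \<theta> * (\<integral>\<omega>. Z 0 \<omega> * exp_integral {..0} \<omega> \<partial>M)"
    by (rule integral_mult_right_zero)
  also have "(\<integral>\<omega>. Z 0 \<omega> * exp_integral {..0} \<omega> \<partial>M) =
      (LBINT v:{..0}. exp (\<theta> * v) * ((- rho M G v - \<theta> * laplace_rho + \<theta> * smooth_rho v) / 2))"
    by (subst expectation_mult_exp_integral[OF exp_admissible_Iic]) (simp_all add: square_integrable_ou_Z_0 expectation_ou_Z_0_G)
  also have "\<dots> = (LBINT v:{..0}. \<theta> / 2 * (exp (\<theta> * v) * smooth_rho v) - 1 / 2 * (exp (\<theta> * v) * rho M G v)
      - \<theta> * laplace_rho / 2 * exp (\<theta> * v))"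
    by (simp add: algebra_simps add_divide_distrib diff_divide_distrib)
  also have "\<dots> = \<theta> / 2 * (laplace_rho / \<theta>) - 1 / 2 * laplace_rho - \<theta> * laplace_rho / 2 * (1 / \<theta>)"
    using set_integrable_exp set_integrable_exp_rho_shift[of 0] exp_smooth_rho_integral(1)
    by (simp add: set_integral_diff(2) set_integral_add(2) set_integrable_mult_right set_integral_mult_right
        integral_exp laplace_rho_reflect exp_smooth_rho_integral(2))
  finally show ?thesis
    using \<theta> by simp
qed

end

section \<open>Covariances in terms of the second derivative\<close>

text \<open>
  Henstock--Kurzweil integrals over a half line include improper ones, so dominated convergence is
  not available for the truncations; the claim is read off from the definition of the integral.
\<close>

lemma integral_atMost_tendsto:
  fixes f :: "real \<Rightarrow> real"
  assumes f: "f integrable_on {..b}"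
  shows "((\<lambda>T. integral {- T..b} f) \<longlongrightarrow> integral {..b} f) at_top"
proof (rule tendstoI)
  fix e :: real
  assume "e > 0"
  have "(f has_integral integral {..b} f) {..b}"
    using f by (rule integrable_integral)
  then obtain B where B: "B > 0" "\<And>a a'. ball 0 B \<subseteq> cbox a a' \<Longrightarrow>
      norm (integral (cbox a a') (\<lambda>x. if x \<in> {..b} then f x else 0) - integral {..b} f) < e"
    using \<open>e > 0\<close> unfolding has_integral_alt'[of f] by meson
  have "dist (integral {- T..b} f) (integral {..b} f) < e" if "T \<ge> B" for T
  proof -
    have "ball 0 B \<subseteq> cbox (- T) (max b B)"
      using that by (auto simp: dist_real_def)
    then have "norm (integral (cbox (- T) (max b B)) (\<lambda>x. if x \<in> {..b} then f x else 0) - integral {..b} f) < e"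
      by (rule B(2))
    moreover have "integral (cbox (- T) (max b B)) (\<lambda>x. if x \<in> {..b} then f x else 0) = integral {- T..b} f"
      unfolding integral_restrict_Int by (rule arg_cong2[where f = integral]) auto
    ultimately show ?thesis
      by (simp add: dist_real_def)
  qed
  then show "\<forall>\<^sub>F T in at_top. dist (integral {- T..b} f) (integral {..b} f) < e"
    using eventually_ge_at_top[of B] by (rule eventually_mono[rotated])
qed

text \<open>
  Integration by parts. The derivative is taken only in the interior, because \<open>\<rho>'\<close> may blow up at
  \<open>0\<close>; continuity up to the end points is enough for Henstock--Kurzweil integrals.
\<close>

lemma exp_mult_deriv_has_integral:
  fixes \<psi> \<psi>' :: "real \<Rightarrow> real"
  assumes "s \<le> t" and cont: "continuous_on {s..t} \<psi>"
    and der: "\<And>v. s < v \<Longrightarrow> v < t \<Longrightarrow> (\<psi> has_real_derivative \<psi>' v) (at v)"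
  shows "((\<lambda>v. exp (c * v) * \<psi>' v) has_integral
    (exp (c * t) * \<psi> t - exp (c * s) * \<psi> s - c * (LBINT v:{s..t}. exp (c * v) * \<psi> v))) {s..t}"
proof -
  define P where "P v = integral {s..v} (\<lambda>r. exp (c * r) * \<psi> r)" for v
  have c: "continuous_on {s..t} (\<lambda>r. exp (c * r) * \<psi> r)"
    using cont by (intro continuous_intros)
  have "((\<lambda>v. exp (c * v) * \<psi>' v) has_integral
    ((exp (c * t) * \<psi> t - c * P t) - (exp (c * s) * \<psi> s - c * P s))) {s..t}"
  proof (rule fundamental_theorem_of_calculus_interior[OF \<open>s \<le> t\<close>])
    show "continuous_on {s..t} (\<lambda>v. exp (c * v) * \<psi> v - c * P v)"
      unfolding P_def using c cont
      by (intro continuous_intros indefinite_integral_continuous_1 integrable_continuous_real) auto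
    fix v
    assume v: "v \<in> {s<..<t}"
    have "(P has_real_derivative exp (c * v) * \<psi> v) (at v within {s..t})"
      unfolding P_def using v by (intro integral_has_real_derivative[OF c]) auto
    moreover have "at v within {s..t} = at v"
      using v by (intro at_within_Icc_at) auto
    ultimately have "(P has_real_derivative exp (c * v) * \<psi> v) (at v)"
      by simp
    then have "((\<lambda>v. exp (c * v) * \<psi> v - c * P v) has_real_derivative exp (c * v) * \<psi>' v) (at v)"
      using v by (auto intro!: derivative_eq_intros der simp: algebra_simps)
    then show "((\<lambda>v. exp (c * v) * \<psi> v - c * P v) has_vector_derivative exp (c * v) * \<psi>' v) (at v)"
      by (simp add: has_real_derivative_iff_has_vector_derivative)
  qed
  moreover have "(LBINT v:{s..t}. exp (c * v) * \<psi> v) = P t"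
    unfolding P_def by (intro set_borel_integral_eq_integral borel_integrable_atLeastAtMost' c)
  ultimately show ?thesis
    by (simp add: P_def algebra_simps)
qed

text \<open>
  The substitution \<open>x = v - u\<close>, for an antiderivative \<open>F\<close> of \<open>exp(-cx) p(x)\<close>. Working in the interior
  keeps the point \<open>0\<close> harmless, at which \<open>\<rho>\<close> need not be differentiable.
\<close>

lemma exp_reflect_has_integral:
  fixes F p :: "real \<Rightarrow> real"
  assumes "a \<le> b" and cont: "continuous_on {v - b..v - a} F"
    and der: "\<And>x. v - b < x \<Longrightarrow> x < v - a \<Longrightarrow> (F has_real_derivative exp (- c * x) * p x) (at x)"
  shows "((\<lambda>u. exp (c * u) * p (v - u)) has_integral exp (c * v) * (F (v - a) - F (v - b))) {a..b}"
proof -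
  have "((\<lambda>u. exp (c * u) * p (v - u)) has_integral
    (- exp (c * v) * F (v - b) - - exp (c * v) * F (v - a))) {a..b}"
  proof (rule fundamental_theorem_of_calculus_interior[OF \<open>a \<le> b\<close>])
    show "continuous_on {a..b} (\<lambda>u. - exp (c * v) * F (v - u))"
      by (intro continuous_intros continuous_on_compose2[OF cont]) auto
    fix u
    assume u: "u \<in> {a<..<b}"
    have "((\<lambda>u. F (v - u)) has_real_derivative (exp (- c * (v - u)) * p (v - u)) * (- 1)) (at u)"
      using u by (intro DERIV_chain2[OF der]) (auto intro!: derivative_eq_intros)
    then have "((\<lambda>u. - exp (c * v) * F (v - u)) has_real_derivative
        - exp (c * v) * ((exp (- c * (v - u)) * p (v - u)) * (- 1))) (at u)"
      by (rule DERIV_cmult)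
    moreover have "- exp (c * v) * ((exp (- c * (v - u)) * x) * (- 1)) = exp (c * u) * x" for x
    proof -
      have "exp (c * v) * exp (- c * (v - u)) = exp (c * u)"
        by (simp add: exp_add[symmetric] right_diff_distrib)
      then show ?thesis
        by (simp add: mult.assoc[symmetric])
    qed
    ultimately show "((\<lambda>u. - exp (c * v) * F (v - u)) has_vector_derivative exp (c * u) * p (v - u)) (at u)"
      by (simp only: has_real_derivative_iff_has_vector_derivative[symmetric])
  qed
  then show ?thesis
    by (simp add: algebra_simps)
qed

context ou_driver_L2
begin

lemma exp_rho_tendsto_0: "((\<lambda>w. exp (- \<theta> * w) * rho M G w) \<longlongrightarrow> 0) at_top"
proof -
  have "((\<lambda>x. exp (\<theta> * x) * rho M G x) \<longlongrightarrow> 0) at_bot"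
    using rho_bound rho_nonneg by (intro exp_mult_tendsto_0_at_bot[OF \<theta>, of _ c]) simp
  from filterlim_compose[OF this filterlim_uminus_at_bot_at_top] show ?thesis
    by (simp add: rho_minus)
qed

text \<open>
  The function \<open>A\<close> of the introduction; it tends to the full Laplace transform at infinity.
\<close>

definition laplace_upto :: "real \<Rightarrow> real" where
  "laplace_upto v = integral {0..v} (\<lambda>x. exp (- \<theta> * x) * rho M G x)"

lemma laplace_upto_eq_set_integral:
  "laplace_upto v = (LBINT x:{0..v}. exp (- \<theta> * x) * rho M G x)"
  unfolding laplace_upto_def
  by (rule set_borel_integral_eq_integral(2)[symmetric], rule set_integrable_subset[OF set_integrable_exp_rho]) auto

lemma laplace_upto_tendsto: "(laplace_upto \<longlongrightarrow> laplace_rho) at_top"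
  unfolding laplace_upto_eq_set_integral[abs_def] laplace_rho_def
  using set_integrable_exp_rho by (intro tendsto_set_lebesgue_integral_at_top) auto

lemma smooth_rho_eq:
  assumes "v \<ge> 0"
  shows "smooth_rho v = exp (\<theta> * v) * (laplace_rho - laplace_upto v)"
proof -
  have "smooth_rho v = (LBINT x:{0..}. exp (\<theta> * (- x)) * rho M G (- x - v))"
    unfolding smooth_rho_def by (rule set_integrable_reflect_real(2))
  also have "\<dots> = (LBINT x:{0..}. exp (- \<theta> * x) * rho M G (v + x))"
    using rho_minus[of "v + x" for x] by (simp add: add.commute)
  also have "\<dots> = (LBINT x. exp (\<theta> * v) * (indicator {v..} (v + x) * (exp (- \<theta> * (v + x)) * rho M G (v + x))))"
    unfolding set_lebesgue_integral_def
  proof (rule Bochner_Integration.integral_cong)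
    fix x :: real
    have "exp (\<theta> * v) * exp (- \<theta> * (v + x)) = exp (- \<theta> * x)"
      by (simp add: exp_add[symmetric] distrib_left)
    then show "indicator {0..} x *\<^sub>R (exp (- \<theta> * x) * rho M G (v + x)) =
        exp (\<theta> * v) * (indicator {v..} (v + x) * (exp (- \<theta> * (v + x)) * rho M G (v + x)))"
      by (auto simp: indicator_def mult.assoc[symmetric])
  qed simp
  also have "\<dots> = exp (\<theta> * v) * (LBINT x. indicator {v..} x * (exp (- \<theta> * x) * rho M G x))"
    by (subst lborel_integral_real_affine[where c = 1 and t = v, of "\<lambda>x. indicator {v..} x * (exp (- \<theta> * x) * rho M G x)"]) auto
  also have "(LBINT x. indicator {v..} x * (exp (- \<theta> * x) * rho M G x)) = laplace_rho - laplace_upto v"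
  proof -
    have "{0..v} \<union> {v..} = {0..}" "{0..v} \<inter> {v..} = {v}"
      using assms by auto
    then have "laplace_rho = laplace_upto v + (LBINT x:{v..}. exp (- \<theta> * x) * rho M G x)"
      using set_lborel_integral_Un_point[of "{0..v}" "{v..}" _ v] set_integrable_exp_rho
      by (simp add: laplace_rho_def laplace_upto_eq_set_integral)
    then show ?thesis
      by (simp add: set_lebesgue_integral_def)
  qed
  finally show ?thesis .
qed

context
  assumes C2: "C2_off_zero (rho M G)" and cont_0: "isCont (rho M G) 0"
begin

abbreviation "\<rho> \<equiv> rho M G"

lemma DERIV_rho: "x \<noteq> 0 \<Longrightarrow> (\<rho> has_real_derivative deriv \<rho> x) (at x)"
  and DERIV_deriv_rho: "x \<noteq> 0 \<Longrightarrow> (deriv \<rho> has_real_derivative deriv (deriv \<rho>) x) (at x)"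
  using C2 by (auto simp: C2_off_zero_def real_differentiable_def DERIV_imp_deriv)

lemma continuous_on_rho: "continuous_on A \<rho>"
proof (rule continuous_at_imp_continuous_on, rule ballI)
  fix x
  show "isCont \<rho> x"
    using cont_0 DERIV_rho[of x] by (cases "x = 0") (auto intro: DERIV_isCont)
qed

lemma continuous_on_laplace_upto: "continuous_on {0..b} laplace_upto"
  unfolding laplace_upto_def[abs_def]
  by (intro indefinite_integral_continuous_1 integrable_continuous_real continuous_intros continuous_on_rho)

lemma DERIV_laplace_upto:
  assumes "x > 0"
  shows "(laplace_upto has_real_derivative exp (- \<theta> * x) * \<rho> x) (at x)"
proof -
  have "(laplace_upto has_real_derivative exp (- \<theta> * x) * \<rho> x) (at x within {0..x + 1})"
    unfolding laplace_upto_def[abs_def] using assms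
    by (intro integral_has_real_derivative continuous_intros continuous_on_rho) auto
  moreover have "at x within {0..x + 1} = at x"
    using assms by (intro at_within_Icc_at) auto
  ultimately show ?thesis
    by simp
qed

text \<open>
  The function \<open>B\<close> of the introduction. It is found by integrating \<open>exp(-\<theta>w) \<rho>''(w)\<close> by parts
  twice.
\<close>

definition antideriv :: "real \<Rightarrow> real" where
  "antideriv w = exp (- \<theta> * w) * (deriv \<rho> w + \<theta> * \<rho> w) + \<theta>^2 * laplace_upto w"

lemma DERIV_antideriv:
  assumes "w > 0"
  shows "(antideriv has_real_derivative exp (- \<theta> * w) * deriv (deriv \<rho>) w) (at w)"
  unfolding antideriv_def[abs_def] using assms
  by (auto intro!: derivative_eq_intros DERIV_rho DERIV_deriv_rho DERIV_laplace_upto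
      simp: algebra_simps power2_eq_square)

lemma integral_exp_deriv_deriv_rho:
  assumes "a \<le> b" "b < v"
  shows "((\<lambda>u. exp (\<theta> * u) * deriv (deriv \<rho>) (v - u)) has_integral
    exp (\<theta> * v) * (antideriv (v - a) - antideriv (v - b))) {a..b}"
proof (rule exp_reflect_has_integral[OF \<open>a \<le> b\<close>])
  show "continuous_on {v - b..v - a} antideriv"
    using assms by (intro continuous_at_imp_continuous_on ballI DERIV_isCont[OF DERIV_antideriv]) auto
qed (use assms DERIV_antideriv in auto)

text \<open>
  By the mean value theorem \<open>\<rho>'\<close> takes values of at most quadratic size at arbitrarily large
  arguments, so zero is the only possible limit.
\<close>

lemma exp_deriv_rho_limit_eq_0:
  assumes L: "((\<lambda>w. exp (- \<theta> * w) * deriv \<rho> w) \<longlongrightarrow> L) at_top"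
  shows "L = 0"
proof -
  have "\<exists>\<xi>. real n + 1 < \<xi> \<and> \<xi> < real n + 2 \<and> \<rho> (real n + 2) - \<rho> (real n + 1) = deriv \<rho> \<xi>" for n
    using MVT2[of "real n + 1" "real n + 2" \<rho> "deriv \<rho>"] DERIV_rho by force
  then obtain \<xi> where \<xi>: "\<And>n. real n + 1 < \<xi> n" "\<And>n. \<xi> n < real n + 2"
    "\<And>n. \<rho> (real n + 2) - \<rho> (real n + 1) = deriv \<rho> (\<xi> n)"
    by metis
  have "filterlim \<xi> at_top sequentially"
  proof (rule filterlim_at_top_mono[OF filterlim_real_sequentially], rule always_eventually, rule allI)
    show "real n \<le> \<xi> n" for n
      using \<xi>(1)[of n] by simp
  qed
  then have 1: "(\<lambda>n. exp (- \<theta> * \<xi> n) * deriv \<rho> (\<xi> n)) \<longlonglongrightarrow> L"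
    by (rule filterlim_compose[OF L])
  have "(\<lambda>n. exp (- \<theta> * \<xi> n) * deriv \<rho> (\<xi> n)) \<longlonglongrightarrow> 0"
  proof (rule Lim_null_comparison)
    define q where "q w = exp (- \<theta> * w) * \<rho> w" for w
    have q: "q w \<ge> 0" for w
      by (simp add: q_def rho_nonneg)
    show "\<forall>\<^sub>F n in sequentially. norm (exp (- \<theta> * \<xi> n) * deriv \<rho> (\<xi> n)) \<le>
        exp \<theta> * q (real n + 2) + q (real n + 1)"
    proof (intro always_eventually allI)
      fix n
      have "\<bar>deriv \<rho> (\<xi> n)\<bar> \<le> \<rho> (real n + 2) + \<rho> (real n + 1)"
        using \<xi>(3)[of n] rho_nonneg[of "real n + 2"] rho_nonneg[of "real n + 1"] by linarith
      moreover have "exp (- \<theta> * \<xi> n) \<le> exp (- \<theta> * (real n + 1))"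
        using \<xi>(1)[of n] \<theta> by simp
      ultimately have "exp (- \<theta> * \<xi> n) * \<bar>deriv \<rho> (\<xi> n)\<bar> \<le> exp (- \<theta> * (real n + 1)) * (\<rho> (real n + 2) + \<rho> (real n + 1))"
        by (intro mult_mono) auto
      also have "\<dots> = exp \<theta> * q (real n + 2) + q (real n + 1)"
      proof -
        have "exp (- \<theta> * (real n + 1)) = exp \<theta> * exp (- \<theta> * (real n + 2))"
          by (simp add: exp_add[symmetric] algebra_simps)
        then have "exp (- \<theta> * (real n + 1)) * \<rho> (real n + 2) = exp \<theta> * (exp (- \<theta> * (real n + 2)) * \<rho> (real n + 2))"
          by simp
        then show ?thesis
          unfolding q_def distrib_left[of "exp (- \<theta> * (real n + 1))"] by simp
      qed
      finally show "norm (exp (- \<theta> * \<xi> n) * deriv \<rho> (\<xi> n)) \<le> exp \<theta> * q (real n + 2) + q (real n + 1)"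
        by (simp add: abs_mult)
    qed
    have "(\<lambda>n. q (real n + a)) \<longlonglongrightarrow> 0" if "a \<ge> 0" for a
      unfolding q_def
      by (rule filterlim_compose[OF exp_rho_tendsto_0],
          rule filterlim_at_top_mono[OF filterlim_real_sequentially])
         (use that in \<open>simp add: always_eventually\<close>)
    from this[of 1] this[of 2]
    have "(\<lambda>n. exp \<theta> * q (real n + 2) + q (real n + 1)) \<longlonglongrightarrow> exp \<theta> * 0 + 0"
      by (intro tendsto_intros) simp_all
    then show "(\<lambda>n. exp \<theta> * q (real n + 2) + q (real n + 1)) \<longlonglongrightarrow> 0"
      by simp
  qed
  then show ?thesis
    using 1 LIMSEQ_unique by blast
qed

text \<open>
  The integral over \<open>[-T, 0]\<close> is \<open>exp(2\<theta>v) (B(v + T) - B(v))\<close> for the antiderivative \<open>B\<close>. If it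
  converges as \<open>T \<rightarrow> \<infinity>\<close>, so does \<open>B\<close>, and with it \<open>exp(-\<theta>w) \<rho>'(w)\<close>; its limit is zero, which
  identifies the limit of \<open>B\<close> as \<open>\<theta>^2\<close> times the Laplace transform.
\<close>

lemma integral_atMost_exp_deriv_deriv_rho:
  assumes "v > 0" and int: "(\<lambda>u. exp (\<theta> * u) * exp (\<theta> * v) * deriv (deriv \<rho>) (v - u)) integrable_on {..0}"
  shows "integral {..0} (\<lambda>u. exp (\<theta> * u) * exp (\<theta> * v) * deriv (deriv \<rho>) (v - u)) =
    (exp (\<theta> * v))^2 * (\<theta>^2 * laplace_rho - antideriv v)"
proof -
  define E where "E = exp (\<theta> * v)"
  have E: "E > 0"
    by (simp add: E_def)
  define I where "I = integral {..0} (\<lambda>u. exp (\<theta> * u) * E * deriv (deriv \<rho>) (v - u))"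
  have "((\<lambda>T. integral {- T..0} (\<lambda>u. exp (\<theta> * u) * E * deriv (deriv \<rho>) (v - u))) \<longlongrightarrow> I) at_top"
    unfolding I_def E_def by (rule integral_atMost_tendsto[OF int])
  moreover have "\<forall>\<^sub>F T in at_top. integral {- T..0} (\<lambda>u. exp (\<theta> * u) * E * deriv (deriv \<rho>) (v - u)) =
      E^2 * (antideriv (v + T) - antideriv v)"
    using eventually_ge_at_top[of "0 :: real"]
  proof eventually_elim
    case (elim T)
    have "((\<lambda>u. E * (exp (\<theta> * u) * deriv (deriv \<rho>) (v - u))) has_integral
        E * (E * (antideriv (v - (- T)) - antideriv (v - 0)))) {- T..0}"
      unfolding E_def using elim assms by (intro has_integral_mult_right integral_exp_deriv_deriv_rho) auto
    then show ?case
      by (intro integral_unique) (simp add: power2_eq_square mult_ac)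
  qed
  ultimately have "((\<lambda>T. E^2 * (antideriv (v + T) - antideriv v)) \<longlongrightarrow> I) at_top"
    by (rule Lim_transform_eventually)
  then have "((\<lambda>T. E^2 * (antideriv (v + T) - antideriv v) / E^2 + antideriv v) \<longlongrightarrow> I / E^2 + antideriv v) at_top"
    using E by (intro tendsto_intros) auto
  then have "((\<lambda>T. antideriv (v + T)) \<longlongrightarrow> I / E^2 + antideriv v) at_top"
    using E by simp
  moreover have "filterlim (\<lambda>w. w - v) at_top at_top"
    using filterlim_tendsto_add_at_top[OF tendsto_const[of "- v"] filterlim_ident[of at_top]]
    by (simp add: add.commute)
  ultimately have "((\<lambda>w. antideriv (v + (w - v))) \<longlongrightarrow> I / E^2 + antideriv v) at_top"
    by (rule filterlim_compose)
  then have "(antideriv \<longlongrightarrow> I / E^2 + antideriv v) at_top"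
    by simp
  then have "((\<lambda>w. antideriv w - \<theta> * (exp (- \<theta> * w) * \<rho> w) - \<theta>^2 * laplace_upto w) \<longlongrightarrow>
      I / E^2 + antideriv v - \<theta> * 0 - \<theta>^2 * laplace_rho) at_top"
    by (intro tendsto_intros exp_rho_tendsto_0 laplace_upto_tendsto)
  then have "((\<lambda>w. exp (- \<theta> * w) * deriv \<rho> w) \<longlongrightarrow> I / E^2 + antideriv v - \<theta> * 0 - \<theta>^2 * laplace_rho) at_top"
    by (simp add: antideriv_def algebra_simps)
  then have "I / E^2 + antideriv v - \<theta> * 0 - \<theta>^2 * laplace_rho = 0"
    by (rule exp_deriv_rho_limit_eq_0)
  then have "I = E^2 * (\<theta>^2 * laplace_rho - antideriv v)"
    using E by (simp add: field_simps)
  then show ?thesis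
    unfolding I_def E_def .
qed

text \<open>
  The covariance \<open>\<phi>(v) = E(Z\<^sub>0 G\<^sub>v)\<close> equals the explicit function \<open>f\<close> for \<open>v \<ge> 0\<close>. Its derivative
  \<open>f'\<close> satisfies \<open>exp(\<theta>v) f'(v) = K(v) / 2\<close> for \<open>0 < v \<le> t\<close>, where \<open>K\<close> is the inner integral. The
  outer integral ignores the point \<open>v = 0\<close>.
\<close>

lemma expectation_ou_Z_mult:
  assumes "t \<ge> 0"
    and int: "\<And>v. v \<in> {0<..t} \<Longrightarrow> (\<lambda>u. exp (\<theta> * u) * exp (\<theta> * v) * deriv (deriv \<rho>) (v - u)) integrable_on {..0}"
  shows "(\<integral>\<omega>. Z t \<omega> * Z 0 \<omega> \<partial>M) = exp (- \<theta> * t) * (\<integral>\<omega>. (Z 0 \<omega>)^2 \<partial>M) +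
    exp (- \<theta> * t) / 2 * integral {0..t} (\<lambda>v. integral {..0} (\<lambda>u. exp (\<theta> * u) * exp (\<theta> * v) * deriv (deriv \<rho>) (v - u)))"
proof -
  define K where "K v = integral {..0} (\<lambda>u. exp (\<theta> * u) * exp (\<theta> * v) * deriv (deriv \<rho>) (v - u))" for v
  define \<phi> where "\<phi> v = (\<integral>\<omega>. Z 0 \<omega> * G v \<omega> \<partial>M)" for v
  define f where "f v = (- \<rho> v - \<theta> * laplace_rho + \<theta> * (exp (\<theta> * v) * (laplace_rho - laplace_upto v))) / 2" for v
  define f' where "f' v = exp (\<theta> * v) * (\<theta>^2 * laplace_rho - antideriv v) / 2" for v
  have \<phi>: "\<phi> v = f v" if "v \<ge> 0" for v
    using that by (simp add: \<phi>_def f_def expectation_ou_Z_0_G smooth_rho_eq)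
  have K: "exp (\<theta> * v) * f' v = K v / 2" if "v \<in> {0<..t}" for v
    using that int[OF that] unfolding K_def f'_def
    by (subst integral_atMost_exp_deriv_deriv_rho) (auto simp: power2_eq_square)
  have f': "(f has_real_derivative f' v) (at v)" if "v > 0" for v
  proof -
    have e: "exp (\<theta> * v) * (exp (- \<theta> * v) * x) = x" for x :: real
      by (simp add: mult.assoc[symmetric] exp_add[symmetric])
    let ?D = "- deriv \<rho> v + \<theta> * (\<theta> * exp (\<theta> * v) * (laplace_rho - laplace_upto v)
        + exp (\<theta> * v) * (- (exp (- \<theta> * v) * \<rho> v)))"
    have "((\<lambda>v. - \<rho> v - \<theta> * laplace_rho + \<theta> * (exp (\<theta> * v) * (laplace_rho - laplace_upto v)))
        has_real_derivative ?D) (at v)"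
      using that
      by (auto intro!: derivative_eq_intros DERIV_rho DERIV_laplace_upto simp: algebra_simps)
    from DERIV_cdivide[OF this, of 2] have "(f has_real_derivative ?D / 2) (at v)"
      unfolding f_def[abs_def] .
    moreover have "?D / 2 = f' v"
      unfolding f'_def antideriv_def right_diff_distrib distrib_left mult_minus_right e
      by (simp add: algebra_simps power2_eq_square)
    ultimately show ?thesis
      by simp
  qed
  have "((\<lambda>v. exp (\<theta> * v) * f' v) has_integral
      (exp (\<theta> * t) * f t - exp (\<theta> * 0) * f 0 - \<theta> * (LBINT v:{0..t}. exp (\<theta> * v) * f v))) {0..t}"
  proof (rule exp_mult_deriv_has_integral[OF \<open>t \<ge> 0\<close>])
    show "continuous_on {0..t} f"
      unfolding f_def[abs_def]
      by (intro continuous_intros continuous_on_rho continuous_on_laplace_upto) simp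
  qed (rule f')
  moreover have "(LBINT v:{0..t}. exp (\<theta> * v) * f v) = (LBINT v:{0..t}. exp (\<theta> * v) * \<phi> v)"
    by (intro set_lebesgue_integral_cong) (auto simp: \<phi>)
  moreover have "f t = \<phi> t" "f 0 = \<phi> 0"
    using \<phi> \<open>t \<ge> 0\<close> by simp_all
  ultimately have "((\<lambda>v. exp (\<theta> * v) * f' v) has_integral (\<integral>\<omega>. Z 0 \<omega> * wiener 0 t \<omega> \<partial>M)) {0..t}"
    by (simp add: expectation_mult_wiener square_integrable_ou_Z_0 \<phi>_def)
  then have "((\<lambda>v. K v / 2) has_integral (\<integral>\<omega>. Z 0 \<omega> * wiener 0 t \<omega> \<partial>M)) {0..t}"
    by (rule has_integral_spike_finite[of "{0}", rotated 2]) (use K in auto)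
  then have W: "(\<integral>\<omega>. Z 0 \<omega> * wiener 0 t \<omega> \<partial>M) = integral {0..t} K / 2"
    by (auto dest!: integral_unique)
  have ZW: "integrable M (\<lambda>\<omega>. Z 0 \<omega> * wiener 0 t \<omega>)"
    by (intro square_integrable_mult square_integrable_ou_Z_0 square_integrable_wiener) simp_all
  have "(\<integral>\<omega>. Z t \<omega> * Z 0 \<omega> \<partial>M) =
      (\<integral>\<omega>. exp (- \<theta> * t) * ((Z 0 \<omega>)^2 + Z 0 \<omega> * wiener 0 t \<omega>) \<partial>M)"
  proof (rule integral_cong_AE)
    show "AE \<omega> in M. Z t \<omega> * Z 0 \<omega> =
        exp (- \<theta> * t) * ((Z 0 \<omega>)^2 + Z 0 \<omega> * wiener 0 t \<omega>)"
      using AE_ou_Z_eq(2)[OF \<open>t \<ge> 0\<close>] by eventually_elim (simp add: power2_eq_square algebra_simps)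
  qed measurable
  also have "\<dots> = exp (- \<theta> * t) * ((\<integral>\<omega>. (Z 0 \<omega>)^2 \<partial>M) + (\<integral>\<omega>. Z 0 \<omega> * wiener 0 t \<omega> \<partial>M))"
    using square_integrable_ou_Z_0 ZW by simp
  finally show ?thesis
    unfolding W by (simp add: K_def[abs_def] algebra_simps)
qed

lemma integral_exp_rho_reflect:
  assumes "0 \<le> s" "s \<le> v"
  shows "(LBINT u:{0..s}. exp (\<theta> * u) * \<rho> (v - u)) = exp (\<theta> * v) * (laplace_upto v - laplace_upto (v - s))"
proof -
  have "((\<lambda>u. exp (\<theta> * u) * \<rho> (v - u)) has_integral
      exp (\<theta> * v) * (laplace_upto (v - 0) - laplace_upto (v - s))) {0..s}"
    using assms DERIV_laplace_upto
    by (intro exp_reflect_has_integral continuous_on_subset[OF continuous_on_laplace_upto[of v]]) auto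
  moreover have "(LBINT u:{0..s}. exp (\<theta> * u) * \<rho> (v - u)) = integral {0..s} (\<lambda>u. exp (\<theta> * u) * \<rho> (v - u))"
    by (intro set_borel_integral_eq_integral borel_integrable_atLeastAtMost' continuous_intros
        continuous_on_compose2[OF continuous_on_rho[of UNIV]]) auto
  ultimately show ?thesis
    by (simp add: integral_unique)
qed

lemma expectation_wiener_G:
  assumes "0 \<le> s" "s \<le> v"
  shows "(\<integral>\<omega>. wiener 0 s \<omega> * G v \<omega> \<partial>M) =
    ((exp (\<theta> * s) * \<rho> s - \<theta> * (LBINT u:{0..s}. exp (\<theta> * u) * \<rho> u)) + \<rho> v - exp (\<theta> * s) * \<rho> (v - s)
      + \<theta> * (exp (\<theta> * v) * (laplace_upto v - laplace_upto (v - s)))) / 2"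
proof -
  have cov: "(\<integral>\<omega>. G v \<omega> * G u \<omega> \<partial>M) = (\<rho> u + \<rho> v - \<rho> (v - u)) / 2" for u
    using rho_minus[of "v - u"] by (simp add: expectation_G_mult)
  have i: "set_integrable lborel {0..s} (\<lambda>u. exp (\<theta> * u))" "set_integrable lborel {0..s} (\<lambda>u. exp (\<theta> * u) * \<rho> u)"
    "set_integrable lborel {0..s} (\<lambda>u. exp (\<theta> * u) * \<rho> (v - u))"
    by (intro borel_integrable_atLeastAtMost' continuous_intros
        continuous_on_compose2[OF continuous_on_rho[of UNIV]]; simp)+
  have e: "(LBINT u:{0..s}. exp (\<theta> * u)) = (exp (\<theta> * s) - 1) / \<theta>"
  proof -
    have "((\<lambda>u. exp (\<theta> * u)) has_integral (exp (\<theta> * s) / \<theta> - exp (\<theta> * 0) / \<theta>)) {0..s}"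
      using assms \<theta>
      by (intro fundamental_theorem_of_calculus)
         (auto intro!: derivative_eq_intros simp: has_real_derivative_iff_has_vector_derivative[symmetric])
    then show ?thesis
      by (simp add: set_borel_integral_eq_integral(2)[OF i(1)] integral_unique diff_divide_distrib)
  qed
  have "(\<integral>\<omega>. wiener 0 s \<omega> * G v \<omega> \<partial>M) = (\<integral>\<omega>. G v \<omega> * wiener 0 s \<omega> \<partial>M)"
    by (simp add: mult.commute)
  also have "\<dots> = exp (\<theta> * s) * ((\<rho> s + \<rho> v - \<rho> (v - s)) / 2) - exp (\<theta> * 0) * ((\<rho> 0 + \<rho> v - \<rho> (v - 0)) / 2)
      - \<theta> * (LBINT u:{0..s}. exp (\<theta> * u) * ((\<rho> u + \<rho> v - \<rho> (v - u)) / 2))"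
    by (subst expectation_mult_wiener) (simp_all add: square_integrable_G cov)
  also have "(LBINT u:{0..s}. exp (\<theta> * u) * ((\<rho> u + \<rho> v - \<rho> (v - u)) / 2)) =
      (LBINT u:{0..s}. 1 / 2 * (exp (\<theta> * u) * \<rho> u) + \<rho> v / 2 * exp (\<theta> * u) - 1 / 2 * (exp (\<theta> * u) * \<rho> (v - u)))"
    by (simp add: algebra_simps add_divide_distrib diff_divide_distrib)
  also have "\<dots> = 1 / 2 * (LBINT u:{0..s}. exp (\<theta> * u) * \<rho> u) + \<rho> v / 2 * ((exp (\<theta> * s) - 1) / \<theta>)
      - 1 / 2 * (exp (\<theta> * v) * (laplace_upto v - laplace_upto (v - s)))"
    using i by (simp add: set_integral_diff(2) set_integral_add(2) set_integral_diff(1) set_integral_add(1)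
        set_integrable_mult_right set_integral_mult_right e integral_exp_rho_reflect[OF assms])
  finally have eq: "(\<integral>\<omega>. wiener 0 s \<omega> * G v \<omega> \<partial>M) = exp (\<theta> * s) * ((\<rho> s + \<rho> v - \<rho> (v - s)) / 2)
      - exp (\<theta> * 0) * ((\<rho> 0 + \<rho> v - \<rho> (v - 0)) / 2)
      - \<theta> * (1 / 2 * (LBINT u:{0..s}. exp (\<theta> * u) * \<rho> u) + \<rho> v / 2 * ((exp (\<theta> * s) - 1) / \<theta>)
        - 1 / 2 * (exp (\<theta> * v) * (laplace_upto v - laplace_upto (v - s))))" .
  have alg: "E * ((a + b - d) / 2) - 1 * ((0 + b - b) / 2) - \<theta> * (1 / 2 * P + b / 2 * ((E - 1) / \<theta>) - 1 / 2 * Q) =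
      ((E * a - \<theta> * P) + b - E * d + \<theta> * Q) / 2" for E a b d P Q :: real
    using \<theta> by (simp add: field_simps)
  show ?thesis
    unfolding eq mult_zero_right exp_zero rho_0 diff_zero alg by (rule refl)
qed

text \<open>
  As for \<open>Z\<close>, with \<open>U = \<integral>\<^sub>0\<^sup>s exp(\<theta>r) dG\<^sub>r\<close> in place of \<open>Z\<^sub>0\<close>. The formula for \<open>E(U G\<^sub>v)\<close>
  can be differentiated for \<open>v > s\<close>, because \<open>\<rho>\<close> is differentiable at the positive numbers \<open>v\<close>
  and \<open>v - s\<close>.
\<close>

lemma expectation_ou_X_mult:
  assumes "0 \<le> s" "s \<le> t"
  shows "(\<integral>\<omega>. X s \<omega> * X t \<omega> \<partial>M) = exp (- \<theta> * (t - s)) * (\<integral>\<omega>. (X s \<omega>)^2 \<partial>M) +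
    exp (- \<theta> * t) * exp (- \<theta> * s) / 2 * integral {s..t} (\<lambda>v. exp (\<theta> * v) * integral {0..s} (\<lambda>u.
      exp (\<theta> * u) * deriv (deriv \<rho>) (v - u)))"
proof -
  define K where "K v = exp (\<theta> * v) * integral {0..s} (\<lambda>u. exp (\<theta> * u) * deriv (deriv \<rho>) (v - u))" for v
  define \<psi> where "\<psi> v = (\<integral>\<omega>. wiener 0 s \<omega> * G v \<omega> \<partial>M)" for v
  define D where "D = exp (\<theta> * s) * \<rho> s - \<theta> * (LBINT u:{0..s}. exp (\<theta> * u) * \<rho> u)"
  define f where "f v = (D + \<rho> v - exp (\<theta> * s) * \<rho> (v - s)
      + \<theta> * (exp (\<theta> * v) * (laplace_upto v - laplace_upto (v - s)))) / 2" for v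
  define f' where "f' v = exp (\<theta> * v) * (antideriv v - antideriv (v - s)) / 2" for v
  have \<psi>: "\<psi> v = f v" if "s \<le> v" for v
    using that assms by (simp add: \<psi>_def f_def D_def expectation_wiener_G)
  have K: "exp (\<theta> * v) * f' v = K v / 2" if "s < v" for v
    using integral_unique[OF integral_exp_deriv_deriv_rho[of 0 s v]] that assms by (simp add: K_def f'_def)
  have f': "(f has_real_derivative f' v) (at v)" if "s < v" for v
  proof -
    have e: "exp (\<theta> * v) * (exp (- \<theta> * v) * x) = x"
      "exp (\<theta> * v) * (exp (- \<theta> * (v - s)) * x) = exp (\<theta> * s) * x" for x :: real
      by (simp_all add: mult.assoc[symmetric] exp_add[symmetric] right_diff_distrib)
    have shift: "((\<lambda>v. \<rho> (v - s)) has_real_derivative deriv \<rho> (v - s)) (at v)"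
      "((\<lambda>v. laplace_upto (v - s)) has_real_derivative exp (- \<theta> * (v - s)) * \<rho> (v - s)) (at v)"
      using that DERIV_shift[of \<rho> "deriv \<rho> (v - s)" v "- s"] DERIV_rho[of "v - s"]
        DERIV_shift[of laplace_upto "exp (- \<theta> * (v - s)) * \<rho> (v - s)" v "- s"]
        DERIV_laplace_upto[of "v - s"] by simp_all
    let ?D = "deriv \<rho> v - exp (\<theta> * s) * deriv \<rho> (v - s)
        + \<theta> * (\<theta> * exp (\<theta> * v) * (laplace_upto v - laplace_upto (v - s))
        + exp (\<theta> * v) * (exp (- \<theta> * v) * \<rho> v - exp (- \<theta> * (v - s)) * \<rho> (v - s)))"
    have "((\<lambda>v. D + \<rho> v - exp (\<theta> * s) * \<rho> (v - s)
      + \<theta> * (exp (\<theta> * v) * (laplace_upto v - laplace_upto (v - s)))) has_real_derivative ?D) (at v)"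
      using that assms
      by (auto intro!: derivative_eq_intros shift DERIV_rho DERIV_laplace_upto simp: algebra_simps)
    from DERIV_cdivide[OF this, of 2] have "(f has_real_derivative ?D / 2) (at v)"
      unfolding f_def[abs_def] .
    moreover have "?D / 2 = f' v"
      unfolding f'_def antideriv_def right_diff_distrib[of "exp (\<theta> * v)"] distrib_left[of "exp (\<theta> * v)"] e
      by (simp add: algebra_simps power2_eq_square)
    ultimately show ?thesis
      by simp
  qed
  have "((\<lambda>v. exp (\<theta> * v) * f' v) has_integral
      (exp (\<theta> * t) * f t - exp (\<theta> * s) * f s - \<theta> * (LBINT v:{s..t}. exp (\<theta> * v) * f v))) {s..t}"
  proof (rule exp_mult_deriv_has_integral[OF \<open>s \<le> t\<close>])
    show "continuous_on {s..t} f"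
      unfolding f_def[abs_def] using assms
      by (intro continuous_intros continuous_on_compose2[OF continuous_on_rho[of UNIV]]
          continuous_on_compose2[OF continuous_on_laplace_upto[of t]]) auto
  qed (rule f')
  moreover have "(LBINT v:{s..t}. exp (\<theta> * v) * f v) = (LBINT v:{s..t}. exp (\<theta> * v) * \<psi> v)"
    by (intro set_lebesgue_integral_cong) (auto simp: \<psi>)
  moreover have "f t = \<psi> t" "f s = \<psi> s"
    using \<psi> assms by simp_all
  ultimately have "((\<lambda>v. exp (\<theta> * v) * f' v) has_integral (\<integral>\<omega>. wiener 0 s \<omega> * wiener s t \<omega> \<partial>M)) {s..t}"
    by (simp add: expectation_mult_wiener square_integrable_wiener \<psi>_def)
  then have "((\<lambda>v. K v / 2) has_integral (\<integral>\<omega>. wiener 0 s \<omega> * wiener s t \<omega> \<partial>M)) {s..t}"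
    by (rule has_integral_spike_finite[of "{s}", rotated 2]) (use K in auto)
  then have W: "(\<integral>\<omega>. wiener 0 s \<omega> * wiener s t \<omega> \<partial>M) = integral {s..t} K / 2"
    by (auto dest!: integral_unique)
  have WW: "integrable M (\<lambda>\<omega>. wiener 0 s \<omega> * wiener s t \<omega>)"
    by (intro square_integrable_mult square_integrable_wiener) simp_all
  define V where "V = (\<integral>\<omega>. (wiener 0 s \<omega>)^2 \<partial>M)"
  have "(\<integral>\<omega>. X s \<omega> * X t \<omega> \<partial>M) =
      (\<integral>\<omega>. exp (- \<theta> * s) * exp (- \<theta> * t) * ((wiener 0 s \<omega>)^2 + wiener 0 s \<omega> * wiener s t \<omega>) \<partial>M)"
    using assms
    by (intro Bochner_Integration.integral_cong)
       (auto simp: ou_X_eq wiener_split[of _ 0 s t] power2_eq_square algebra_simps)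
  also have "\<dots> = exp (- \<theta> * s) * exp (- \<theta> * t) * (V + (\<integral>\<omega>. wiener 0 s \<omega> * wiener s t \<omega> \<partial>M))"
    using square_integrable_wiener WW by (simp add: V_def)
  finally have 1: "(\<integral>\<omega>. X s \<omega> * X t \<omega> \<partial>M) =
      exp (- \<theta> * s) * exp (- \<theta> * t) * V + exp (- \<theta> * t) * exp (- \<theta> * s) / 2 * integral {s..t} K"
    unfolding W by (simp add: algebra_simps)
  have "(\<integral>\<omega>. (X s \<omega>)^2 \<partial>M) = (\<integral>\<omega>. (exp (- \<theta> * s))^2 * (wiener 0 s \<omega>)^2 \<partial>M)"
    using assms by (intro Bochner_Integration.integral_cong) (auto simp: ou_X_eq power_mult_distrib)
  then have "exp (- \<theta> * (t - s)) * (\<integral>\<omega>. (X s \<omega>)^2 \<partial>M) = exp (- \<theta> * (t - s)) * (exp (- \<theta> * s))^2 * V"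
    by (simp add: V_def)
  also have "exp (- \<theta> * (t - s)) * (exp (- \<theta> * s))^2 = exp (- \<theta> * s) * exp (- \<theta> * t)"
    by (simp add: power2_eq_square exp_add[symmetric] algebra_simps)
  finally show ?thesis
    using 1 by (simp add: K_def[abs_def])
qed

end

end

section \<open>From moment and path assumptions to the theorem\<close>

lemma tendsto_abs_powr_0:
  fixes a x :: real
  assumes "a > 0"
  shows "((\<lambda>t. \<bar>t - x\<bar> powr a) \<longlongrightarrow> 0) (at x)"
proof -
  have "((\<lambda>t. \<bar>t - x\<bar>) \<longlongrightarrow> \<bar>x - x\<bar>) (at x)"
    by (intro tendsto_intros)
  then have "((\<lambda>t. \<bar>t - x\<bar> powr a) \<longlongrightarrow> 0 powr a) (at x)"
    using assms by (intro tendsto_powr2) (auto intro: always_eventually)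
  then show ?thesis
    by simp
qed

lemma continuous_on_holder_path:
  assumes "holder_paths M G \<gamma>" "0 < \<gamma>" "\<omega> \<in> space M"
  shows "continuous_on UNIV (\<lambda>t. G t \<omega>)"
proof (rule continuous_at_imp_continuous_on, rule ballI)
  fix x :: real
  have "0 < \<gamma> / 2 \<and> \<gamma> / 2 < \<gamma>"
    using \<open>0 < \<gamma>\<close> by simp
  then obtain C where C: "\<forall>s\<in>{x - 1..x + 1}. \<forall>t\<in>{x - 1..x + 1}. \<bar>G t \<omega> - G s \<omega>\<bar> \<le> C * \<bar>t - s\<bar> powr (\<gamma> - \<gamma> / 2)"
    using assms unfolding holder_paths_def by meson
  have "((\<lambda>t. G t \<omega> - G x \<omega>) \<longlongrightarrow> 0) (at x)"
  proof (rule Lim_null_comparison)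
    have "\<forall>\<^sub>F t in at x. t \<in> {x - 1<..<x + 1}"
      by (rule eventually_at_in_open') auto
    then show "\<forall>\<^sub>F t in at x. norm (G t \<omega> - G x \<omega>) \<le> C * \<bar>t - x\<bar> powr (\<gamma> / 2)"
      by eventually_elim (use C in auto)
    show "((\<lambda>t. C * \<bar>t - x\<bar> powr (\<gamma> / 2)) \<longlongrightarrow> 0) (at x)"
      using \<open>0 < \<gamma>\<close> by (intro tendsto_mult_right_zero tendsto_abs_powr_0) simp
  qed
  then show "isCont (\<lambda>t. G t \<omega>) x"
    by (simp add: isCont_def LIM_zero_iff)
qed

text \<open>
  The moment of order \<open>2/\<gamma> \<ge> 2\<close> of an increment is of the order of the squared time difference,
  as chaining requires. The moment of order \<open>2\<close> gives \<open>\<rho>(t) \<le> c |t|^(2\<gamma>)\<close>, which is at most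
  \<open>c (1 + t^2)\<close> and tends to \<open>0\<close> at the origin.
\<close>

lemma ou_driver_L2I:
  fixes M :: "'a measure" and G :: "real \<Rightarrow> 'a \<Rightarrow> real"
  assumes "prob_space M" and process: "measurable_process M G" and increments: "stationary_increments M G"
    and A: "assumption_A M G \<gamma>" and holder: "holder_paths M G \<gamma>" and \<theta>: "\<theta> > 0"
  obtains c where "ou_driver_L2 M G \<theta> c" "isCont (rho M G) 0"
proof -
  interpret prob_space M
    by fact
  have \<gamma>: "0 < \<gamma>" "\<gamma> < 1" and G_0: "AE \<omega> in M. G 0 \<omega> = 0"
    using A by (auto simp: assumption_A_def)
  have moments: "\<exists>c>0. \<forall>s t. integrable M (\<lambda>\<omega>. \<bar>G t \<omega> - G s \<omega>\<bar> powr q) \<and>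
      (\<integral>\<omega>. \<bar>G t \<omega> - G s \<omega>\<bar> powr q \<partial>M) \<le> c * \<bar>t - s\<bar> powr (q * \<gamma>)" if "q \<ge> 2" for q
    using A that by (auto simp: assumption_A_def)
  have paths: "continuous_on UNIV (\<lambda>t. G t \<omega>)" if "\<omega> \<in> space M" for \<omega>
    using holder \<gamma>(1) that by (rule continuous_on_holder_path)
  have [measurable]: "G t \<in> borel_measurable M" for t
    using measurable_compose[OF measurable_Pair1'[of t borel M] process[unfolded measurable_process_def]]
    by simp
  have growth: "AE \<omega> in M. \<exists>C. \<forall>t\<le>0. \<bar>G t \<omega>\<bar> \<le> C * (1 + t^2)"
  proof -
    have q: "2 / \<gamma> \<ge> 2" "2 / \<gamma> * \<gamma> = 2"
      using \<gamma> by (auto simp: field_simps)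
    obtain c where c: "c > 0" "\<And>s t. integrable M (\<lambda>\<omega>. \<bar>G t \<omega> - G s \<omega>\<bar> powr (2 / \<gamma>))"
      "\<And>s t. (\<integral>\<omega>. \<bar>G t \<omega> - G s \<omega>\<bar> powr (2 / \<gamma>) \<partial>M) \<le> c * \<bar>t - s\<bar> powr 2"
      using moments[OF q(1)] unfolding q(2) by blast
    have "AE \<omega> in M. \<exists>C. \<forall>t\<le>0. \<bar>G t \<omega> - G 0 \<omega>\<bar> \<le> C * (1 + t^2)"
      by (rule AE_quadratic_growth[of G "2 / \<gamma>" c]) (use c q(1) paths in auto)
    then show ?thesis
      using G_0 by eventually_elim simp
  qed
  obtain c where c: "c > 0" and int: "\<And>s t. integrable M (\<lambda>\<omega>. \<bar>G t \<omega> - G s \<omega>\<bar> powr 2)"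
    and mom: "\<And>s t. (\<integral>\<omega>. \<bar>G t \<omega> - G s \<omega>\<bar> powr 2 \<partial>M) \<le> c * \<bar>t - s\<bar> powr (2 * \<gamma>)"
    using moments[of 2] by auto
  have rho_le: "rho M G t \<le> c * \<bar>t\<bar> powr (2 * \<gamma>)" for t
  proof -
    have "rho M G t = (\<integral>\<omega>. \<bar>G t \<omega> - G 0 \<omega>\<bar> powr 2 \<partial>M)"
      unfolding rho_def using G_0 by (intro integral_cong_AE) auto
    then show ?thesis
      using mom[of t 0] by simp
  qed
  have powr_le: "\<bar>t\<bar> powr (2 * \<gamma>) \<le> 1 + t^2" for t
  proof (cases "\<bar>t\<bar> \<le> 1")
    case True
    then have "\<bar>t\<bar> powr (2 * \<gamma>) \<le> 1 powr (2 * \<gamma>)"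
      using \<gamma> by (intro powr_mono2) auto
    then show ?thesis
      by (simp add: add_increasing2)
  next
    case False
    then have "\<bar>t\<bar> powr (2 * \<gamma>) \<le> \<bar>t\<bar> powr 2"
      using \<gamma> by (intro powr_mono) auto
    then show ?thesis
      by simp
  qed
  show thesis
  proof (rule that)
    show "ou_driver_L2 M G \<theta> c"
    proof
      show "integrable M (\<lambda>\<omega>. (G t \<omega> - G s \<omega>)^2)" for s t
        using int[of t s] by simp
      show "rho M G t \<le> c * (1 + t^2)" for t
        using c by (intro order.trans[OF rho_le mult_left_mono[OF powr_le]]) simp
    qed (use process increments paths growth \<theta> G_0 in auto)
    have "rho M G 0 = 0"
      using rho_le[of 0] \<gamma> by (simp add: rho_def order_antisym)
    moreover have "(rho M G \<longlongrightarrow> 0) (at 0)"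
    proof (rule Lim_null_comparison)
      show "\<forall>\<^sub>F t in at 0. norm (rho M G t) \<le> c * \<bar>t - 0\<bar> powr (2 * \<gamma>)"
        using rho_le by (auto simp: rho_def)
      show "((\<lambda>t. c * \<bar>t - 0\<bar> powr (2 * \<gamma>)) \<longlongrightarrow> 0) (at 0)"
        using \<gamma> by (intro tendsto_mult_right_zero tendsto_abs_powr_0) simp
    qed
    ultimately show "isCont (rho M G) 0"
      by (simp add: isCont_def)
  qed
qed

lemma (in ou_driver_L2) integrable_ou_Z_mult:
  assumes "s \<ge> 0" "t \<ge> 0"
  shows "integrable M (\<lambda>\<omega>. Z s \<omega> * Z t \<omega>)"
  using assms by (intro square_integrable_mult square_integrable_ou_Z) simp_all

lemma (in ou_driver_L2) integrable_ou_X_mult: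
  assumes "s \<ge> 0" "t \<ge> 0"
  shows "integrable M (\<lambda>\<omega>. X s \<omega> * X t \<omega>)"
proof (subst Bochner_Integration.integrable_cong[OF refl])
  show "X s \<omega> * X t \<omega> = exp (- \<theta> * s) * exp (- \<theta> * t) * (wiener 0 s \<omega> * wiener 0 t \<omega>)"
    if "\<omega> \<in> space M" for \<omega>
    using that assms by (simp add: ou_X_eq mult_ac)
  show "integrable M (\<lambda>\<omega>. exp (- \<theta> * s) * exp (- \<theta> * t) * (wiener 0 s \<omega> * wiener 0 t \<omega>))"
    by (intro integrable_mult_right square_integrable_mult square_integrable_wiener) simp_all
qed

theorem theorem3p1:
  fixes M :: "'a measure" and G :: "real \<Rightarrow> 'a \<Rightarrow> real" and \<gamma> \<theta> :: real
  assumes "prob_space M"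
    and "measurable_process M G"
    and "stationary_increments M G"
    and "assumption_A M G \<gamma>"
    and "holder_paths M G \<gamma>"
    and "\<theta> > 0"
  shows
    "((AE \<omega> in M. \<forall>t\<ge>0.
          has_rs_integral_bot (\<lambda>s. exp (- \<theta> * (t - s))) (\<lambda>s. G s \<omega>) t (ou_Z \<theta> G t \<omega>)) \<and>
      (AE \<omega> in M.
          (let z0 = rs_integral_bot (\<lambda>s. exp (\<theta> * s)) (\<lambda>s. G s \<omega>) 0 in
             solves_langevin \<theta> (\<lambda>t. G t \<omega>) z0 (\<lambda>t. ou_Z \<theta> G t \<omega>) \<and>
             (\<forall>z. solves_langevin \<theta> (\<lambda>t. G t \<omega>) z0 z \<longrightarrow> (\<forall>t\<ge>0. z t = ou_Z \<theta> G t \<omega>)))) \<and>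
      stationary_process M (ou_Z \<theta> G))
     \<and>
     (C2_off_zero (rho M G) \<longrightarrow>
       (\<forall>s\<ge>0. \<forall>t\<ge>0. integrable M (\<lambda>\<omega>. ou_Z \<theta> G s \<omega> * ou_Z \<theta> G t \<omega>) \<and>
                     integrable M (\<lambda>\<omega>. ou_X \<theta> G s \<omega> * ou_X \<theta> G t \<omega>)) \<and>
       (\<forall>t\<ge>0.
          iterated_converges
            (\<lambda>u v. exp (\<theta> * u) * exp (\<theta> * v) * deriv (deriv (rho M G)) (v - u)) {..0} 0 t \<longrightarrow>
          (\<integral>\<omega>. ou_Z \<theta> G t \<omega> * ou_Z \<theta> G 0 \<omega> \<partial>M) =
            exp (- \<theta> * t) * (\<integral>\<omega>. (ou_Z \<theta> G 0 \<omega>)\<^sup>2 \<partial>M) +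
            exp (- \<theta> * t) / 2 *
              integral {0..t} (\<lambda>v. integral {..0} (\<lambda>u.
                exp (\<theta> * u) * exp (\<theta> * v) * deriv (deriv (rho M G)) (v - u)))) \<and>
       (\<forall>s t. 0 \<le> s \<and> s \<le> t \<longrightarrow>
          iterated_converges
            (\<lambda>u v. exp (\<theta> * v) * (exp (\<theta> * u) * deriv (deriv (rho M G)) (v - u))) {0..s} s t \<longrightarrow>
          (\<integral>\<omega>. ou_X \<theta> G s \<omega> * ou_X \<theta> G t \<omega> \<partial>M) =
            exp (- \<theta> * (t - s)) * (\<integral>\<omega>. (ou_X \<theta> G s \<omega>)\<^sup>2 \<partial>M) +
            exp (- \<theta> * t) * exp (- \<theta> * s) / 2 *
              integral {s..t} (\<lambda>v. exp (\<theta> * v) * integral {0..s} (\<lambda>u.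
                exp (\<theta> * u) * deriv (deriv (rho M G)) (v - u)))) \<and>
       (\<exists>C>0. \<forall>t\<ge>0.
          \<bar>(\<integral>\<omega>. (ou_X \<theta> G t \<omega>)\<^sup>2 \<partial>M) - (\<integral>\<omega>. (ou_Z \<theta> G 0 \<omega>)\<^sup>2 \<partial>M)\<bar> \<le> C * exp (- \<theta> * t)) \<and>
       (\<lambda>t. exp (- \<theta> * t) * rho M G t) integrable_on {0..} \<and>
       (\<integral>\<omega>. (ou_Z \<theta> G 0 \<omega>)\<^sup>2 \<partial>M) =
         \<theta> / 2 * integral {0..} (\<lambda>t. exp (- \<theta> * t) * rho M G t))"
proof -
  obtain c where L2: "ou_driver_L2 M G \<theta> c" and cont_0: "isCont (rho M G) 0"
    using ou_driver_L2I[OF assms] by blast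
  interpret ou_driver_L2 M G \<theta> c
    by (rule L2)
  have improper: "AE \<omega> in M. \<forall>t\<ge>0. has_rs_integral_bot (\<lambda>s. exp (- \<theta> * (t - s))) (\<lambda>s. G s \<omega>) t (ou_Z \<theta> G t \<omega>)"
    using AE_ou_Z by eventually_elim blast
  have close: "\<exists>C>0. \<forall>t\<ge>0. \<bar>(\<integral>\<omega>. (ou_X \<theta> G t \<omega>)^2 \<partial>M) - (\<integral>\<omega>. (ou_Z \<theta> G 0 \<omega>)^2 \<partial>M)\<bar> \<le> C * exp (- \<theta> * t)"
  \<comment> \<open>the summand \<open>1\<close> keeps the constant positive when the variance vanishes\<close>
  proof (intro exI[of _ "3 * (\<integral>\<omega>. (ou_Z \<theta> G 0 \<omega>)^2 \<partial>M) + 1"] conjI allI impI)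
    show "0 < 3 * (\<integral>\<omega>. (ou_Z \<theta> G 0 \<omega>)^2 \<partial>M) + 1"
      by (intro add_nonneg_pos) simp_all
    fix t :: real
    assume "t \<ge> 0"
    show "\<bar>(\<integral>\<omega>. (ou_X \<theta> G t \<omega>)^2 \<partial>M) - (\<integral>\<omega>. (ou_Z \<theta> G 0 \<omega>)^2 \<partial>M)\<bar>
        \<le> (3 * (\<integral>\<omega>. (ou_Z \<theta> G 0 \<omega>)^2 \<partial>M) + 1) * exp (- \<theta> * t)"
      by (rule order.trans[OF expectation_ou_X_square_close[OF \<open>t \<ge> 0\<close>]]) (simp add: distrib_right)
  qed
  have laplace: "(\<lambda>t. exp (- \<theta> * t) * rho M G t) integrable_on {0..}"
    "laplace_rho = integral {0..} (\<lambda>t. exp (- \<theta> * t) * rho M G t)"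
    unfolding laplace_rho_def using set_borel_integral_eq_integral[OF set_integrable_exp_rho] by blast+
  show ?thesis
  proof (intro conjI impI allI)
    show "stationary_process M (ou_Z \<theta> G)"
      by (rule stationary_ou_Z)
  next
    show "(\<integral>\<omega>. (ou_Z \<theta> G 0 \<omega>)^2 \<partial>M) = \<theta> / 2 * integral {0..} (\<lambda>t. exp (- \<theta> * t) * rho M G t)"
      using expectation_ou_Z_0_square unfolding laplace(2) .
  qed ((rule improper AE_ou_Z_langevin close laplace(1) integrable_ou_Z_mult integrable_ou_X_mult; assumption)
    | (rule expectation_ou_Z_mult[OF _ cont_0]; simp add: iterated_converges_def)
    | (rule expectation_ou_X_mult[OF _ cont_0]; simp))+
qed

end
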